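(* Let $S$ be a set of $2n$ points in the plane in general position (no three collinear), with $n$ even, and let $M$ be a perfect matching of $S$. Then there is a matching $M'$ of $S$ with at least $\tfrac15(4n-1)$ segments such that $M$ and $M'$ are compatible and disjoint.
   Context: A geometric graph has straight-segment edges joining points of its vertex set; it is non-crossing if two edges meet at most in a common endpoint. A matching of $S$ is a non-crossing geometric graph with vertex set $S$ in which every vertex has degree at most one; it is perfect if every vertex has degree exactly one. Two non-crossing geometric graphs are compatible if they have the same vertex set and their union is non-crossing, and disjoint if they share no edge. *)

theory Defs
  imports "HOL-Analysis.Analysis"
begin

type_synonym point = "real ^ 2"

definition general_position :: "point set \<Rightarrow> bool" where
  "general_position S \<longleftrightarrow>
     (\<forall>a\<in>S. \<forall>b\<in>S. \<forall>c\<in>S. a \<noteq> b \<longrightarrow> a \<noteq> c \<longrightarrow> b \<noteq> c \<longrightarrow> \<not> collinear {a, b, c})"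

text \<open>A geometric graph is given by its finite vertex set \<open>S\<close> and its edge set \<open>E\<close>. An edge is
  stored as the two-element set of its endpoints; the segment it stands for is its convex hull
  (see \<open>segment_convex_hull\<close>).\<close>

definition geometric_graph :: "point set \<Rightarrow> point set set \<Rightarrow> bool" where
  "geometric_graph S E \<longleftrightarrow> finite S \<and> (\<forall>e\<in>E. \<exists>a\<in>S. \<exists>b\<in>S. a \<noteq> b \<and> e = {a, b})"

text \<open>Distinct edges share at most one endpoint, so \<open>e \<inter> f\<close> below is empty or the single common
  endpoint.\<close>

definition non_crossing :: "point set set \<Rightarrow> bool" where
  "non_crossing E \<longleftrightarrow>
     (\<forall>e\<in>E. \<forall>f\<in>E. e \<noteq> f \<longrightarrow> convex hull e \<inter> convex hull f \<subseteq> e \<inter> f)"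

definition non_crossing_geometric_graph :: "point set \<Rightarrow> point set set \<Rightarrow> bool" where
  "non_crossing_geometric_graph S E \<longleftrightarrow> geometric_graph S E \<and> non_crossing E"

definition degree :: "point set set \<Rightarrow> point \<Rightarrow> nat" where
  "degree E v = card {e \<in> E. v \<in> e}"

definition matching :: "point set \<Rightarrow> point set set \<Rightarrow> bool" where
  "matching S E \<longleftrightarrow> non_crossing_geometric_graph S E \<and> (\<forall>v\<in>S. degree E v \<le> 1)"

definition perfect_matching :: "point set \<Rightarrow> point set set \<Rightarrow> bool" where
  "perfect_matching S E \<longleftrightarrow> matching S E \<and> (\<forall>v\<in>S. degree E v = 1)"

text \<open>The common vertex set of the two graphs is the parameter \<open>S\<close>.\<close>

definition compatible :: "point set \<Rightarrow> point set set \<Rightarrow> point set set \<Rightarrow> bool" where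
  "compatible S E F \<longleftrightarrow>
     non_crossing_geometric_graph S E \<and> non_crossing_geometric_graph S F \<and> non_crossing (E \<union> F)"

end

theory Submission
  imports Defs
begin

text \<open>
  Extend every segment to the left until it hits another segment or an extension (or leaves a large
  disk), and then to the right; this cuts the disk into convex cells. Every endpoint lies on the
  boundary of two cells, one on each side of its segment, and can be assigned to either of them, so
  the endpoints are the edges of a dual graph on the cells. A segment between two endpoints assigned
  to the same cell crosses no given segment.

  With the right endpoints as its only edges, the dual graph is connected, since the right extensions
  come last and the left extensions form a forest. Hence there are at most \<open>n + 1\<close> cells, and, \<open>n\<close> being
  even, the right endpoints can be assigned so that every cell receives an even number of them. With the left
  endpoints as edges, the graph need not be connected, but it is simple and planar: sweeping a
  vertical line shows that any \<open>k \<ge> 2\<close> cells span at most \<open>3 k - 5\<close> edges. The left endpoints can be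
  assigned with at most one odd cell in each component, necessarily a component with an odd number of
  edges, and the edge bound yields \<open>n + 5 o \<le> 3 (n + 1)\<close> for the number \<open>o\<close> of odd cells. One left
  endpoint is dropped in each odd cell.

  In each cell the remaining endpoints can be paired left with left and right with right, avoiding
  the given segments. Among all pairings within cells that avoid them, one of minimal total length is
  non-crossing: of the two ways to uncross two segments, at least one avoids the given matching.
\<close>

subsection \<open>Parity of orientations\<close>

text \<open>The constant rests on parity twice. Since \<open>n\<close> is even, the number
  \<open>o\<close> of odd cells is even too, and this sharpens \<open>5 o <= 2 n + 3\<close> to
  \<open>5 o <= 2 n + 2\<close>; the \<open>2 n - o\<close> endpoints that remain form at least
  \<open>(4 n - 1) / 5\<close> pairs. The bound \<open>3 k - 5\<close>, instead of the
  \<open>3 k - 6\<close> of planar graphs, is the form that still holds for \<open>k = 2\<close>,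
  and its 5 is what one odd cell costs in each component; a component that is a single cell has no
  edge and so no odd cell.

  The obstacle is that both ends of one segment may be assigned to the same cell, so that pairing
  inside the cell could return the segment itself. Pairing only ends of the same kind excludes this,
  which is why left and right endpoints are balanced separately. Uncrossing may mix the kinds, so
  the minimum is taken over all pairings within cells that never join the two ends of one segment.

  The order of the extensions matters because only right extensions can end on a right extension:
  agreement of colours at the right endpoints spreads first along these, in order of abscissa, and
  then to the left.\<close>

text \<open>Connectivity of \<open>V\<close> in terms of cuts: no two-colouring separates \<open>V\<close> unless some edge changes
  colour. The vertices outside \<open>V\<close> do not matter.\<close>

definition graph_connected :: "'i set \<Rightarrow> ('i \<Rightarrow> 'v) \<Rightarrow> ('i \<Rightarrow> 'v) \<Rightarrow> 'v set \<Rightarrow> bool" where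
  "graph_connected I s t V \<longleftrightarrow>
     (\<forall>f :: 'v \<Rightarrow> bool. (\<forall>i\<in>I. f (s i) = f (t i)) \<longrightarrow> (\<forall>u\<in>V. \<forall>v\<in>V. f u = f v))"

text \<open>Contract one edge with \<open>\<pi>\<close>. A colouring of the contracted graph pulls
  back to one that does not change across this edge, so the cut condition survives, and contraction
  loses at most one vertex. Finiteness is part of the conclusion because this is how the cells are
  shown to be finite.\<close>

lemma card_vertices_le_Suc_card_edges:
  fixes s t :: "'i \<Rightarrow> 'v"
  assumes "finite I" and "graph_connected I s t V"
  shows "finite V \<and> card V \<le> Suc (card I)"
  using assms
proof (induction I arbitrary: s t V rule: finite_induct)
  case empty
  have eq: "u = v" if "u \<in> V" "v \<in> V" for u v
    using empty(1)[unfolded graph_connected_def, rule_format, of "\<lambda>x. x = u" u v] that by auto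
  show ?case
  proof (cases "V = {}")
    case False
    then obtain u where "V = {u}" using eq by blast
    then show ?thesis by simp
  qed simp
next
  case (insert i I)
  define \<pi> where "\<pi> x = (if x = t i then s i else x)" for x
  have conn: "graph_connected I (\<pi> \<circ> s) (\<pi> \<circ> t) (\<pi> ` V)"
    unfolding graph_connected_def
  proof (intro allI impI)
    fix f :: "'v \<Rightarrow> bool"
    assume f: "\<forall>j\<in>I. f ((\<pi> \<circ> s) j) = f ((\<pi> \<circ> t) j)"
    have "\<forall>j\<in>insert i I. (f \<circ> \<pi>) (s j) = (f \<circ> \<pi>) (t j)"
      using f by (simp add: \<pi>_def)
    then have "\<forall>u\<in>V. \<forall>v\<in>V. (f \<circ> \<pi>) u = (f \<circ> \<pi>) v"
      by (rule insert.prems[unfolded graph_connected_def, THEN spec, THEN mp])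
    then show "\<forall>u\<in>\<pi> ` V. \<forall>v\<in>\<pi> ` V. f u = f v"
      unfolding ball_simps comp_def .
  qed
  have "finite (\<pi> ` V) \<and> card (\<pi> ` V) \<le> Suc (card I)"
    by (rule insert.IH[OF conn])
  moreover have sub: "V \<subseteq> insert (t i) (\<pi> ` V)"
  proof
    fix x assume "x \<in> V"
    then have "\<pi> x \<in> \<pi> ` V" by (rule imageI)
    then show "x \<in> insert (t i) (\<pi> ` V)" by (cases "x = t i") (simp_all add: \<pi>_def)
  qed
  ultimately have "finite V" using finite_subset by blast
  moreover have "card V \<le> Suc (card (\<pi> ` V))"
  proof -
    have "card V \<le> card (insert (t i) (\<pi> ` V))"
      using \<open>finite V\<close> by (intro card_mono sub) simp
    also have "\<dots> \<le> Suc (card (\<pi> ` V))"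
      using \<open>finite V\<close> by (simp add: card_insert_if)
    finally show ?thesis .
  qed
  ultimately show ?case
    using \<open>finite (\<pi> ` V) \<and> card (\<pi> ` V) \<le> Suc (card I)\<close> insert.hyps by simp
qed

text \<open>Here \<open>h i\<close> is the head chosen for edge \<open>i\<close>. In the application
  an edge is an endpoint of a segment and its head is the cell that receives the endpoint.\<close>

definition indeg :: "'i set \<Rightarrow> ('i \<Rightarrow> 'v) \<Rightarrow> 'v \<Rightarrow> nat" where
  "indeg I h v = card {i \<in> I. h i = v}"

definition orients :: "'i set \<Rightarrow> ('i \<Rightarrow> 'v) \<Rightarrow> ('i \<Rightarrow> 'v) \<Rightarrow> ('i \<Rightarrow> 'v) \<Rightarrow> bool" where
  "orients I s t h \<longleftrightarrow> (\<forall>i\<in>I. h i = s i \<or> h i = t i)"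

definition edge_rel :: "'i set \<Rightarrow> ('i \<Rightarrow> 'v) \<Rightarrow> ('i \<Rightarrow> 'v) \<Rightarrow> ('v \<times> 'v) set" where
  "edge_rel I s t = (\<lambda>i. (s i, t i)) ` I \<union> (\<lambda>i. (t i, s i)) ` I"

lemma sym_edge_rel: "sym (edge_rel I s t)"
  by (auto simp: edge_rel_def sym_def)

lemma edge_rel_connected_iff:
  "(u, v) \<in> (edge_rel I s t)\<^sup>* \<longleftrightarrow> (v, u) \<in> (edge_rel I s t)\<^sup>*"
  using sym_rtrancl[OF sym_edge_rel] by (meson symE)

lemma indeg_fun_upd:
  assumes "finite I" "i \<in> I" "h i \<noteq> w"
  shows "odd (indeg I (h(i := w)) x) \<longleftrightarrow> (odd (indeg I h x) \<noteq> (x = h i \<or> x = w))"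
proof -
  have *: "indeg I g x = (if g i = x then 1 else 0) + card {j \<in> I - {i}. g j = x}" for g
  proof -
    have "{j \<in> I. g j = x} = (if g i = x then {i} else {}) \<union> {j \<in> I - {i}. g j = x}"
      using assms(2) by auto
    then show ?thesis unfolding indeg_def using assms(1) by (auto simp: card_insert_if)
  qed
  have "{j \<in> I - {i}. (h(i := w)) j = x} = {j \<in> I - {i}. h j = x}" by auto
  then show ?thesis using assms(3) *[of h] *[of "h(i := w)"] by auto
qed

text \<open>Reverse the edges of the walk one after the other. Each reversal toggles both ends of
  the edge, so an inner vertex is toggled twice for each visit and only the two ends of the walk
  change.\<close>

lemma toggle_parity_along_walk:
  assumes fin: "finite I" and walk: "(u, v) \<in> (edge_rel I s t)\<^sup>*" and h: "orients I s t h"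
  shows "\<exists>h'. orients I s t h' \<and>
    (\<forall>x. odd (indeg I h' x) \<longleftrightarrow> (odd (indeg I h x) \<noteq> ((x = u) \<noteq> (x = v))))"
  using walk
proof (induction rule: rtrancl_induct)
  case base
  then show ?case using h by blast
next
  case (step y z)
  then obtain h' where h': "orients I s t h'"
    "\<forall>x. odd (indeg I h' x) \<longleftrightarrow> (odd (indeg I h x) \<noteq> ((x = u) \<noteq> (x = y)))" by blast
  from step(2) obtain i where i: "i \<in> I" "(y = s i \<and> z = t i) \<or> (y = t i \<and> z = s i)"
    by (auto simp: edge_rel_def)
  show ?case
  proof (cases "y = z")
    case True
    then show ?thesis using h' by blast
  next
    case False
    \<comment> \<open>The end of edge \<open>i\<close> that is not its present head, so that the
      update reverses the edge.\<close>
    define w where "w = (if h' i = y then z else y)"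
    have hi: "h' i = y \<or> h' i = z" using h'(1) i by (auto simp: orients_def)
    have "orients I s t (h'(i := w))"
      using h'(1) i by (auto simp: orients_def w_def)
    moreover have "h' i \<noteq> w" using hi False by (auto simp: w_def)
    moreover have "(x = h' i \<or> x = w) \<longleftrightarrow> (x = y \<or> x = z)" for x
      using hi by (auto simp: w_def)
    ultimately have "odd (indeg I (h'(i := w)) x) \<longleftrightarrow> (odd (indeg I h' x) \<noteq> (x = y \<or> x = z))" for x
      using indeg_fun_upd[OF fin i(1), of h' w x] by simp
    then have "\<forall>x. odd (indeg I (h'(i := w)) x) \<longleftrightarrow> (odd (indeg I h x) \<noteq> ((x = u) \<noteq> (x = z)))"
      using h'(2) False by metis
    then show ?thesis using \<open>orients I s t (h'(i := w))\<close> by blast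
  qed
qed

text \<open>Minimise the number of odd vertices: two of them joined by a walk could be toggled
  together, which would leave fewer.\<close>

lemma ex_orientation_one_odd_per_component:
  fixes s t :: "'i \<Rightarrow> 'v"
  assumes fin: "finite I"
  shows "\<exists>h. orients I s t h \<and> (\<forall>u v. odd (indeg I h u) \<longrightarrow> odd (indeg I h v) \<longrightarrow>
           (u, v) \<in> (edge_rel I s t)\<^sup>* \<longrightarrow> u = v)"
proof -
  define odds where "odds h = {x. odd (indeg I h x)}" for h :: "'i \<Rightarrow> 'v"
  have fino: "finite (odds h)" for h
  proof (rule finite_subset)
    show "odds h \<subseteq> h ` I"
    proof
      fix x assume "x \<in> odds h"
      then have "{i \<in> I. h i = x} \<noteq> {}"
        unfolding odds_def indeg_def by (metis (no_types, lifting) card.empty even_zero mem_Collect_eq)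
      then show "x \<in> h ` I" by auto
    qed
  qed (use fin in simp)
  have "orients I s t s" by (simp add: orients_def)
  then obtain h where h: "orients I s t h"
    and min: "\<And>h'. orients I s t h' \<Longrightarrow> card (odds h) \<le> card (odds h')"
    using ex_has_least_nat[of "orients I s t" s "\<lambda>h. card (odds h)"] by auto
  have "u = v" if uv: "odd (indeg I h u)" "odd (indeg I h v)" "(u, v) \<in> (edge_rel I s t)\<^sup>*" for u v
  proof (rule ccontr)
    assume "u \<noteq> v"
    obtain h' where h': "orients I s t h'"
      "\<forall>x. odd (indeg I h' x) \<longleftrightarrow> (odd (indeg I h x) \<noteq> ((x = u) \<noteq> (x = v)))"
      using toggle_parity_along_walk[OF fin uv(3) h] by blast
    have "odds h' = odds h - {u, v}"
      using uv(1,2) h'(2) \<open>u \<noteq> v\<close> by (auto simp: odds_def)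
    then have "card (odds h') < card (odds h)"
      using uv(1) by (intro psubset_card_mono fino) (auto simp: odds_def)
    then show False using min[OF h'(1)] by simp
  qed
  then show ?thesis using h by blast
qed

lemma sum_indeg:
  assumes "finite I" "finite V" "h ` I \<subseteq> V"
  shows "(\<Sum>v\<in>V. indeg I h v) = card I"
  unfolding indeg_def using sum.group[OF assms, of "\<lambda>_. 1::nat"] by simp

text \<open>All of \<open>V\<close> is one component, so at most one vertex is odd; but the
  indegrees add up to the even number \<open>card I\<close>, so the number of odd vertices is
  even.\<close>

lemma ex_even_orientation:
  assumes fin: "finite I" and ev: "even (card I)" and sub: "s ` I \<union> t ` I \<subseteq> V"
    and conn: "graph_connected I s t V"
  shows "\<exists>h. orients I s t h \<and> (\<forall>v. even (indeg I h v))"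
proof -
  obtain h where h: "orients I s t h" and one: "\<And>u v. odd (indeg I h u) \<Longrightarrow> odd (indeg I h v) \<Longrightarrow>
           (u, v) \<in> (edge_rel I s t)\<^sup>* \<Longrightarrow> u = v"
    using ex_orientation_one_odd_per_component[OF fin, of s t] by blast
  have finV: "finite V" using card_vertices_le_Suc_card_edges[OF fin conn] by blast
  have hV: "h ` I \<subseteq> V" using h sub unfolding orients_def by blast
  have reach: "(u, v) \<in> (edge_rel I s t)\<^sup>*" if "u \<in> V" "v \<in> V" for u v
  proof -
    \<comment> \<open>Reachability from \<open>u\<close> is used as the two-colouring: no edge
      leaves the reachable set.\<close>
    have "((u, u) \<in> (edge_rel I s t)\<^sup>*) = ((u, v) \<in> (edge_rel I s t)\<^sup>*)"
    proof (rule conn[unfolded graph_connected_def, rule_format, where f = "\<lambda>x. (u, x) \<in> (edge_rel I s t)\<^sup>*"])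
      fix i assume "i \<in> I"
      then have "(s i, t i) \<in> edge_rel I s t" "(t i, s i) \<in> edge_rel I s t"
        by (auto simp: edge_rel_def)
      then show "((u, s i) \<in> (edge_rel I s t)\<^sup>*) = ((u, t i) \<in> (edge_rel I s t)\<^sup>*)"
        by (meson rtrancl.rtrancl_into_rtrancl)
    qed (use that in auto)
    then show ?thesis by blast
  qed
  have "even (card {v \<in> V. odd (indeg I h v)})"
    using sum_indeg[OF fin finV hV] ev even_sum_iff[OF finV, of "indeg I h"] by simp
  moreover have "card {v \<in> V. odd (indeg I h v)} \<le> 1"
    using one reach by (auto simp: card_le_Suc0_iff_eq finV)
  ultimately have "card {v \<in> V. odd (indeg I h v)} = 0" by (metis One_nat_def le_SucE odd_one le_zero_eq)
  then have inV: "even (indeg I h v)" if "v \<in> V" for v using finV that by auto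
  have "indeg I h v = 0" if "v \<notin> V" for v
    using hV that fin by (auto simp: indeg_def)
  then have "even (indeg I h v)" for v using inV by (cases "v \<in> V") auto
  then show ?thesis using h by blast
qed

text \<open>The bound holds in each component and is then summed. With at least two vertices, the
  sparsity bound has a surplus of 5, which pays for the single odd vertex that may occur. An
  isolated vertex has no edges, as loops are excluded, and hence indegree 0.\<close>

lemma ex_orientation_few_odd:
  assumes fin: "finite I" and finV: "finite V" and sub: "s ` I \<union> t ` I \<subseteq> V"
    and neq: "\<And>i. i \<in> I \<Longrightarrow> s i \<noteq> t i"
    and sparse: "\<And>K. K \<subseteq> V \<Longrightarrow> 2 \<le> card K \<Longrightarrow> card {i \<in> I. s i \<in> K \<and> t i \<in> K} + 5 \<le> 3 * card K"
  shows "\<exists>h. orients I s t h \<and> card I + 5 * card {v \<in> V. odd (indeg I h v)} \<le> 3 * card V"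
proof -
  obtain h where h: "orients I s t h" and one: "\<And>u v. odd (indeg I h u) \<Longrightarrow> odd (indeg I h v) \<Longrightarrow>
           (u, v) \<in> (edge_rel I s t)\<^sup>* \<Longrightarrow> u = v"
    using ex_orientation_one_odd_per_component[OF fin, of s t] by blast
  define c where "c u = (edge_rel I s t)\<^sup>* `` {u}" for u
  have c_iff: "c u = c v \<longleftrightarrow> (u, v) \<in> (edge_rel I s t)\<^sup>*" for u v
  proof
    assume "c u = c v"
    then have "v \<in> c u" by (auto simp: c_def)
    then show "(u, v) \<in> (edge_rel I s t)\<^sup>*" by (simp add: c_def)
  next
    assume "(u, v) \<in> (edge_rel I s t)\<^sup>*"
    moreover from this have "(v, u) \<in> (edge_rel I s t)\<^sup>*" using edge_rel_connected_iff by metis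
    ultimately show "c u = c v" unfolding c_def by (auto intro: rtrancl_trans)
  qed
  have cst: "c (s i) = c (t i)" if "i \<in> I" for i
    using that unfolding c_iff by (auto simp: edge_rel_def)
  let ?O = "{v \<in> V. odd (indeg I h v)}"
  have main: "card {i \<in> I. c (s i) = K} + 5 * card {v \<in> ?O. c v = K} \<le> 3 * card {v \<in> V. c v = K}"
    if K: "K \<in> c ` V" for K
  proof -
    let ?K = "{v \<in> V. c v = K}"
    have finK: "finite ?K" using finV by simp
    obtain u where u: "u \<in> ?K" using K by auto
    have le1: "card {v \<in> ?O. c v = K} \<le> 1"
      using one c_iff finV by (auto simp: card_le_Suc0_iff_eq)
    show ?thesis
    proof (cases "2 \<le> card ?K")
      case True
      have "{i \<in> I. s i \<in> ?K \<and> t i \<in> ?K} = {i \<in> I. c (s i) = K}"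
        using sub cst by auto
      then show ?thesis using sparse[OF _ True] le1 by auto
    next
      case False
      then have single: "v = u" if "v \<in> ?K" for v
        using that u finK by (metis (no_types, lifting) One_nat_def card_le_Suc0_iff_eq not_less_eq_eq numeral_2_eq_2)
      have e: "{i \<in> I. c (s i) = K} = {}"
      proof -
        have "False" if i: "i \<in> I" "c (s i) = K" for i
        proof -
          have "s i \<in> ?K" "t i \<in> ?K" using i cst[of i] sub by auto
          then show False using single neq[OF i(1)] by metis
        qed
        then show ?thesis by blast
      qed
      have o: "{v \<in> ?O. c v = K} = {}"
      proof -
        have "False" if v: "v \<in> ?O" "c v = K" for v
        proof -
          have "{i \<in> I. h i = v} \<noteq> {}"
            using v unfolding indeg_def by (metis (no_types, lifting) card.empty even_zero mem_Collect_eq)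
          then obtain i where i: "i \<in> I" "h i = v" by auto
          then have "c (s i) = K" using h cst[OF i(1)] v(2) by (auto simp: orients_def)
          then show False using e i by blast
        qed
        then show ?thesis by blast
      qed
      show ?thesis unfolding e o by simp
    qed
  qed
  have finc: "finite (c ` V)" using finV by simp
  have "(\<Sum>K\<in>c ` V. card {i \<in> I. c (s i) = K}) = card I"
    using sum.group[OF fin finc, of "\<lambda>i. c (s i)" "\<lambda>_. 1::nat"] sub by auto
  moreover have "(\<Sum>K\<in>c ` V. card {v \<in> ?O. c v = K}) = card ?O"
    using sum.group[of ?O "c ` V" c "\<lambda>_. 1::nat"] finV finc by auto
  moreover have "(\<Sum>K\<in>c ` V. card {v \<in> V. c v = K}) = card V"
    using sum.group[of V "c ` V" c "\<lambda>_. 1::nat"] finV finc by auto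
  moreover have "(\<Sum>K\<in>c ` V. card {i \<in> I. c (s i) = K} + 5 * card {v \<in> ?O. c v = K})
      \<le> (\<Sum>K\<in>c ` V. 3 * card {v \<in> V. c v = K})"
    by (rule sum_mono) (rule main)
  ultimately have "card I + 5 * card ?O \<le> 3 * card V"
    by (simp only: sum.distrib sum_distrib_left[symmetric])
  then show ?thesis using h by blast
qed

section \<open>Pairing the elements of each colour class\<close>

lemma ex_monochromatic_pairing:
  assumes "finite X" "\<And>c. even (card {x \<in> X. \<kappa> x = c})"
  shows "\<exists>E. (\<forall>e\<in>E. \<exists>a\<in>X. \<exists>b\<in>X. a \<noteq> b \<and> e = {a, b} \<and> \<kappa> a = \<kappa> b) \<and> disjoint E \<and> \<Union>E = X"
  using assms
proof (induction X rule: finite_psubset_induct)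
  case (psubset X)
  show ?case
  proof (cases "X = {}")
    case True
    then show ?thesis by (intro exI[of _ "{}"]) auto
  next
    case False
    then obtain a where a: "a \<in> X" by blast
    \<comment> \<open>An even class is not a singleton, so \<open>a\<close> has a partner; removing
      both keeps every class even.\<close>
    have "{x \<in> X. \<kappa> x = \<kappa> a} \<noteq> {a}" using psubset.prems[of "\<kappa> a"] by auto
    then obtain b where b: "b \<in> X" "\<kappa> b = \<kappa> a" "b \<noteq> a" using a by blast
    have "even (card {x \<in> X - {a, b}. \<kappa> x = c})" for c
    proof (cases "c = \<kappa> a")
      case True
      have "{x \<in> X. \<kappa> x = c} = insert a (insert b {x \<in> X - {a, b}. \<kappa> x = c})"
        using a b True by auto
      then have "card {x \<in> X. \<kappa> x = c} = Suc (Suc (card {x \<in> X - {a, b}. \<kappa> x = c}))"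
        using psubset.hyps b(3) by simp
      then show ?thesis using psubset.prems[of c] by simp
    next
      case False
      then have "{x \<in> X - {a, b}. \<kappa> x = c} = {x \<in> X. \<kappa> x = c}" using b by auto
      then show ?thesis using psubset.prems[of c] by simp
    qed
    then obtain E where E: "\<forall>e\<in>E. \<exists>x\<in>X - {a, b}. \<exists>y\<in>X - {a, b}. x \<noteq> y \<and> e = {x, y} \<and> \<kappa> x = \<kappa> y"
      "disjoint E" "\<Union>E = X - {a, b}"
      using psubset.IH[of "X - {a, b}"] a by blast
    show ?thesis
    proof (intro exI[of _ "insert {a, b} E"] conjI)
      show "\<forall>e\<in>insert {a, b} E. \<exists>x\<in>X. \<exists>y\<in>X. x \<noteq> y \<and> e = {x, y} \<and> \<kappa> x = \<kappa> y"
        using E(1) a b by (metis DiffE insertE)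
      show "disjoint (insert {a, b} E)"
        using E(2,3) by (intro pairwise_insert[THEN iffD2]) (auto simp: disjnt_def)
      show "\<Union>(insert {a, b} E) = X" using E(3) a b by auto
    qed
  qed
qed

subsection \<open>Sweeping a family of bars\<close>

lemma ex_max_on_finite:
  fixes f :: "'a \<Rightarrow> 'b :: linorder"
  assumes "finite G" "G \<noteq> {}"
  shows "\<exists>C\<in>G. \<forall>A\<in>G. f A \<le> f C"
proof -
  have "Max (f ` G) \<in> f ` G" using assms by (intro Max_in) auto
  then obtain C where "C \<in> G" "f C = Max (f ` G)" by auto
  then show ?thesis using assms(1) by (intro bexI[of _ C]) auto
qed

lemma ex_min_on_finite:
  fixes f :: "'a \<Rightarrow> 'b :: linorder"
  assumes "finite G" "G \<noteq> {}"
  shows "\<exists>C\<in>G. \<forall>A\<in>G. f C \<le> f A"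
proof -
  have "Min (f ` G) \<in> f ` G" using assms by (intro Min_in) auto
  then obtain C where "C \<in> G" "f C = Min (f ` G)" by auto
  then show ?thesis using assms(1) by (intro bexI[of _ C]) auto
qed

text \<open>The relation \<open>B\<close> is the vertical order; adjacency of a pair in the sweep is charged to the
  event that creates it: the insertion of one of its two members or the removal of a bar
  between them.\<close>

locale bars =
  fixes F :: "'c set" and l r :: "'c \<Rightarrow> real" and B :: "'c \<Rightarrow> 'c \<Rightarrow> bool"
  assumes finite_F: "finite F"
    and asym: "\<And>A C x. A \<in> F \<Longrightarrow> C \<in> F \<Longrightarrow> l A < x \<Longrightarrow> x < r A \<Longrightarrow> l C < x \<Longrightarrow> x < r C \<Longrightarrow> B A C \<Longrightarrow> \<not> B C A"
    and total: "\<And>A C x. A \<in> F \<Longrightarrow> C \<in> F \<Longrightarrow> l A < x \<Longrightarrow> x < r A \<Longrightarrow> l C < x \<Longrightarrow> x < r C \<Longrightarrow> A \<noteq> C \<Longrightarrow> B A C \<or> B C A"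
    and trans: "\<And>A C E x. A \<in> F \<Longrightarrow> C \<in> F \<Longrightarrow> E \<in> F \<Longrightarrow> l A < x \<Longrightarrow> x < r A \<Longrightarrow> l C < x \<Longrightarrow> x < r C \<Longrightarrow>
       l E < x \<Longrightarrow> x < r E \<Longrightarrow> B A C \<Longrightarrow> B C E \<Longrightarrow> B A E"
begin

definition act :: "real \<Rightarrow> 'c set" where "act x = {C \<in> F. l C < x \<and> x < r C}"

definition adj :: "real \<Rightarrow> 'c \<Rightarrow> 'c \<Rightarrow> bool" where
  "adj x A C \<longleftrightarrow> A \<in> act x \<and> C \<in> act x \<and> B A C \<and> (\<forall>E\<in>act x. B A E \<longrightarrow> \<not> B E C)"

lemma act_asym: "A \<in> act x \<Longrightarrow> C \<in> act x \<Longrightarrow> B A C \<Longrightarrow> \<not> B C A"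
  using asym by (auto simp: act_def)

lemma act_total: "A \<in> act x \<Longrightarrow> C \<in> act x \<Longrightarrow> A \<noteq> C \<Longrightarrow> B A C \<or> B C A"
  using total by (auto simp: act_def)

lemma act_trans: "A \<in> act x \<Longrightarrow> C \<in> act x \<Longrightarrow> E \<in> act x \<Longrightarrow> B A C \<Longrightarrow> B C E \<Longrightarrow> B A E"
  using trans by (simp add: act_def) blast

lemma adj_neq: "adj x A C \<Longrightarrow> A \<noteq> C"
  using act_asym by (auto simp: adj_def)

lemma adj_unique_above: "adj x A C \<Longrightarrow> adj x A C' \<Longrightarrow> C = C'"
  unfolding adj_def using act_total[of C x C'] by blast

lemma adj_unique_below: "adj x A C \<Longrightarrow> adj x A' C \<Longrightarrow> A = A'"
  unfolding adj_def using act_total[of A x A'] by blast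

text \<open>The adjacency is asked just to the right of \<open>t\<close>, since a bar is not yet
  active at its own left end. The same pair may be created at several abscissae.\<close>

definition created :: "'c \<Rightarrow> 'c \<Rightarrow> real \<Rightarrow> bool" where
  "created A C t \<longleftrightarrow> max (l A) (l C) \<le> t \<and> (\<exists>x>t. \<forall>y. t < y \<longrightarrow> y \<le> x \<longrightarrow> adj y A C) \<and>
     (t = max (l A) (l C) \<or> (\<exists>E\<in>F. r E = t \<and> B A E \<and> B E C))"

text \<open>Let \<open>t\<close> be the last event before \<open>x\<close> that concerns the pair:
  the birth of its later member or the removal of a bar between the two. Since \<open>x\<close> is
  no right end, a bar between them that is active after \<open>t\<close> and not removed before
  \<open>x\<close> would still be active at \<open>x\<close>.\<close>

lemma ex_created:
  assumes adj: "adj x A C" and x: "x \<notin> r ` F"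
  shows "\<exists>t. created A C t"
proof -
  let ?m = "max (l A) (l C)"
  define T where "T = insert ?m {r E | E. E \<in> F \<and> B A E \<and> B E C \<and> ?m < r E \<and> r E < x}"
  have "finite {r E | E. E \<in> F \<and> B A E \<and> B E C \<and> ?m < r E \<and> r E < x}"
    by (rule finite_subset[of _ "r ` F"]) (use finite_F in auto)
  then have finT: "finite T" by (simp add: T_def)
  define t where "t = Max T"
  have tT: "t \<in> T" unfolding t_def using finT by (intro Max_in) (auto simp: T_def)
  have tmax: "\<And>s. s \<in> T \<Longrightarrow> s \<le> t" unfolding t_def using finT by simp
  have mx: "?m < x" using adj by (auto simp: adj_def act_def)
  have tx: "t < x" using tT mx by (auto simp: T_def)
  have mt: "?m \<le> t" by (rule tmax) (simp add: T_def)
  have AC: "A \<in> F" "C \<in> F" "x < r A" "x < r C" "B A C" using adj by (auto simp: adj_def act_def)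
  have "adj y A C" if y: "t < y" "y \<le> x" for y
  proof -
    have "\<not> B E C" if E: "E \<in> act y" "B A E" for E
    proof
      assume "B E C"
      have EF: "E \<in> F" "l E < y" "y < r E" using E by (auto simp: act_def)
      show False
      proof (cases "r E < x")
        case True
        then have "r E \<in> T" using EF E \<open>B E C\<close> y mt by (auto simp: T_def)
        then show False using tmax[of "r E"] EF y by linarith
      next
        case False
        moreover have "r E \<noteq> x" using x EF by auto
        ultimately have "E \<in> act x" using EF y by (auto simp: act_def)
        then show False using adj E \<open>B E C\<close> by (auto simp: adj_def)
      qed
    qed
    moreover have "A \<in> act y" "C \<in> act y" using AC y mt by (auto simp: act_def)
    ultimately show ?thesis using AC by (auto simp: adj_def)
  qed
  moreover have "t = ?m \<or> (\<exists>E\<in>F. r E = t \<and> B A E \<and> B E C)" using tT by (auto simp: T_def)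
  ultimately show ?thesis using mt tx unfolding created_def by blast
qed

lemma created_adj:
  assumes "created A C t" "t < u"
  obtains y where "t < y" "y < u" "\<And>z. t < z \<Longrightarrow> z \<le> y \<Longrightarrow> adj z A C"
proof -
  obtain x where x: "x > t" "\<And>y. t < y \<Longrightarrow> y \<le> x \<Longrightarrow> adj y A C"
    using assms unfolding created_def by blast
  define y where "y = min x ((t + u) / 2)"
  show ?thesis
    by (rule that[of y]) (use x assms(2) in \<open>auto simp: y_def min_def split: if_splits\<close>)
qed

lemma created_common:
  assumes "created A C t" "created A' C' t"
  obtains y where "t < y" "adj y A C" "adj y A' C'"
proof -
  obtain y where y: "t < y" "\<And>z. t < z \<Longrightarrow> z \<le> y \<Longrightarrow> adj z A C"
    using created_adj[OF assms(1), of "t + 1"] by auto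
  obtain y' where y': "t < y'" "y' < y" "\<And>z. t < z \<Longrightarrow> z \<le> y' \<Longrightarrow> adj z A' C'"
    using created_adj[OF assms(2) y(1)] by metis
  show ?thesis by (rule that[of y']) (use y y' in auto)
qed

text \<open>Only the two neighbours of \<open>E\<close> become adjacent when it disappears. If
  \<open>A\<close> were below \<open>A'\<close>, then \<open>C\<close>, next above \<open>A\<close>
  after the removal, would be at or below \<open>A'\<close>; as \<open>E\<close> is below
  \<open>C\<close>, it would also be below \<open>A'\<close>, although \<open>A'\<close> is below
  \<open>E\<close>.\<close>

lemma removal_creates_unique:
  assumes c: "created A C t" "created A' C' t" and t: "max (l A) (l C) < t" "max (l A') (l C') < t"
    and E: "E \<in> F" "r E = t" "l E < r E" "B A E" "B E C" "B A' E" "B E C'"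
  shows "A = A' \<and> C = C'"
proof -
  obtain y where y: "t < y" "adj y A C" "adj y A' C'" using created_common[OF c] .
  \<comment> \<open>An abscissa just before \<open>t\<close> at which all five bars are active, so
    that \<open>E\<close> can be compared with the others.\<close>
  define z where "z = (max (max (max (l A) (l C)) (max (l A') (l C'))) (l E) + t) / 2"
  have z: "z < t" "l A < z" "l C < z" "l A' < z" "l C' < z" "l E < z"
    using t E unfolding z_def by auto
  have y_act: "A \<in> act y" "C \<in> act y" "A' \<in> act y" "C' \<in> act y"
    using y by (auto simp: adj_def)
  then have z_act: "A \<in> act z" "C \<in> act z" "A' \<in> act z" "C' \<in> act z" "E \<in> act z"
    using z y E by (auto simp: act_def)
  have "A = A'"
  proof (rule ccontr)
    assume "A \<noteq> A'"
    then consider "B A A'" | "B A' A" using act_total y_act by blast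
    then show False
    proof cases
      case 1
      then have "C = A' \<or> B C A'" using y y_act act_total unfolding adj_def by metis
      then have "B E A'" using act_trans z_act E by metis
      then show False using act_asym z_act E by metis
    next
      case 2
      then have "C' = A \<or> B C' A" using y y_act act_total unfolding adj_def by metis
      then have "B E A" using act_trans z_act E by metis
      then show False using act_asym z_act E by metis
    qed
  qed
  then show ?thesis using y adj_unique_above by blast
qed

text \<open>Bars may have the same left end. The rank breaks such ties and makes one member of each
  pair the later one, even when both are inserted at the same abscissa.\<close>

lemma ex_rank:
  "\<exists>\<rho> :: 'c \<Rightarrow> nat. inj_on \<rho> F \<and> (\<forall>A\<in>F. \<forall>C\<in>F. l A < l C \<longrightarrow> \<rho> A < \<rho> C)"
  using finite_F
proof (induction "card F" arbitrary: F)
  case 0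
  then show ?case by auto
next
  case (Suc k)
  then have "F \<noteq> {}" by auto
  then obtain C where C: "C \<in> F" "\<And>A. A \<in> F \<Longrightarrow> l A \<le> l C"
    using Suc.prems ex_max_on_finite[of F l] by blast
  have "card (F - {C}) = k" using Suc C by simp
  then obtain \<rho> :: "'c \<Rightarrow> nat" where \<rho>: "inj_on \<rho> (F - {C})"
    "\<forall>A\<in>F - {C}. \<forall>E\<in>F - {C}. l A < l E \<longrightarrow> \<rho> A < \<rho> E"
    using Suc.hyps(1)[of "F - {C}"] Suc.prems by auto
  define m where "m = Suc (Max (insert 0 (\<rho> ` (F - {C}))))"
  have m: "\<rho> A < m" if "A \<in> F - {C}" for A
    unfolding m_def using that Suc.prems by (simp add: le_imp_less_Suc)
  show ?case
  proof (intro exI[of _ "\<rho>(C := m)"] conjI)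
    show "inj_on (\<rho>(C := m)) F"
      using \<rho>(1) m unfolding inj_on_def by (metis DiffI fun_upd_apply less_irrefl singletonD)
    show "\<forall>A\<in>F. \<forall>E\<in>F. l A < l E \<longrightarrow> (\<rho>(C := m)) A < (\<rho>(C := m)) E"
      using \<rho>(2) m C(2) by (auto simp: not_less) (meson leD)
  qed
qed

text \<open>Every bar offers three tokens: one for the neighbour above it at its insertion, one for
  the neighbour below it, and one for the pair that its removal joins. Five tokens are never spent:
  both insertion tokens of the first bar, one of the second bar, which finds a single bar present,
  and the removal tokens of the last two bars.\<close>

theorem card_adjacent_pairs:
  assumes P: "P \<subseteq> F \<times> F" and adj: "\<And>A C. (A, C) \<in> P \<Longrightarrow> \<exists>x. x \<notin> r ` F \<and> adj x A C"
    and two: "2 \<le> card F" and lr: "\<And>C. C \<in> F \<Longrightarrow> l C < r C"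
  shows "card P + 5 \<le> 3 * card F"
proof -
  obtain \<rho> :: "'c \<Rightarrow> nat" where \<rho>: "inj_on \<rho> F" "\<And>A C. A \<in> F \<Longrightarrow> C \<in> F \<Longrightarrow> l A < l C \<Longrightarrow> \<rho> A < \<rho> C"
    using ex_rank by blast
  have "\<exists>t. created A C t" if "(A, C) \<in> P" for A C using adj[OF that] ex_created by blast
  then obtain \<tau> where \<tau>: "\<And>A C. (A, C) \<in> P \<Longrightarrow> created A C (\<tau> A C)" by metis
  define m where "m A C = max (l A) (l C)" for A C
  have "\<exists>E. E \<in> F \<and> r E = \<tau> A C \<and> B A E \<and> B E C" if "(A, C) \<in> P" "\<tau> A C \<noteq> m A C" for A C
    using \<tau>[OF that(1)] that(2) unfolding created_def m_def by blast
  then obtain \<epsilon> where \<epsilon>: "\<And>A C. (A, C) \<in> P \<Longrightarrow> \<tau> A C \<noteq> m A C \<Longrightarrow>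
      \<epsilon> A C \<in> F \<and> r (\<epsilon> A C) = \<tau> A C \<and> B A (\<epsilon> A C) \<and> B (\<epsilon> A C) C" by metis
  \<comment> \<open>Token 2 belongs to the removed bar. At an insertion the later bar pays: token 0
    if it is the lower member \<open>A\<close>, token 1 if it is the upper member
    \<open>C\<close>.\<close>
  define \<phi> where "\<phi> = (\<lambda>(A, C). if \<tau> A C \<noteq> m A C then (\<epsilon> A C, 2::nat)
      else if \<rho> C < \<rho> A then (A, 0) else (C, 1))"
  have mle: "m A C \<le> \<tau> A C" if "(A, C) \<in> P" for A C
    using \<tau>[OF that] by (simp add: created_def m_def)
  have neq: "A \<noteq> C" if "(A, C) \<in> P" for A C using adj[OF that] adj_neq by blast
  have PF: "A \<in> F" "C \<in> F" if "(A, C) \<in> P" for A C using P that by auto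
  have birth_A: "\<tau> A C = l A" if "(A, C) \<in> P" "\<tau> A C = m A C" "\<rho> C < \<rho> A" for A C
  proof -
    have "\<not> l A < l C" using that \<rho>(2)[of A C] PF[OF that(1)] by auto
    then show ?thesis using that(2) by (simp add: m_def)
  qed
  have birth_C: "\<tau> A C = l C" "\<rho> A < \<rho> C" if "(A, C) \<in> P" "\<tau> A C = m A C" "\<not> \<rho> C < \<rho> A" for A C
  proof -
    have "\<rho> A \<noteq> \<rho> C" using \<rho>(1) neq[OF that(1)] PF[OF that(1)] by (auto dest: inj_onD)
    then show "\<rho> A < \<rho> C" using that by simp
    have "\<not> l C < l A" using that \<rho>(2)[of C A] PF[OF that(1)] by auto
    then show "\<tau> A C = l C" using that(2) by (simp add: m_def)
  qed
  have inj: "inj_on \<phi> P"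
  proof (rule inj_onI, clarify)
    fix A C A' C' assume P: "(A, C) \<in> P" "(A', C') \<in> P" and eq: "\<phi> (A, C) = \<phi> (A', C')"
    consider (d) "\<tau> A C \<noteq> m A C" "\<tau> A' C' \<noteq> m A' C'" "\<epsilon> A C = \<epsilon> A' C'"
      | (a) "\<tau> A C = m A C" "\<tau> A' C' = m A' C'" "A = A'" "\<rho> C < \<rho> A" "\<rho> C' < \<rho> A'"
      | (c) "\<tau> A C = m A C" "\<tau> A' C' = m A' C'" "C = C'" "\<not> \<rho> C < \<rho> A" "\<not> \<rho> C' < \<rho> A'"
      using eq by (auto simp: \<phi>_def split: if_splits)
    then show "A = A' \<and> C = C'"
    proof cases
      case d
      have eqt: "\<tau> A C = \<tau> A' C'" using \<epsilon>[OF P(1) d(1)] \<epsilon>[OF P(2) d(2)] d(3) by simp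
      show ?thesis
      proof (rule removal_creates_unique[of A C "\<tau> A C" A' C' "\<epsilon> A C"])
        show "created A C (\<tau> A C)" "created A' C' (\<tau> A C)" using \<tau> P eqt by metis+
        show "max (l A) (l C) < \<tau> A C" "max (l A') (l C') < \<tau> A C"
          using mle[OF P(1)] mle[OF P(2)] d eqt by (auto simp: m_def)
      qed (use \<epsilon>[OF P(1) d(1)] \<epsilon>[OF P(2) d(2)] d(3) lr[of "\<epsilon> A C"] in auto)
    next
      case a
      then have "\<tau> A C = \<tau> A' C'" using birth_A P by metis
      then obtain y where "adj y A C" "adj y A' C'" using created_common \<tau> P by metis
      then show ?thesis using a adj_unique_above by blast
    next
      case c
      then have "\<tau> A C = \<tau> A' C'" using birth_C P by metis
      then obtain y where "adj y A C" "adj y A' C'" using created_common \<tau> P by metis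
      then show ?thesis using c adj_unique_below by blast
    qed
  qed
  have "F \<noteq> {}" using two by auto
  have ex_min: "\<exists>C\<in>G. \<forall>A\<in>G. \<rho> C \<le> \<rho> A" if "G \<noteq> {}" "G \<subseteq> F" for G
    using that finite_F ex_min_on_finite finite_subset by metis
  have ex_max: "\<exists>C\<in>G. \<forall>A\<in>G. r A \<le> r C" if "G \<noteq> {}" "G \<subseteq> F" for G
    using that finite_F ex_max_on_finite finite_subset by metis
  have minus: "F - {C} \<noteq> {}" for C
  proof
    assume "F - {C} = {}"
    then have "card F \<le> card {C}" by (intro card_mono) auto
    then show False using two by simp
  qed
  obtain C0 where C0: "C0 \<in> F" "\<And>A. A \<in> F \<Longrightarrow> \<rho> C0 \<le> \<rho> A" using ex_min[OF \<open>F \<noteq> {}\<close>] by auto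
  obtain C1 where C1: "C1 \<in> F" "C1 \<noteq> C0" "\<And>A. A \<in> F \<Longrightarrow> A \<noteq> C0 \<Longrightarrow> \<rho> C1 \<le> \<rho> A"
    using ex_min[OF minus[of C0]] by auto
  obtain D0 where D0: "D0 \<in> F" "\<And>A. A \<in> F \<Longrightarrow> r A \<le> r D0" using ex_max[OF \<open>F \<noteq> {}\<close>] by auto
  obtain D1 where D1: "D1 \<in> F" "D1 \<noteq> D0" "\<And>A. A \<in> F \<Longrightarrow> A \<noteq> D0 \<Longrightarrow> r A \<le> r D1"
    using ex_max[OF minus[of D0]] by auto
  have dead: "r (\<epsilon> A C) < r A" "r (\<epsilon> A C) < r C" if AC: "(A, C) \<in> P" "\<tau> A C \<noteq> m A C" for A C
  proof -
    obtain y where "\<tau> A C < y" "adj y A C"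
      using created_common[OF \<tau>[OF AC(1)] \<tau>[OF AC(1)]] by blast
    then show "r (\<epsilon> A C) < r A" "r (\<epsilon> A C) < r C"
      using \<epsilon>[OF AC] by (auto simp: adj_def act_def)
  qed
  \<comment> \<open>The second bar \<open>C1\<close> can only meet \<open>C0\<close> at its
    insertion, so the token for the other side is lost: the upper one if \<open>C1\<close> lies
    above \<open>C0\<close>, and the lower one otherwise.\<close>
  define k :: nat where "k = (if B C0 C1 then 0 else 1)"
  let ?X = "{(C0, 0), (C0, 1), (C1, k), (D0, 2), (D1, 2)}"
  have image: "\<phi> ` P \<subseteq> F \<times> {0, 1, 2} - ?X"
  proof
    fix z assume "z \<in> \<phi> ` P"
    then obtain A C where AC: "(A, C) \<in> P" and z: "z = \<phi> (A, C)" by auto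
    have "\<phi> (A, C) \<in> F \<times> {0, 1, 2}" using PF[OF AC] \<epsilon>[OF AC] by (auto simp: \<phi>_def)
    moreover have "\<phi> (A, C) \<notin> ?X"
    proof
      assume X: "\<phi> (A, C) \<in> ?X"
      show False
      proof (cases "\<tau> A C = m A C")
        case False
        then have "\<epsilon> A C = D0 \<or> \<epsilon> A C = D1" using X by (auto simp: \<phi>_def k_def split: if_splits)
        moreover have "\<epsilon> A C \<noteq> D0" using dead[OF AC False] D0 PF[OF AC] by force
        moreover have "A = D0" "C = D0" if "\<epsilon> A C = D1"
          using dead[OF AC False] D1(3)[OF PF(1)[OF AC]] D1(3)[OF PF(2)[OF AC]] that by force+
        ultimately show False using neq[OF AC] by auto
      next
        case True
        show False
        proof (cases "\<rho> C < \<rho> A")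
          case less: True
          then have "A = C0 \<or> A = C1 \<and> k = 0" using X True by (auto simp: \<phi>_def)
          moreover have "A \<noteq> C0" using C0(2)[OF PF(2)[OF AC]] less by auto
          ultimately have "A = C1" "k = 0" by auto
          then have "C = C0" using C1(3)[OF PF(2)[OF AC]] less by force
          have "B C0 C1" using \<open>k = 0\<close> by (auto simp: k_def split: if_splits)
          moreover obtain x where "adj x A C" using adj AC by blast
          ultimately show False using act_asym \<open>A = C1\<close> \<open>C = C0\<close> unfolding adj_def by blast
        next
          case less: False
          then have "C = C0 \<or> C = C1 \<and> k = 1" using X True by (auto simp: \<phi>_def)
          moreover have "C \<noteq> C0" using C0(2)[OF PF(1)[OF AC]] birth_C(2)[OF AC True less] by auto
          ultimately have "C = C1" "k = 1" by auto
          then have "A = C0" using C1(3)[OF PF(1)[OF AC]] birth_C(2)[OF AC True less] by force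
          have "\<not> B C0 C1" using \<open>k = 1\<close> by (auto simp: k_def split: if_splits)
          moreover obtain x where "adj x A C" using adj AC by blast
          ultimately show False using \<open>A = C0\<close> \<open>C = C1\<close> unfolding adj_def by blast
        qed
      qed
    qed
    ultimately show "z \<in> F \<times> {0, 1, 2} - ?X" unfolding z by (rule DiffI)
  qed
  have "card P = card (\<phi> ` P)" using inj by (simp add: card_image)
  also have "\<dots> \<le> card (F \<times> {0, 1, 2::nat} - ?X)" using image finite_F by (intro card_mono) auto
  also have "\<dots> = card (F \<times> {0, 1, 2::nat}) - card ?X"
    using C0(1) C1(1) D0(1) D1(1) by (intro card_Diff_subset) (auto simp: k_def)
  also have "card ?X = 5" using C1(2) D1(2) by (auto simp: k_def card_insert_if)
  also have "card (F \<times> {0, 1, 2::nat}) = 3 * card F" by (simp add: card_cartesian_product)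
  finally show ?thesis using two by linarith
qed

end

subsection \<open>Extending segments\<close>

definition pt :: "complex \<Rightarrow> complex \<Rightarrow> real \<Rightarrow> complex" where
  "pt a b t = a + of_real t * (b - a)"

lemma pt_0 [simp]: "pt a b 0 = a" and pt_1 [simp]: "pt a b 1 = b"
  by (simp_all add: pt_def)

lemma pt_swap: "pt b a t = pt a b (1 - t)"
  by (simp add: pt_def algebra_simps)

lemma pt_eq_iff: "a \<noteq> b \<Longrightarrow> pt a b s = pt a b t \<longleftrightarrow> s = t"
  by (simp add: pt_def)

lemma pt_diff: "pt a b s - pt a b t = of_real (s - t) * (b - a)"
  by (simp add: pt_def algebra_simps)

lemma continuous_on_pt [continuous_intros]: "continuous_on X (pt a b)"
  unfolding pt_def by (intro continuous_intros)

lemma compact_pt: "compact (pt a b ` {s..t})"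
  by (intro compact_continuous_image continuous_intros compact_Icc)

lemma first_hit:
  fixes e v :: complex
  assumes T: "closed T" "e \<notin> T" and hit: "s > 0" "e + of_real s * v \<in> T"
  obtains t where "t > 0" "e + of_real t * v \<in> T" "\<And>r. 0 \<le> r \<Longrightarrow> r < t \<Longrightarrow> e + of_real r * v \<notin> T"
proof -
  define X where "X = {0..} \<inter> (\<lambda>r. e + of_real r * v) -` T"
  have "closed X" unfolding X_def
    by (intro closed_Int closed_atLeast closed_vimage T(1) continuous_intros)
  moreover have "s \<in> X" using hit by (simp add: X_def)
  then have "X \<noteq> {}" by blast
  moreover have bdd: "bdd_below X" by (auto simp: X_def intro!: bdd_belowI[of _ 0])
  ultimately have X: "Inf X \<in> X" by (intro closed_contains_Inf)
  have "Inf X \<noteq> 0" using X T(2) by (auto simp: X_def)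
  show ?thesis
  proof (rule that[of "Inf X"])
    show "Inf X > 0" "e + of_real (Inf X) * v \<in> T" using X \<open>Inf X \<noteq> 0\<close> by (auto simp: X_def)
    show "e + of_real r * v \<notin> T" if "0 \<le> r" "r < Inf X" for r
      using cInf_lower[OF _ bdd, of r] that by (auto simp: X_def)
  qed
qed

lemma ray_leaves_bounded:
  fixes e v :: complex
  assumes "bounded D" "v \<noteq> 0"
  obtains s where "s > 0" "e + of_real s * v \<notin> D"
proof -
  obtain B where B: "B > 0" "\<And>z. z \<in> D \<Longrightarrow> norm z \<le> B" using assms(1) by (auto simp: bounded_pos)
  define s where "s = (B + norm e + 1) / norm v"
  have "s > 0" using B(1) assms(2) by (simp add: s_def add_pos_nonneg)
  have "norm (of_real s * v) = B + norm e + 1"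
    using \<open>s > 0\<close> assms(2) by (simp add: norm_mult) (simp add: s_def)
  moreover have "norm (of_real s * v) \<le> norm (e + of_real s * v) + norm e"
    by (metis add.commute add_diff_cancel_left' norm_triangle_ineq4 norm_triangle_sub)
  ultimately have "norm (e + of_real s * v) > B" by linarith
  then show ?thesis using B(2) \<open>s > 0\<close> that by force
qed

text \<open>The left extensions are obtained from this lemma too, with \<open>p\<close> and \<open>q\<close> exchanged and \<open>\<alpha> = 0\<close>.\<close>

lemma extend_right:
  fixes p q :: "'i \<Rightarrow> complex" and \<alpha> :: "'i \<Rightarrow> real" and \<gamma> :: "'i \<Rightarrow> real \<Rightarrow> complex"
  assumes \<gamma>: "\<And>i. \<gamma> i = pt (p i) (q i)"
    and fin: "finite I" and D: "open D" "bounded D"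
    and pq: "\<And>i. i \<in> I \<Longrightarrow> p i \<noteq> q i"
    and gp: "\<And>i j \<tau>. i \<in> I \<Longrightarrow> j \<in> I \<Longrightarrow> i \<noteq> j \<Longrightarrow> p i \<noteq> \<gamma> j \<tau>"
       "\<And>i j \<tau>. i \<in> I \<Longrightarrow> j \<in> I \<Longrightarrow> i \<noteq> j \<Longrightarrow> q i \<noteq> \<gamma> j \<tau>"
    and \<alpha>: "\<And>i. i \<in> I \<Longrightarrow> \<alpha> i \<le> 0"
    and inD: "\<And>i \<tau>. i \<in> I \<Longrightarrow> \<alpha> i < \<tau> \<Longrightarrow> \<tau> \<le> 1 \<Longrightarrow> \<gamma> i \<tau> \<in> D"
    and disj: "\<And>i j \<tau> \<sigma>. i \<in> I \<Longrightarrow> j \<in> I \<Longrightarrow> i \<noteq> j \<Longrightarrow> \<alpha> i < \<tau> \<Longrightarrow> \<tau> < 1 \<Longrightarrow> \<alpha> j < \<sigma> \<Longrightarrow> \<sigma> < 1 \<Longrightarrow>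
       \<gamma> i \<tau> \<noteq> \<gamma> j \<sigma>"
    and left: "\<And>i. i \<in> I \<Longrightarrow> \<alpha> i = 0 \<or> \<gamma> i (\<alpha> i) \<notin> D \<or>
       (\<exists>k\<in>I. k \<noteq> i \<and> (\<exists>\<sigma>. \<alpha> k < \<sigma> \<and> \<sigma> < 1 \<and> \<gamma> i (\<alpha> i) = \<gamma> k \<sigma>))"
  shows "\<exists>\<beta>. (\<forall>i\<in>I. 1 < \<beta> i \<and> (\<forall>\<tau>. \<alpha> i < \<tau> \<longrightarrow> \<tau> < \<beta> i \<longrightarrow> \<gamma> i \<tau> \<in> D) \<and>
        (\<gamma> i (\<beta> i) \<notin> D \<or> (\<exists>k\<in>I. k \<noteq> i \<and> (\<exists>\<sigma>. \<alpha> k < \<sigma> \<and> \<sigma> < \<beta> k \<and> \<gamma> i (\<beta> i) = \<gamma> k \<sigma>)))) \<and>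
      (\<forall>i\<in>I. \<forall>j\<in>I. i \<noteq> j \<longrightarrow> (\<forall>\<tau> \<sigma>. \<alpha> i < \<tau> \<longrightarrow> \<tau> < \<beta> i \<longrightarrow> \<alpha> j < \<sigma> \<longrightarrow> \<sigma> < \<beta> j \<longrightarrow> \<gamma> i \<tau> \<noteq> \<gamma> j \<sigma>))"
    (is "\<exists>\<beta>. ?P \<beta>")
proof -
  \<comment> \<open>The invariant when exactly the segments in \<open>J\<close> have been extended:
    the others still stop at parameter 1 and carry no stopping condition.\<close>
  define Q where "Q J \<beta> \<longleftrightarrow>
     (\<forall>i\<in>I. 1 \<le> \<beta> i \<and> (i \<notin> J \<longrightarrow> \<beta> i = 1) \<and> (\<forall>\<tau>. \<alpha> i < \<tau> \<longrightarrow> \<tau> < \<beta> i \<longrightarrow> \<gamma> i \<tau> \<in> D) \<and>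
       (i \<in> J \<longrightarrow> 1 < \<beta> i \<and> (\<gamma> i (\<beta> i) \<notin> D \<or>
          (\<exists>k\<in>I. k \<noteq> i \<and> (\<exists>\<sigma>. \<alpha> k < \<sigma> \<and> \<sigma> < \<beta> k \<and> \<gamma> i (\<beta> i) = \<gamma> k \<sigma>))))) \<and>
     (\<forall>i\<in>I. \<forall>j\<in>I. i \<noteq> j \<longrightarrow> (\<forall>\<tau> \<sigma>. \<alpha> i < \<tau> \<longrightarrow> \<tau> < \<beta> i \<longrightarrow> \<alpha> j < \<sigma> \<longrightarrow> \<sigma> < \<beta> j \<longrightarrow> \<gamma> i \<tau> \<noteq> \<gamma> j \<sigma>))"
    for J \<beta>
  have "\<exists>\<beta>. Q J \<beta>" if "finite J" "J \<subseteq> I" for J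
    using that
  proof (induction rule: finite_subset_induct')
    case empty
    have "Q {} (\<lambda>_. 1)" unfolding Q_def using inD disj by auto
    then show ?case by blast
  next
    case (insert i J)
    then obtain \<beta> where Q: "Q J \<beta>" by blast
    have \<beta>1: "1 \<le> \<beta> j" if "j \<in> I" for j using Q that by (auto simp: Q_def)
    have \<beta>J: "\<beta> j = 1" if "j \<in> I" "j \<notin> J" for j using Q that by (auto simp: Q_def)
    have \<beta>D: "\<gamma> j \<tau> \<in> D" if "j \<in> I" "\<alpha> j < \<tau>" "\<tau> < \<beta> j" for j \<tau> using Q that by (auto simp: Q_def)
    have \<beta>end: "\<gamma> j (\<beta> j) \<notin> D \<or> (\<exists>k\<in>I. k \<noteq> j \<and> (\<exists>\<sigma>. \<alpha> k < \<sigma> \<and> \<sigma> < \<beta> k \<and> \<gamma> j (\<beta> j) = \<gamma> k \<sigma>))"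
      if "j \<in> I" "j \<in> J" for j using Q that unfolding Q_def by blast
    have \<beta>less: "1 < \<beta> j" if "j \<in> I" "j \<in> J" for j using Q that by (auto simp: Q_def)
    have \<beta>disj: "\<gamma> j \<tau> \<noteq> \<gamma> k \<sigma>"
      if "j \<in> I" "k \<in> I" "j \<noteq> k" "\<alpha> j < \<tau>" "\<tau> < \<beta> j" "\<alpha> k < \<sigma>" "\<sigma> < \<beta> k" for j k \<tau> \<sigma>
      using Q that unfolding Q_def by blast
    have i: "i \<in> I" "\<beta> i = 1" using insert \<beta>J by auto
    \<comment> \<open>The obstacles for the ray from \<open>q i\<close>. The arcs are taken with
      their ends, to have a closed set and thus a first hit.\<close>
    define T where "T = - D \<union> (\<Union>j\<in>I - {i}. \<gamma> j ` {\<alpha> j..\<beta> j})"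
    have "closed T" unfolding T_def \<gamma>
      using D(1) fin by (intro closed_Un closed_UN) (auto intro: compact_imp_closed compact_pt)
    moreover have "q i \<notin> T"
      using inD[OF i(1), of 1] \<alpha>[OF i(1)] gp(2)[OF i(1)] by (auto simp: T_def \<gamma>)
    moreover obtain s where "s > 0" "q i + of_real s * (q i - p i) \<notin> D"
      using ray_leaves_bounded[OF D(2), of "q i - p i" "q i"] pq[OF i(1)] by auto
    ultimately obtain t where t: "t > 0" "q i + of_real t * (q i - p i) \<in> T"
      "\<And>r. 0 \<le> r \<Longrightarrow> r < t \<Longrightarrow> q i + of_real r * (q i - p i) \<notin> T"
      using first_hit[of T "q i" s "q i - p i"] by (auto simp: T_def)
    have \<gamma>i: "\<gamma> i \<tau> = q i + of_real (\<tau> - 1) * (q i - p i)" for \<tau>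
      by (simp add: \<gamma> pt_def algebra_simps)
    have end_T: "\<gamma> i (1 + t) \<in> T" using t(2) by (simp add: \<gamma>i)
    have before_T: "\<gamma> i \<tau> \<notin> T" if "1 \<le> \<tau>" "\<tau> < 1 + t" for \<tau>
      using t(3)[of "\<tau> - 1"] that by (simp add: \<gamma>i)
    define \<beta>' where "\<beta>' = \<beta>(i := 1 + t)"
    \<comment> \<open>Arcs only grow, so the stopping conditions that were established earlier
      remain true.\<close>
    have mono: "\<beta> j \<le> \<beta>' j" for j using i t by (auto simp: \<beta>'_def)
    have \<gamma>_inj: "\<sigma> = \<tau>" if "\<gamma> i \<sigma> = \<gamma> i \<tau>" for \<sigma> \<tau>
      using that pq[OF i(1)] by (simp add: \<gamma> pt_eq_iff)
    \<comment> \<open>The hit may fall on an end of arc \<open>j\<close> instead of its inside. By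
      general position this end is not an endpoint of segment \<open>j\<close>, so arc
      \<open>j\<close> itself stopped there inside some arc \<open>k\<close>; and \<open>k\<close>
      is not \<open>i\<close>, because arc \<open>i\<close> only reached parameter 1 before.\<close>
    have endi: "\<gamma> i (1 + t) \<notin> D \<or> (\<exists>k\<in>I. k \<noteq> i \<and> (\<exists>\<sigma>. \<alpha> k < \<sigma> \<and> \<sigma> < \<beta> k \<and> \<gamma> i (1 + t) = \<gamma> k \<sigma>))"
    proof (cases "\<gamma> i (1 + t) \<in> D")
      case True
      then obtain j where j0: "j \<in> I - {i}" "\<gamma> i (1 + t) \<in> \<gamma> j ` {\<alpha> j..\<beta> j}"
        using end_T unfolding T_def by blast
      obtain \<tau> where "\<tau> \<in> {\<alpha> j..\<beta> j}" "\<gamma> i (1 + t) = \<gamma> j \<tau>"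
        using j0(2) by (rule imageE)
      then have j: "j \<in> I" "j \<noteq> i" "\<alpha> j \<le> \<tau>" "\<tau> \<le> \<beta> j" "\<gamma> i (1 + t) = \<gamma> j \<tau>"
        using j0(1) by simp_all
      have not_i: "k \<noteq> i" if "\<gamma> j \<tau> = \<gamma> k \<sigma>" "\<sigma> \<le> \<beta> k" for k \<sigma>
        using \<gamma>_inj[of "1 + t" \<sigma>] that j(5) i(2) t(1) by auto
      show ?thesis
      proof (cases "\<tau> = \<beta> j")
        case at_end: True
        have "j \<in> J"
        proof (rule ccontr)
          assume "j \<notin> J"
          then have "\<gamma> j \<tau> = q j" using at_end \<beta>J[OF j(1)] by (simp add: \<gamma>)
          then show False using gp(2)[OF j(1) i(1) j(2), of "1 + t"] j(5) by simp
        qed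
        then obtain k \<sigma> where "k \<in> I" "\<alpha> k < \<sigma>" "\<sigma> < \<beta> k" "\<gamma> j \<tau> = \<gamma> k \<sigma>"
          using \<beta>end[OF j(1)] True j(5) at_end by auto
        then show ?thesis using not_i[of k \<sigma>] j(5) by auto
      next
        case not_end: False
        show ?thesis
        proof (cases "\<tau> = \<alpha> j")
          case at_end: True
          have "\<alpha> j \<noteq> 0"
          proof
            assume "\<alpha> j = 0"
            then have "\<gamma> j \<tau> = p j" using at_end by (simp add: \<gamma>)
            then show False using gp(1)[OF j(1) i(1) j(2), of "1 + t"] j(5) by simp
          qed
          then obtain k \<sigma> where k: "k \<in> I" "\<alpha> k < \<sigma>" "\<sigma> < 1" "\<gamma> j \<tau> = \<gamma> k \<sigma>"
            using left[OF j(1)] True j(5) at_end by auto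
          then have "\<sigma> < \<beta> k" using \<beta>1[OF k(1)] by simp
          then show ?thesis using k not_i[of k \<sigma>] j(5) by auto
        next
          case False
          then show ?thesis using not_end j by force
        qed
      qed
    qed simp
    have newD: "\<gamma> i \<tau> \<in> D" if "\<alpha> i < \<tau>" "\<tau> < 1 + t" for \<tau>
    proof (cases "\<tau> \<le> 1")
      case True
      then show ?thesis using inD[OF i(1)] that by blast
    next
      case False
      then show ?thesis using before_T[of \<tau>] that by (auto simp: T_def)
    qed
    have newdisj: "\<gamma> i \<tau> \<noteq> \<gamma> k \<sigma>" if "k \<in> I" "k \<noteq> i" "\<alpha> i < \<tau>" "\<tau> < 1 + t" "\<alpha> k < \<sigma>" "\<sigma> < \<beta> k" for k \<tau> \<sigma>
    proof (cases "\<tau> < 1")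
      case True
      then show ?thesis using \<beta>disj[OF i(1)] that i by auto
    next
      case False
      then have "\<gamma> i \<tau> \<notin> \<gamma> k ` {\<alpha> k..\<beta> k}" using before_T[of \<tau>] that by (auto simp: T_def)
      then show ?thesis using that by auto
    qed
    have "Q (insert i J) \<beta>'"
      unfolding Q_def
    proof (intro conjI ballI impI allI)
      fix j assume j: "j \<in> I"
      show "1 \<le> \<beta>' j" using \<beta>1[OF j] mono[of j] by linarith
      show "\<beta>' j = 1" if "j \<notin> insert i J" using that \<beta>J[OF j] by (simp add: \<beta>'_def)
      show "\<gamma> j \<tau> \<in> D" if "\<alpha> j < \<tau>" "\<tau> < \<beta>' j" for \<tau>
        using that newD \<beta>D[OF j] by (auto simp: \<beta>'_def split: if_splits)
      show "1 < \<beta>' j" if "j \<in> insert i J"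
        using that \<beta>less[OF j] t(1) by (auto simp: \<beta>'_def)
      show "\<gamma> j (\<beta>' j) \<notin> D \<or> (\<exists>k\<in>I. k \<noteq> j \<and> (\<exists>\<sigma>. \<alpha> k < \<sigma> \<and> \<sigma> < \<beta>' k \<and> \<gamma> j (\<beta>' j) = \<gamma> k \<sigma>))"
        if "j \<in> insert i J"
      proof (cases "j = i")
        case True
        then have eq: "\<beta>' j = 1 + t" by (simp add: \<beta>'_def)
        show ?thesis unfolding eq unfolding True using endi mono by (meson less_le_trans)
      next
        case False
        then have eq: "\<beta>' j = \<beta> j" and "j \<in> J" using that by (auto simp: \<beta>'_def)
        show ?thesis unfolding eq using \<beta>end[OF j \<open>j \<in> J\<close>] mono by (meson less_le_trans)
      qed
    next
      fix j k \<tau> \<sigma> assume jk: "j \<in> I" "k \<in> I" "j \<noteq> k" "\<alpha> j < \<tau>" "\<tau> < \<beta>' j" "\<alpha> k < \<sigma>" "\<sigma> < \<beta>' k"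
      consider "j = i" | "k = i" | "j \<noteq> i" "k \<noteq> i" by blast
      then show "\<gamma> j \<tau> \<noteq> \<gamma> k \<sigma>"
      proof cases
        case 1
        then show ?thesis using jk newdisj[of k \<tau> \<sigma>] by (auto simp: \<beta>'_def)
      next
        case 2
        then show ?thesis using jk newdisj[of j \<sigma> \<tau>] by (auto simp: \<beta>'_def)
      next
        case 3
        then show ?thesis using jk \<beta>disj[of j k \<tau> \<sigma>] by (auto simp: \<beta>'_def)
      qed
    qed
    then show ?case by blast
  qed
  then have ex: "\<exists>\<beta>. Q I \<beta>" using fin by blast
  have imp: "?P \<beta>" if "Q I \<beta>" for \<beta>
  proof (rule conjI)
    note Q = that[unfolded Q_def]
    show "\<forall>i\<in>I. 1 < \<beta> i \<and> (\<forall>\<tau>. \<alpha> i < \<tau> \<longrightarrow> \<tau> < \<beta> i \<longrightarrow> \<gamma> i \<tau> \<in> D) \<and>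
        (\<gamma> i (\<beta> i) \<notin> D \<or> (\<exists>k\<in>I. k \<noteq> i \<and> (\<exists>\<sigma>. \<alpha> k < \<sigma> \<and> \<sigma> < \<beta> k \<and> \<gamma> i (\<beta> i) = \<gamma> k \<sigma>)))"
    proof
      fix i assume "i \<in> I"
      with bspec[OF conjunct1[OF Q] this]
      show "1 < \<beta> i \<and> (\<forall>\<tau>. \<alpha> i < \<tau> \<longrightarrow> \<tau> < \<beta> i \<longrightarrow> \<gamma> i \<tau> \<in> D) \<and>
        (\<gamma> i (\<beta> i) \<notin> D \<or> (\<exists>k\<in>I. k \<noteq> i \<and> (\<exists>\<sigma>. \<alpha> k < \<sigma> \<and> \<sigma> < \<beta> k \<and> \<gamma> i (\<beta> i) = \<gamma> k \<sigma>)))"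
        by argo
    qed
  qed (rule conjunct2[OF that[unfolded Q_def]])
  show ?thesis by (rule ex_forward[OF ex]) (rule imp)
qed

subsection \<open>Convex cells\<close>

text \<open>The cross product of plane vectors: positive if \<open>v\<close> points to the left of
  \<open>u\<close>, and zero if they are parallel.\<close>

definition cr :: "complex \<Rightarrow> complex \<Rightarrow> real" where
  "cr u v = Re u * Im v - Im u * Re v"

lemma cr_add_right: "cr u (v + w) = cr u v + cr u w"
  and cr_diff_right: "cr u (v - w) = cr u v - cr u w"
  and cr_minus_right: "cr u (- v) = - cr u v"
  and cr_add_left: "cr (v + w) u = cr v u + cr w u"
  and cr_diff_left: "cr (v - w) u = cr v u - cr w u"
  and cr_scale_right: "cr u (of_real t * v) = t * cr u v"
  and cr_scale_left: "cr (of_real t * u) v = t * cr u v"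
  by (simp_all add: cr_def algebra_simps)

lemma cr_self [simp]: "cr u u = 0" and cr_0_right [simp]: "cr u 0 = 0"
  by (simp_all add: cr_def)

lemma cr_commute: "cr u v = - cr v u"
  by (simp add: cr_def)

lemma cr_ii: "cr u (\<i> * u) = (Re u)\<^sup>2 + (Im u)\<^sup>2"
  by (simp add: cr_def power2_eq_square)

lemma continuous_on_cr [continuous_intros]:
  "continuous_on X f \<Longrightarrow> continuous_on X g \<Longrightarrow> continuous_on X (\<lambda>x. cr (f x) (g x))"
  unfolding cr_def by (intro continuous_intros)

lemma cr_eq_0_imp_scale:
  assumes "u \<noteq> 0" "cr u v = 0"
  obtains t where "v = of_real t * u"
proof (cases "Re u = 0")
  case False
  then show ?thesis using that[of "Re v / Re u"] assms by (simp add: cr_def complex_eq_iff field_simps)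
next
  case True
  then have "Im u \<noteq> 0" using assms(1) by (simp add: complex_eq_iff)
  then show ?thesis using that[of "Im v / Im u"] assms True by (simp add: cr_def complex_eq_iff field_simps)
qed

lemma cr_eq_0_imp_collinear:
  assumes "cr (w - z) (y - z) = 0"
  shows "collinear {z, w, y}"
proof -
  have "collinear {w, z, y}"
  proof (cases "w = z")
    case True
    then show ?thesis by simp
  next
    case False
    then obtain t where "y - z = of_real t * (w - z)" using cr_eq_0_imp_scale assms by (metis right_minus_eq)
    then show ?thesis by (subst collinear_3) (auto simp: collinear_lemma scaleR_conv_of_real)
  qed
  then show ?thesis by (simp add: insert_commute)
qed

text \<open>Cramer's rule for the basis \<open>a\<close>, \<open>b\<close>.\<close>

lemma cr_coordinates:
  assumes "cr a b \<noteq> 0"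
  shows "x = of_real (cr x b / cr a b) * a + of_real (cr a x / cr a b) * b"
proof -
  have "Re x * cr a b = cr x b * Re a + cr a x * Re b" "Im x * cr a b = cr x b * Im a + cr a x * Im b"
    by (simp_all add: cr_def algebra_simps)
  then show ?thesis using assms by (simp add: complex_eq_iff field_simps)
qed

lemma eventually_at_right_0_imp_ex:
  fixes P :: "real \<Rightarrow> bool"
  assumes "\<forall>\<^sub>F \<delta> in at_right 0. P \<delta>"
  shows "\<exists>\<delta>>0. P \<delta>"
proof -
  have "\<forall>\<^sub>F \<delta> in at_right (0::real). \<delta> > 0" by (simp add: eventually_at_right_less)
  with assms have "\<forall>\<^sub>F \<delta> in at_right 0. P \<delta> \<and> \<delta> > 0" by (rule eventually_conj)
  then show ?thesis using eventually_happens[of _ "at_right (0::real)"] trivial_limit_at_right_real by blast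
qed

lemma eventually_at_right_0_affine_pos:
  fixes c d :: real
  assumes "c > 0"
  shows "\<forall>\<^sub>F \<eta> in at_right 0. c + \<eta> * d > 0"
proof -
  have "((\<lambda>\<eta>. c + \<eta> * d) \<longlongrightarrow> c + 0 * d) (at_right 0)" by (intro tendsto_intros)
  then show ?thesis using assms by (intro order_tendstoD(1)) simp_all
qed

text \<open>The parameters 0 and 1 on the line \<open>\<gamma> i\<close> are the two endpoints of
  the segment, and \<open>\<alpha> i\<close>, \<open>\<beta> i\<close> are the ends of its
  extension. The bound \<open>\<sigma> < 1\<close> in \<open>left_end\<close>, against
  \<open>\<sigma> < \<beta> k\<close> in \<open>right_end\<close>, records that the left extensions
  were drawn first and so never stop on a right extension.\<close>

locale extension =
  fixes I :: "'i set" and p q :: "'i \<Rightarrow> complex" and D :: "complex set" and \<alpha> \<beta> :: "'i \<Rightarrow> real"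
  fixes \<gamma> :: "'i \<Rightarrow> real \<Rightarrow> complex" and d :: "'i \<Rightarrow> complex"
  defines "\<gamma> i \<equiv> pt (p i) (q i)" and "d i \<equiv> q i - p i"
  assumes fin: "finite I" and D: "open D" "convex D" "bounded D"
    and Re_less: "\<And>i. i \<in> I \<Longrightarrow> Re (p i) < Re (q i)"
    and gp: "\<And>i j \<tau>. i \<in> I \<Longrightarrow> j \<in> I \<Longrightarrow> i \<noteq> j \<Longrightarrow> p i \<noteq> \<gamma> j \<tau>"
       "\<And>i j \<tau>. i \<in> I \<Longrightarrow> j \<in> I \<Longrightarrow> i \<noteq> j \<Longrightarrow> q i \<noteq> \<gamma> j \<tau>"
    and \<alpha>_less: "\<And>i. i \<in> I \<Longrightarrow> \<alpha> i < 0" and \<beta>_greater: "\<And>i. i \<in> I \<Longrightarrow> 1 < \<beta> i"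
    and inD: "\<And>i \<tau>. i \<in> I \<Longrightarrow> \<alpha> i < \<tau> \<Longrightarrow> \<tau> < \<beta> i \<Longrightarrow> \<gamma> i \<tau> \<in> D"
    and disj: "\<And>i j \<tau> \<sigma>. i \<in> I \<Longrightarrow> j \<in> I \<Longrightarrow> i \<noteq> j \<Longrightarrow> \<alpha> i < \<tau> \<Longrightarrow> \<tau> < \<beta> i \<Longrightarrow>
       \<alpha> j < \<sigma> \<Longrightarrow> \<sigma> < \<beta> j \<Longrightarrow> \<gamma> i \<tau> \<noteq> \<gamma> j \<sigma>"
    and left_end: "\<And>i. i \<in> I \<Longrightarrow> \<gamma> i (\<alpha> i) \<in> D \<Longrightarrow>
       \<exists>k\<in>I. k \<noteq> i \<and> (\<exists>\<sigma>. \<alpha> k < \<sigma> \<and> \<sigma> < 1 \<and> \<gamma> i (\<alpha> i) = \<gamma> k \<sigma>)"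
    and right_end: "\<And>i. i \<in> I \<Longrightarrow> \<gamma> i (\<beta> i) \<in> D \<Longrightarrow>
       \<exists>k\<in>I. k \<noteq> i \<and> (\<exists>\<sigma>. \<alpha> k < \<sigma> \<and> \<sigma> < \<beta> k \<and> \<gamma> i (\<beta> i) = \<gamma> k \<sigma>)"
begin

section \<open>The extended segments and the visibility cells between them\<close>

definition U :: "complex set" where "U = (\<Union>i\<in>I. \<gamma> i ` {\<alpha> i..\<beta> i})"

text \<open>Cells are defined by visibility instead of as connected components: once visibility is
  transitive (\<open>free_trans\<close>), they are equivalence classes and their convexity follows
  at once.\<close>

definition cell :: "complex \<Rightarrow> complex set" where
  "cell z = {w \<in> D. closed_segment z w \<inter> U = {}}"

definition cells :: "complex set set" where "cells = cell ` (D - U)"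

lemma \<gamma>_0 [simp]: "\<gamma> i 0 = p i" and \<gamma>_1 [simp]: "\<gamma> i 1 = q i"
  by (simp_all add: \<gamma>_def)

lemma \<gamma>_plus: "\<gamma> i (\<tau> + \<delta>) = \<gamma> i \<tau> + of_real \<delta> * d i"
  by (simp add: \<gamma>_def d_def pt_def algebra_simps)

lemma \<gamma>_minus: "\<gamma> i \<tau> - \<gamma> i \<sigma> = of_real (\<tau> - \<sigma>) * d i"
  by (simp add: \<gamma>_def d_def pt_diff)

lemma Re_d: "i \<in> I \<Longrightarrow> Re (d i) > 0"
  using Re_less by (simp add: d_def)

lemma d_nz: "i \<in> I \<Longrightarrow> d i \<noteq> 0"
  using Re_d by force

lemma \<gamma>_eq_iff: "i \<in> I \<Longrightarrow> \<gamma> i \<sigma> = \<gamma> i \<tau> \<longleftrightarrow> \<sigma> = \<tau>"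
  using \<gamma>_minus[of i \<sigma> \<tau>] d_nz by force

lemma compact_L: "compact (\<gamma> i ` {\<alpha> i..\<beta> i})"
  by (simp add: \<gamma>_def compact_pt)

lemma compact_U: "compact U"
  unfolding U_def using fin compact_L by (intro compact_UN) auto

lemma closed_U: "closed U"
  using compact_U compact_imp_closed by blast

lemma open_free: "open (D - U)"
  using D(1) closed_U by (rule open_Diff)

lemma \<gamma>_in_U: "i \<in> I \<Longrightarrow> \<alpha> i \<le> \<tau> \<Longrightarrow> \<tau> \<le> \<beta> i \<Longrightarrow> \<gamma> i \<tau> \<in> U"
  unfolding U_def by (intro UN_I[of i] imageI) auto

text \<open>An extension that ends inside \<open>D\<close> ends in the inside of another one, so
  within \<open>D\<close> the closed arcs cover no more than the open ones.\<close>

lemma U_in_D: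
  assumes "z \<in> U" "z \<in> D"
  obtains i \<tau> where "i \<in> I" "\<alpha> i < \<tau>" "\<tau> < \<beta> i" "z = \<gamma> i \<tau>"
proof -
  obtain i \<tau> where i: "i \<in> I" "\<alpha> i \<le> \<tau>" "\<tau> \<le> \<beta> i" "z = \<gamma> i \<tau>"
    using assms(1) by (auto simp: U_def)
  consider "\<tau> = \<alpha> i" | "\<tau> = \<beta> i" | "\<alpha> i < \<tau>" "\<tau> < \<beta> i" using i by linarith
  then show ?thesis
  proof cases
    case 1
    then obtain k \<sigma> where "k \<in> I" "\<alpha> k < \<sigma>" "\<sigma> < 1" "z = \<gamma> k \<sigma>"
      using left_end[OF i(1)] i assms(2) by auto
    then show ?thesis using that[of k \<sigma>] \<beta>_greater[of k] by simp
  next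
    case 2
    then obtain k \<sigma> where "k \<in> I" "\<alpha> k < \<sigma>" "\<sigma> < \<beta> k" "z = \<gamma> k \<sigma>"
      using right_end[OF i(1)] i assms(2) by auto
    then show ?thesis using that by blast
  next
    case 3
    then show ?thesis using that i by blast
  qed
qed

text \<open>Parallel lines with a common point coincide, and then \<open>p j\<close> would lie on
  the line of segment \<open>i\<close>.\<close>

lemma not_parallel:
  assumes "i \<in> I" "j \<in> I" "i \<noteq> j" "\<gamma> i \<tau> = \<gamma> j \<sigma>"
  shows "cr (d i) (d j) \<noteq> 0"
proof
  assume "cr (d i) (d j) = 0"
  then obtain t where t: "d j = of_real t * d i" using cr_eq_0_imp_scale d_nz[OF assms(1)] by blast
  have "p j = \<gamma> j (\<sigma> + (- \<sigma>))" by simp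
  also have "\<dots> = \<gamma> i \<tau> + of_real (- \<sigma>) * d j" unfolding \<gamma>_plus assms(4) ..
  also have "\<dots> = \<gamma> i (\<tau> + (- \<sigma> * t))" unfolding \<gamma>_plus t by simp
  finally show False using gp(1)[OF assms(2,1)] assms(3) by auto
qed

text \<open>A point of \<open>U\<close> in the triangle \<open>z w y\<close> that is farthest from \<open>z y\<close> lies inside an extended
  segment parallel to \<open>z y\<close>. This segment cannot leave the triangle through the free sides, so it ends
  in the triangle, on an extended segment of another direction that reaches farther.\<close>

lemma free_trans:
  assumes zwy: "z \<in> D" "w \<in> D" "y \<in> D"
    and free: "closed_segment z w \<inter> U = {}" "closed_segment w y \<inter> U = {}"
  shows "closed_segment z y \<inter> U = {}"
proof (cases "cr (w - z) (y - z) = 0")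
  case True
  then have "collinear {z, w, y}" by (rule cr_eq_0_imp_collinear)
  then consider "w \<in> closed_segment z y" | "z \<in> closed_segment w y" | "y \<in> closed_segment z w"
    unfolding collinear_between_cases between_mem_segment by (auto simp: closed_segment_commute)
  then show ?thesis
  proof cases
    case 1
    then have "closed_segment z y = closed_segment z w \<union> closed_segment w y"
      using Un_closed_segment by metis
    then show ?thesis using free by auto
  next
    case 2
    then have "closed_segment z y \<subseteq> closed_segment w y" by (simp add: subset_closed_segment)
    then show ?thesis using free by auto
  next
    case 3
    then have "closed_segment z y \<subseteq> closed_segment z w" by (simp add: subset_closed_segment)
    then show ?thesis using free by auto
  qed
next
  case nz: False
  define a b where "a = w - z" and "b = y - z"
  define \<Delta> where "\<Delta> = cr a b"
  have \<Delta>: "\<Delta> \<noteq> 0" using nz by (simp add: \<Delta>_def a_def b_def)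
  \<comment> \<open>Affine coordinates with origin \<open>z\<close> in the basis \<open>a\<close>,
    \<open>b\<close>; \<open>s\<close> measures the distance from the line through \<open>z\<close>
    and \<open>y\<close>, up to a factor. Their linear parts are \<open>s'\<close> and
    \<open>r'\<close>.\<close>
  define s r where "s x = cr (x - z) b / \<Delta>" and "r x = cr a (x - z) / \<Delta>" for x
  define s' r' where "s' v = cr v b / \<Delta>" and "r' v = cr a v / \<Delta>" for v
  have coord: "x = z + of_real (s x) * a + of_real (r x) * b" for x
    using cr_coordinates[of a b "x - z"] \<Delta> unfolding s_def r_def \<Delta>_def
    by (metis add.assoc add_diff_cancel_left' diff_add_cancel add.commute)
  have move: "s (x + of_real \<delta> * v) = s x + \<delta> * s' v" "r (x + of_real \<delta> * v) = r x + \<delta> * r' v" for x \<delta> v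
    by (simp_all add: s_def r_def s'_def r'_def cr_scale_left cr_scale_right cr_add_left cr_add_right
        cr_diff_left cr_diff_right add_divide_distrib diff_divide_distrib)
  have sr: "s (z + of_real t * a + of_real u * b) = t" "r (z + of_real t * a + of_real u * b) = u" for t u
    using \<Delta> cr_self[of a] cr_self[of b] 
    by (simp_all add: s_def r_def cr_add_left cr_add_right cr_scale_left cr_scale_right \<Delta>_def)
  define H where "H = {x. 0 \<le> s x} \<inter> {x. 0 \<le> r x} \<inter> {x. s x + r x \<le> 1}"
  have cont: "continuous_on UNIV s" "continuous_on UNIV r"
    unfolding s_def r_def using \<Delta> by (auto intro!: continuous_intros)
  have "closed H" unfolding H_def
    by (intro closed_Int closed_Collect_le continuous_intros cont)
  have HD: "x \<in> D" if "x \<in> H" for x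
  proof -
    have "x = of_real (1 - s x - r x) * z + of_real (s x) * w + of_real (r x) * y"
      using coord[of x] unfolding a_def b_def by (simp add: algebra_simps)
    then have "x = (1 - s x - r x) *\<^sub>R z + s x *\<^sub>R w + r x *\<^sub>R y" by (simp add: scaleR_conv_of_real)
    moreover have "(1 - s x - r x) *\<^sub>R z + s x *\<^sub>R w + r x *\<^sub>R y \<in> convex hull {z, w, y}"
      unfolding convex_hull_3 using that by (force simp: H_def)
    moreover have "convex hull {z, w, y} \<subseteq> D" using zwy D(2) by (intro hull_minimal) auto
    ultimately show ?thesis by auto
  qed
  \<comment> \<open>The free sides of the triangle \<open>H\<close> are \<open>r = 0\<close> and
    \<open>s + r = 1\<close>, so both inequalities are strict on \<open>U\<close>; only the side
    \<open>s = 0\<close> can be met.\<close>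
  have r_pos: "r x > 0" if "x \<in> H" "x \<in> U" for x
  proof (rule ccontr)
    assume "\<not> r x > 0"
    then have "r x = 0" "0 \<le> s x" "s x \<le> 1" using that by (auto simp: H_def)
    then have "x \<in> closed_segment z w"
      unfolding in_segment using coord[of x]
      by (intro exI[of _ "s x"]) (simp add: a_def scaleR_conv_of_real algebra_simps)
    then show False using free that by auto
  qed
  have sr_less: "s x + r x < 1" if "x \<in> H" "x \<in> U" for x
  proof (rule ccontr)
    assume "\<not> s x + r x < 1"
    then have *: "s x = 1 - r x" "0 \<le> r x" "r x \<le> 1" using that by (auto simp: H_def)
    have "x = z + (1 - of_real (r x)) * a + of_real (r x) * b" using coord[of x] *(1) by simp
    also have "\<dots> = (1 - r x) *\<^sub>R w + r x *\<^sub>R y"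
      by (simp add: a_def b_def scaleR_conv_of_real algebra_simps)
    finally have "x \<in> closed_segment w y" unfolding in_segment using * by blast
    then show False using free that by auto
  qed
  show ?thesis
  proof (rule ccontr)
    assume "closed_segment z y \<inter> U \<noteq> {}"
    then obtain x0 where x0: "x0 \<in> closed_segment z y" "x0 \<in> U" by blast
    obtain u where u: "0 \<le> u" "u \<le> 1" "x0 = (1 - u) *\<^sub>R z + u *\<^sub>R y"
      using x0(1) unfolding in_segment by blast
    have "x0 = z + of_real 0 * a + of_real u * b"
      using u(3) by (simp add: b_def scaleR_conv_of_real algebra_simps)
    then have "s x0 = 0" "r x0 = u" using sr by metis+
    then have "x0 \<in> U \<inter> H" using u x0 by (simp add: H_def)
    moreover have "compact (U \<inter> H)" using compact_U \<open>closed H\<close> by (rule compact_Int_closed)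
    ultimately obtain x where x: "x \<in> U" "x \<in> H" and max: "\<And>x'. x' \<in> U \<Longrightarrow> x' \<in> H \<Longrightarrow> s x' \<le> s x"
      using continuous_attains_sup[of "U \<inter> H" s] cont(1) continuous_on_subset by (metis IntD1 IntD2 IntI empty_iff top_greatest)
    \<comment> \<open>Otherwise a short move along the arc, in the direction \<open>e\<close> in
      which \<open>s\<close> grows, would stay in the triangle and in \<open>U\<close> and exceed
      the maximum of \<open>s\<close>.\<close>
    have parallel: "s' (d i) = 0"
      if i: "i \<in> I" "\<alpha> i < \<tau>" "\<tau> < \<beta> i" and \<gamma>: "\<gamma> i \<tau> \<in> H" "s (\<gamma> i \<tau>) = s x" for i \<tau>
    proof (rule ccontr)
      assume nz: "s' (d i) \<noteq> 0"
      define e where "e = sgn (s' (d i))"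
      let ?x = "\<gamma> i \<tau>"
      have xU: "?x \<in> U" using i by (intro \<gamma>_in_U) auto
      have "\<forall>\<^sub>F \<eta> in at_right 0. (\<tau> - \<alpha> i) + \<eta> * e > 0 \<and> (\<beta> i - \<tau>) + \<eta> * (- e) > 0 \<and>
          r ?x + \<eta> * (e * r' (d i)) > 0 \<and> (1 - s ?x - r ?x) + \<eta> * (- e * (s' (d i) + r' (d i))) > 0 \<and> 0 < \<eta>"
        using i r_pos[OF \<gamma>(1) xU] sr_less[OF \<gamma>(1) xU]
        by (intro eventually_conj eventually_at_right_0_affine_pos) (auto simp: eventually_at_right_less)
      then obtain \<eta> where \<eta>: "(\<tau> - \<alpha> i) + \<eta> * e > 0" "(\<beta> i - \<tau>) + \<eta> * (- e) > 0"
          "r ?x + \<eta> * (e * r' (d i)) > 0" "(1 - s ?x - r ?x) + \<eta> * (- e * (s' (d i) + r' (d i))) > 0" "0 < \<eta>"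
        using eventually_happens[of _ "at_right (0::real)"] trivial_limit_at_right_real by blast
      let ?y = "\<gamma> i (\<tau> + \<eta> * e)"
      have "?y \<in> U" using i \<eta> by (intro \<gamma>_in_U) auto
      have "e * s' (d i) > 0" using nz by (auto simp: e_def sgn_if)
      then have pos: "\<eta> * e * s' (d i) > 0" using \<eta>(5) by (simp add: mult.assoc)
      have sy: "s ?y = s ?x + \<eta> * e * s' (d i)" "r ?y = r ?x + \<eta> * e * r' (d i)"
        unfolding \<gamma>_plus move by simp_all
      have "s ?x \<ge> 0" using \<gamma>(1) by (simp add: H_def)
      then have "?y \<in> H" using pos \<eta> sy by (auto simp: H_def algebra_simps)
      then show False using max[OF \<open>?y \<in> U\<close>] sy pos \<gamma>(2) by linarith
    qed
    obtain i \<tau> where i: "i \<in> I" "\<alpha> i < \<tau>" "\<tau> < \<beta> i" "x = \<gamma> i \<tau>"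
      using U_in_D[OF x(1) HD[OF x(2)]] by metis
    have s0: "s' (d i) = 0" using parallel[OF i(1-3)] x(2) i(4) by simp
    have r0: "r' (d i) \<noteq> 0"
    proof
      assume "r' (d i) = 0"
      then have "cr (d i) b = 0" "cr a (d i) = 0" using s0 \<Delta> by (auto simp: s'_def r'_def)
      then have "d i = 0" using cr_coordinates[of a b "d i"] \<Delta> by (simp add: \<Delta>_def)
      then show False using d_nz[OF i(1)] by simp
    qed
    \<comment> \<open>The end of the arc towards which \<open>r\<close> grows, that is, in the
      direction of the free side from \<open>w\<close> to \<open>y\<close>.\<close>
    define \<tau>1 where "\<tau>1 = (if r' (d i) > 0 then \<beta> i else \<alpha> i)"
    let ?x1 = "\<gamma> i \<tau>1"
    have dir: "(\<tau>1 - \<tau>) * r' (d i) > 0"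
      using r0 i by (auto simp: \<tau>1_def intro: mult_pos_pos mult_neg_neg)
    have x1: "s ?x1 = s x" "r ?x1 = r x + (\<tau>1 - \<tau>) * r' (d i)"
      using move[of "\<gamma> i \<tau>" "\<tau>1 - \<tau>" "d i"] \<gamma>_plus[of i \<tau> "\<tau>1 - \<tau>"] s0 i(4) by auto
    have x1U: "?x1 \<in> U" using i by (intro \<gamma>_in_U) (auto simp: \<tau>1_def)
    have "s x + r ?x1 < 1"
    proof (rule ccontr)
      assume "\<not> s x + r ?x1 < 1"
      then have ge: "(\<tau>1 - \<tau>) * r' (d i) \<ge> 1 - s x - r x" using x1 by simp
      \<comment> \<open>The shift of the parameter at which the arc would meet the side from
        \<open>w\<close> to \<open>y\<close>.\<close>
      define \<delta> where "\<delta> = (1 - s x - r x) / r' (d i)"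
      have pos: "1 - s x - r x > 0" using sr_less[OF x(2,1)] by linarith
      have \<delta>: "\<delta> * r' (d i) = 1 - s x - r x" using r0 by (simp add: \<delta>_def)
      have "\<alpha> i \<le> \<tau> + \<delta> \<and> \<tau> + \<delta> \<le> \<beta> i"
      proof (cases "r' (d i) > 0")
        case True
        then have "\<tau>1 = \<beta> i" by (simp add: \<tau>1_def)
        have "\<delta> > 0" using True pos by (simp add: \<delta>_def)
        moreover have "\<delta> \<le> \<tau>1 - \<tau>" using ge \<delta> True by (metis mult_le_cancel_right_pos)
        ultimately show ?thesis using i \<open>\<tau>1 = \<beta> i\<close> by linarith
      next
        case False
        then have "\<tau>1 = \<alpha> i" "r' (d i) < 0" using r0 by (auto simp: \<tau>1_def)
        have "\<delta> < 0" using \<open>r' (d i) < 0\<close> pos by (simp add: \<delta>_def divide_pos_neg)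
        moreover have "\<tau>1 - \<tau> \<le> \<delta>" using ge \<delta> \<open>r' (d i) < 0\<close> by (metis mult_le_cancel_right_neg)
        ultimately show ?thesis using i \<open>\<tau>1 = \<alpha> i\<close> by linarith
      qed
      then have "\<gamma> i (\<tau> + \<delta>) \<in> U" using i by (intro \<gamma>_in_U) auto
      moreover have "s (\<gamma> i (\<tau> + \<delta>)) = s x" "r (\<gamma> i (\<tau> + \<delta>)) = 1 - s x"
        unfolding \<gamma>_plus move using s0 \<delta> i(4) by auto
      moreover from this have "\<gamma> i (\<tau> + \<delta>) \<in> H"
        using x pos r_pos[OF x(2,1)] by (auto simp: H_def)
      ultimately show False using sr_less by fastforce
    qed
    then have x1H: "?x1 \<in> H" using x1 dir x r_pos[OF x(2,1)] by (auto simp: H_def)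
    obtain j \<sigma> where j: "j \<in> I" "\<alpha> j < \<sigma>" "\<sigma> < \<beta> j" "?x1 = \<gamma> j \<sigma>"
      using U_in_D[OF x1U HD[OF x1H]] by metis
    have "j \<noteq> i"
    proof
      assume "j = i"
      then have "\<sigma> = \<tau>1" using j(4) \<gamma>_eq_iff[OF i(1)] by auto
      then show False using j \<open>j = i\<close> by (auto simp: \<tau>1_def split: if_splits)
    qed
    \<comment> \<open>The end still has the maximal \<open>s\<close>, so the arc \<open>j\<close> on
      which it lies is also parallel to \<open>z y\<close>, although meeting arcs have different
      directions.\<close>
    have "s' (d j) = 0" using parallel[OF j(1-3)] x1H x1 j(4) by simp
    then have "cr (d j) b = 0" "cr (d i) b = 0" using s0 \<Delta> by (auto simp: s'_def)
    moreover have "b \<noteq> 0" using \<Delta> by (auto simp: \<Delta>_def)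
    ultimately obtain t1 t2 where t: "d j = of_real t1 * b" "d i = of_real t2 * b"
      using cr_eq_0_imp_scale cr_commute by (metis neg_equal_0_iff_equal)
    have "cr (d i) (d j) = 0" unfolding t by (simp add: cr_scale_left cr_scale_right)
    then show False using not_parallel[OF i(1) j(1) _ j(4)] \<open>j \<noteq> i\<close> by blast
  qed
qed

section \<open>The free points split into disjoint open convex cells\<close>

lemma mem_cell: "z \<in> D - U \<Longrightarrow> z \<in> cell z"
  by (simp add: cell_def)

lemma cell_subset: "cell z \<subseteq> D - U"
  by (auto simp: cell_def)

lemma cell_eq:
  assumes "z \<in> D - U" "w \<in> cell z"
  shows "cell w = cell z"
proof -
  have w: "w \<in> D" "closed_segment z w \<inter> U = {}" "closed_segment w z \<inter> U = {}"
    using assms by (auto simp: cell_def closed_segment_commute)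
  show ?thesis
    using free_trans[of z w] free_trans[of w z] w assms by (auto simp: cell_def)
qed

lemma open_cell: assumes "z \<in> D - U" shows "open (cell z)"
proof (rule openI)
  fix w assume w: "w \<in> cell z"
  then have "w \<in> D - U" using cell_subset by blast
  then obtain e where e: "e > 0" "ball w e \<subseteq> D - U" using open_free openE by blast
  have "ball w e \<subseteq> cell w"
  proof
    fix u assume u: "u \<in> ball w e"
    then have "closed_segment w u \<subseteq> ball w e" using e by (intro closed_segment_subset) auto
    then show "u \<in> cell w" using e u by (auto simp: cell_def)
  qed
  then show "\<exists>T>0. ball w T \<subseteq> cell z" using e cell_eq[OF assms w] by blast
qed

lemma convex_cell: assumes "z \<in> D - U" shows "convex (cell z)"
  unfolding convex_contains_segment
proof (intro ballI subsetI)
  fix u v x assume uv: "u \<in> cell z" "v \<in> cell z" and x: "x \<in> closed_segment u v"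
  have u: "u \<in> D" "closed_segment z u \<inter> U = {}" "closed_segment u z \<inter> U = {}"
    and v: "v \<in> D" "closed_segment z v \<inter> U = {}"
    using uv by (auto simp: cell_def closed_segment_commute)
  have "closed_segment u v \<inter> U = {}" using free_trans[of u z v] u v assms by auto
  moreover have "closed_segment u x \<subseteq> closed_segment u v" using x by (simp add: subset_closed_segment)
  moreover have "x \<in> D" using x u v D(2) by (meson closed_segment_subset subsetD)
  ultimately show "x \<in> cell z" using free_trans[of z u x] u assms by (auto simp: cell_def)
qed

lemma cells_disjoint: "C \<in> cells \<Longrightarrow> C' \<in> cells \<Longrightarrow> C \<noteq> C' \<Longrightarrow> C \<inter> C' = {}"
  unfolding cells_def using cell_eq by blast

lemma cells_props:
  assumes "C \<in> cells"
  shows "open C" "convex C" "C \<subseteq> D - U" "C \<noteq> {}"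
  using assms open_cell convex_cell cell_subset mem_cell unfolding cells_def by blast+

end

subsection \<open>The two cells at an endpoint\<close>

context extension begin

text \<open>As \<open>d i\<close> points to the right, \<open>s = 1\<close> selects the cell above
  the segment at its endpoint \<open>v\<close>, and \<open>s = -1\<close> the cell below.\<close>

definition side :: "'i \<Rightarrow> complex \<Rightarrow> real \<Rightarrow> complex set" where
  "side i v s = (SOME C. C \<in> cells \<and> (\<forall>\<^sub>F w in nhds v. s * cr (d i) (w - v) > 0 \<longrightarrow> w \<in> C))"

lemma vertex_in_U: "i \<in> I \<Longrightarrow> p i \<in> U \<and> q i \<in> U"
  using \<gamma>_in_U[of i 0] \<gamma>_in_U[of i 1] \<alpha>_less \<beta>_greater by (metis \<gamma>_0 \<gamma>_1 less_imp_le less_trans zero_less_one)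

lemma vertex_in_D: "i \<in> I \<Longrightarrow> p i \<in> D \<and> q i \<in> D"
  using inD[of i 0] inD[of i 1] \<alpha>_less \<beta>_greater by (metis \<gamma>_0 \<gamma>_1 less_trans zero_less_one)

lemma cr_on_line: "cr (d i) (\<gamma> i \<tau> - \<gamma> i \<sigma>) = 0"
  by (simp only: \<gamma>_minus cr_scale_right cr_self mult_zero_right)

text \<open>By general position the endpoint is on no other arc. These arcs are closed and finitely
  many, so they all keep away from a neighbourhood of it.\<close>

lemma eventually_near_vertex:
  assumes i: "i \<in> I" and v: "v \<in> {p i, q i}"
  shows "\<forall>\<^sub>F w in nhds v. w \<in> D \<and> (w \<in> U \<longrightarrow> cr (d i) (w - v) = 0)"
proof -
  obtain \<sigma> where \<sigma>: "v = \<gamma> i \<sigma>" using v \<gamma>_0 \<gamma>_1 by (metis insertE singletonD)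
  have "\<forall>\<^sub>F w in nhds v. w \<in> D" using D(1) vertex_in_D[OF i] v by (intro eventually_nhds_in_open) auto
  moreover have "\<forall>\<^sub>F w in nhds v. \<forall>j\<in>I - {i}. w \<notin> \<gamma> j ` {\<alpha> j..\<beta> j}"
  proof (rule eventually_ball_finite)
    show "\<forall>j\<in>I - {i}. \<forall>\<^sub>F w in nhds v. w \<notin> \<gamma> j ` {\<alpha> j..\<beta> j}"
    proof
      fix j assume "j \<in> I - {i}"
      then have "v \<in> - \<gamma> j ` {\<alpha> j..\<beta> j}" using gp(1)[of i j] gp(2)[of i j] i v by (auto; metis)
      moreover have "open (- \<gamma> j ` {\<alpha> j..\<beta> j})" using compact_L compact_imp_closed by blast
      ultimately have "\<forall>\<^sub>F w in nhds v. w \<in> - \<gamma> j ` {\<alpha> j..\<beta> j}" by (intro eventually_nhds_in_open)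
      then show "\<forall>\<^sub>F w in nhds v. w \<notin> \<gamma> j ` {\<alpha> j..\<beta> j}" by simp
    qed
  qed (use fin in simp)
  ultimately show ?thesis
  proof eventually_elim
    case (elim w)
    have "cr (d i) (w - v) = 0" if "w \<in> U"
    proof -
      obtain j where "j \<in> I" "w \<in> \<gamma> j ` {\<alpha> j..\<beta> j}" using \<open>w \<in> U\<close> by (auto simp: U_def)
      then have "w \<in> \<gamma> i ` {\<alpha> i..\<beta> i}" using elim by (cases "j = i") auto
      then show ?thesis using cr_on_line \<sigma> by auto
    qed
    then show ?case using elim by blast
  qed
qed

lemma cr_d_ii: "i \<in> I \<Longrightarrow> cr (d i) (\<i> * d i) > 0"
  unfolding cr_ii using Re_d[of i] by (intro add_pos_nonneg zero_less_power) simp_all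

lemma tendsto_affine_at_right_0: "((\<lambda>\<delta>. v + of_real \<delta> * u) \<longlongrightarrow> (v :: complex)) (at_right 0)"
proof -
  have "((\<lambda>\<delta>. v + of_real \<delta> * u) \<longlongrightarrow> v + of_real 0 * u) (at_right 0)" by (intro tendsto_intros)
  then show ?thesis by simp
qed

lemma convex_half_plane: "convex {w. s * cr a (w - v) > 0}"
proof -
  have "{w. s * cr a (w - v) > 0} = {w. inner (Complex (- s * Im a) (s * Re a)) w > s * cr a v}"
    by (auto simp: cr_def inner_complex_def algebra_simps)
  then show ?thesis by (simp add: convex_halfspace_gt)
qed

text \<open>A small half disk at \<open>v\<close> is convex and free, so all its points see one
  another.\<close>

lemma ex_side:
  assumes i: "i \<in> I" and v: "v \<in> {p i, q i}" and s: "s \<in> {1, -1}"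
  shows "\<exists>C. C \<in> cells \<and> (\<forall>\<^sub>F w in nhds v. s * cr (d i) (w - v) > 0 \<longrightarrow> w \<in> C)"
proof -
  obtain e where e: "e > 0" "\<And>w. w \<in> ball v e \<Longrightarrow> w \<in> D \<and> (w \<in> U \<longrightarrow> cr (d i) (w - v) = 0)"
    using eventually_near_vertex[OF i v] by (auto simp: eventually_nhds_metric dist_commute)
  define h where "h = ball v e \<inter> {w. s * cr (d i) (w - v) > 0}"
  have "convex h" unfolding h_def by (intro convex_Int convex_ball convex_half_plane)
  have "h \<subseteq> D - U" using e(2) by (force simp: h_def)
  have "\<forall>\<^sub>F \<delta> in at_right 0. v + of_real \<delta> * (of_real s * (\<i> * d i)) \<in> ball v e"
    by (rule topological_tendstoD[OF tendsto_affine_at_right_0]) (use e(1) in auto)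
  from eventually_at_right_0_imp_ex[OF this] obtain \<delta> where \<delta>: "v + of_real \<delta> * (of_real s * (\<i> * d i)) \<in> ball v e" "\<delta> > 0" by blast
  let ?w = "v + of_real \<delta> * (of_real s * (\<i> * d i))"
  have "s * (\<delta> * (s * cr (d i) (\<i> * d i))) > 0"
    using s \<delta>(2) cr_d_ii[OF i] by auto
  then have "?w \<in> h" using \<delta> by (simp add: h_def cr_scale_right)
  have "h \<subseteq> cell ?w"
  proof
    fix w assume "w \<in> h"
    then have "closed_segment ?w w \<subseteq> h" using \<open>?w \<in> h\<close> \<open>convex h\<close> by (simp add: closed_segment_subset)
    then show "w \<in> cell ?w" using \<open>h \<subseteq> D - U\<close> \<open>w \<in> h\<close> by (auto simp: cell_def)
  qed
  then have "\<forall>\<^sub>F w in nhds v. s * cr (d i) (w - v) > 0 \<longrightarrow> w \<in> cell ?w"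
    unfolding eventually_nhds_metric using e(1) by (auto simp: h_def dist_commute intro!: exI[of _ e])
  moreover have "cell ?w \<in> cells" using \<open>?w \<in> h\<close> \<open>h \<subseteq> D - U\<close> by (auto simp: cells_def)
  ultimately show ?thesis by blast
qed

lemma side_cell:
  assumes "i \<in> I" "v \<in> {p i, q i}" "s \<in> {1, -1}"
  shows "side i v s \<in> cells" "\<forall>\<^sub>F w in nhds v. s * cr (d i) (w - v) > 0 \<longrightarrow> w \<in> side i v s"
  using someI_ex[OF ex_side[OF assms]] unfolding side_def by blast+

lemma side_approach:
  assumes iv: "i \<in> I" "v \<in> {p i, q i}" "s \<in> {1, -1}" and u: "s * cr (d i) u > 0"
  shows "\<forall>\<^sub>F \<delta> in at_right 0. v + of_real \<delta> * u \<in> side i v s"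
proof -
  have "\<forall>\<^sub>F \<delta> in at_right 0. s * cr (d i) (v + of_real \<delta> * u - v) > 0 \<longrightarrow> v + of_real \<delta> * u \<in> side i v s"
    using side_cell(2)[OF iv] tendsto_affine_at_right_0 by (rule eventually_compose_filterlim)
  moreover have "\<forall>\<^sub>F \<delta> in at_right (0::real). \<delta> > 0" by (simp add: eventually_at_right_less)
  ultimately show ?thesis
  proof eventually_elim
    case (elim \<delta>)
    have "s * cr (d i) (v + of_real \<delta> * u - v) = \<delta> * (s * cr (d i) u)" by (simp add: cr_scale_right)
    also have "\<dots> > 0" using u elim by simp
    finally show ?case using elim by blast
  qed
qed

text \<open>If a point \<open>w\<close> of the cell lay strictly on the other side, the cell would
  also contain a point on the prolongation of the segment from \<open>w\<close> to \<open>v\<close>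
  beyond \<open>v\<close>; by convexity it would contain \<open>v\<close>, which belongs to
  \<open>U\<close>. A point on the line itself could be pushed to the other side, as the cell is
  open.\<close>

lemma side_cr_pos:
  assumes iv: "i \<in> I" "v \<in> {p i, q i}" "s \<in> {1, -1}" and w: "w \<in> side i v s"
  shows "s * cr (d i) (w - v) > 0"
proof -
  note C = cells_props[OF side_cell(1)[OF iv]]
  have not_neg: False if w: "w \<in> side i v s" "s * cr (d i) (w - v) < 0" for w
  proof -
    have "s * cr (d i) (v - w) > 0" using w by (simp add: cr_diff_right algebra_simps)
    then have "\<forall>\<^sub>F \<delta> in at_right 0. v + of_real \<delta> * (v - w) \<in> side i v s" by (rule side_approach[OF iv])
    from eventually_at_right_0_imp_ex[OF this] obtain \<delta> where \<delta>: "v + of_real \<delta> * (v - w) \<in> side i v s" "\<delta> > 0" by blast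
    let ?u = "v + of_real \<delta> * (v - w)"
    have "?u + \<delta> *\<^sub>R w = (1 + \<delta>) *\<^sub>R v" by (simp add: scaleR_conv_of_real algebra_simps)
    then have "v = (1 / (1 + \<delta>)) *\<^sub>R (?u + \<delta> *\<^sub>R w)" using \<delta>(2) by simp
    then have "v = (1 / (1 + \<delta>)) *\<^sub>R ?u + (\<delta> / (1 + \<delta>)) *\<^sub>R w" by (simp add: scaleR_add_right)
    moreover have "1 / (1 + \<delta>) + \<delta> / (1 + \<delta>) = 1" using \<delta>(2) by (simp add: field_simps)
    ultimately have "v \<in> side i v s"
      using convexD[OF C(2) \<delta>(1) w(1), of "1 / (1 + \<delta>)" "\<delta> / (1 + \<delta>)"] \<delta>(2) by simp
    then show False using C(3) vertex_in_U[OF iv(1)] iv(2) by auto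
  qed
  show ?thesis
  proof (rule ccontr)
    assume "\<not> s * cr (d i) (w - v) > 0"
    moreover have "\<not> s * cr (d i) (w - v) < 0" using not_neg w by blast
    ultimately have eq: "s * cr (d i) (w - v) = 0" by linarith
    have "\<forall>\<^sub>F \<delta> in at_right 0. w + of_real \<delta> * (of_real (- s) * (\<i> * d i)) \<in> side i v s"
      by (rule topological_tendstoD[OF tendsto_affine_at_right_0 C(1) w])
    from eventually_at_right_0_imp_ex[OF this] obtain \<delta> where \<delta>: "w + of_real \<delta> * (of_real (- s) * (\<i> * d i)) \<in> side i v s" "\<delta> > 0" by blast
    have "s * cr (d i) (w + of_real \<delta> * (of_real (- s) * (\<i> * d i)) - v)
        = s * cr (d i) (w - v) - \<delta> * (s * s) * cr (d i) (\<i> * d i)"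
      by (simp only: cr_diff_right cr_add_right cr_scale_right) (simp add: algebra_simps)
    also have "\<dots> < 0" using eq \<delta>(2) cr_d_ii[OF iv(1)] iv(3) by auto
    finally show False using not_neg \<delta>(1) by blast
  qed
qed

lemma side_closure_cr:
  assumes iv: "i \<in> I" "v \<in> {p i, q i}" "s \<in> {1, -1}" and w: "w \<in> closure (side i v s)"
  shows "s * cr (d i) (w - v) \<ge> 0"
proof -
  have "closed {w. s * cr (d i) (w - v) \<ge> 0}"
    by (intro closed_Collect_le continuous_intros)
  moreover have "side i v s \<subseteq> {w. s * cr (d i) (w - v) \<ge> 0}"
    using side_cr_pos[OF iv] by (auto intro: less_imp_le)
  ultimately have "closure (side i v s) \<subseteq> {w. s * cr (d i) (w - v) \<ge> 0}"
    by (rule closure_minimal[rotated])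
  then show ?thesis using w by auto
qed

lemma vertex_in_closure_side:
  assumes iv: "i \<in> I" "v \<in> {p i, q i}" "s \<in> {1, -1}"
  shows "v \<in> closure (side i v s)"
proof -
  have "s * cr (d i) (of_real s * (\<i> * d i)) > 0"
    using iv(3) cr_d_ii[OF iv(1)] by (auto simp: cr_scale_right cr_minus_right)
  then have "\<forall>\<^sub>F \<delta> in at_right 0. v + of_real \<delta> * (of_real s * (\<i> * d i)) \<in> side i v s"
    by (rule side_approach[OF iv])
  then have "\<forall>\<^sub>F \<delta> in at_right 0. v + of_real \<delta> * (of_real s * (\<i> * d i)) \<in> closure (side i v s)"
    by eventually_elim (use closure_subset in blast)
  then show ?thesis
    using Lim_in_closed_set[OF closed_closure _ _ tendsto_affine_at_right_0] trivial_limit_at_right_real by blast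
qed

text \<open>Close to \<open>v\<close> the segment runs inside the cell. From such an interior point
  of a convex set, the open segment to any point of the closure stays in the interior, which covers
  both halves.\<close>

lemma open_segment_in_side:
  assumes iv: "i \<in> I" "v \<in> {p i, q i}" "s \<in> {1, -1}"
    and b: "b \<in> closure (side i v s)" "s * cr (d i) (b - v) > 0"
  shows "open_segment v b \<subseteq> side i v s"
proof -
  note C = cells_props[OF side_cell(1)[OF iv]]
  have "\<forall>\<^sub>F \<delta> in at_right 0. v + of_real \<delta> * (b - v) \<in> side i v s" by (rule side_approach[OF iv b(2)])
  moreover have "\<forall>\<^sub>F \<delta> in at_right (0::real). \<delta> \<in> {0<..<1}" by (rule eventually_at_right_real) simp
  ultimately have "\<forall>\<^sub>F \<delta> in at_right 0. v + of_real \<delta> * (b - v) \<in> side i v s \<and> \<delta> \<in> {0<..<1}"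
    by (rule eventually_conj)
  then obtain \<delta> where \<delta>: "v + of_real \<delta> * (b - v) \<in> side i v s" "0 < \<delta>" "\<delta> < 1"
    using eventually_happens[of _ "at_right (0::real)"] trivial_limit_at_right_real by (auto simp: greaterThanLessThan_iff)
  define m where "m = v + of_real \<delta> * (b - v)"
  have "v \<noteq> b" using b(2) by auto
  then have m: "m \<in> open_segment v b"
    unfolding in_segment using \<delta> by (auto simp: m_def scaleR_conv_of_real algebra_simps intro!: exI[of _ \<delta>])
  have mC: "m \<in> interior (side i v s)" using \<delta>(1) C(1) by (simp add: m_def interior_open)
  have "open_segment m v \<subseteq> interior (side i v s)" "open_segment m b \<subseteq> interior (side i v s)"
    using in_interior_closure_convex_segment[OF C(2) mC] vertex_in_closure_side[OF iv] b(1) by blast+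
  then have "open_segment v m \<union> {m} \<union> open_segment m b \<subseteq> side i v s"
    using mC C(1) by (simp add: interior_open open_segment_commute)
  then show ?thesis unfolding Un_open_segment[OF m] .
qed

end

subsection \<open>Connectivity through right endpoints\<close>

context extension begin

lemma on_lineE:
  assumes "i \<in> I" "cr (d i) (w - p i) = 0"
  obtains t where "w = \<gamma> i t"
proof -
  obtain t where "w - p i = of_real t * d i" using cr_eq_0_imp_scale d_nz assms by blast
  then have "w = \<gamma> i (0 + t)" unfolding \<gamma>_plus by (simp add: algebra_simps)
  then show ?thesis using that by simp
qed

lemma interior_L: assumes "i \<in> I" shows "interior (\<gamma> i ` {\<alpha> i..\<beta> i}) = {}"
proof -
  let ?n = "Complex (- Im (d i)) (Re (d i))"
  have "?n \<noteq> 0" using Re_d[OF assms] by (auto simp: complex_eq_iff)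
  then have "interior {x. inner ?n x = cr (d i) (p i)} = {}" by (rule interior_hyperplane)
  moreover have "\<gamma> i ` {\<alpha> i..\<beta> i} \<subseteq> {x. inner ?n x = cr (d i) (p i)}"
  proof clarify
    fix \<tau>
    have "cr (d i) (\<gamma> i \<tau>) = cr (d i) (p i)"
      using cr_on_line[of i \<tau> 0] by (simp add: cr_diff_right)
    then show "inner ?n (\<gamma> i \<tau>) = cr (d i) (p i)"
      by (simp add: cr_def inner_complex_def algebra_simps)
  qed
  ultimately show ?thesis using interior_mono by blast
qed

text \<open>A finite union of closed sets with empty interior has empty interior. It follows that
  each neighbourhood contains free points, so a local colour is unique.\<close>

lemma interior_U: "interior U = {}"
proof -
  have "interior (\<Union>i\<in>J. \<gamma> i ` {\<alpha> i..\<beta> i}) = {}" if "finite J" "J \<subseteq> I" for J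
    using that
  proof (induction rule: finite_induct)
    case (insert i J)
    have "interior (\<gamma> i ` {\<alpha> i..\<beta> i} \<union> (\<Union>i\<in>J. \<gamma> i ` {\<alpha> i..\<beta> i})) = interior (\<gamma> i ` {\<alpha> i..\<beta> i})"
      by (rule interior_closed_Un_empty_interior[OF compact_imp_closed[OF compact_L]])
        (use insert in blast)
    then show ?case using insert.prems interior_L[of i] by simp
  qed simp
  then show ?thesis using fin by (simp add: U_def)
qed

lemma open_not_subset_U: "open S \<Longrightarrow> S \<noteq> {} \<Longrightarrow> \<exists>w\<in>S. w \<notin> U"
  using interior_U interior_maximal[of S U] by (metis subsetI subset_empty)

text \<open>For a colouring \<open>f\<close> of the cells, \<open>good f z\<close> says that the colour does not change at \<open>z\<close>. If the
  colour does not change at the right endpoint of an extended segment, then it does not change along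
  the whole of it, by induction on the abscissa of its end: the extended segments that end on it are
  already known not to change the colour.\<close>

definition good :: "(complex \<Rightarrow> bool) \<Rightarrow> complex \<Rightarrow> bool" where
  "good f z \<longleftrightarrow> (\<exists>c. \<forall>\<^sub>F w in nhds z. w \<notin> U \<longrightarrow> f w = c)"

text \<open>The points with local colour \<open>True\<close> and those with local colour
  \<open>False\<close> form two open sets. They are disjoint because \<open>U\<close> has no
  interior, so a connected set cannot meet both.\<close>

lemma constant_if_all_good:
  assumes "connected S" "\<And>z. z \<in> S \<Longrightarrow> good f z"
  shows "\<exists>c. \<forall>w\<in>S. w \<notin> U \<longrightarrow> f w = c"
proof -
  define G where "G c = {z. \<forall>\<^sub>F w in nhds z. w \<notin> U \<longrightarrow> f w = c}" for c
  have "open (G c)" for c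
  proof (subst open_subopen, intro ballI)
    fix z assume "z \<in> G c"
    then obtain S where "open S" "z \<in> S" "\<forall>w\<in>S. w \<notin> U \<longrightarrow> f w = c" by (auto simp: G_def eventually_nhds)
    then show "\<exists>T. open T \<and> z \<in> T \<and> T \<subseteq> G c" by (auto simp: G_def eventually_nhds)
  qed
  moreover have "G True \<inter> G False = {}"
  proof -
    have False if "z \<in> G True" "z \<in> G False" for z
    proof -
      have "\<forall>\<^sub>F w in nhds z. w \<in> U"
        using that[unfolded G_def mem_Collect_eq] by eventually_elim blast
      then obtain T where "open T" "z \<in> T" "T \<subseteq> U" unfolding eventually_nhds by blast
      then show False using open_not_subset_U by blast
    qed
    then show ?thesis by blast
  qed
  moreover have "S \<subseteq> G True \<union> G False"
  proof
    fix z assume "z \<in> S"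
    then obtain c where "z \<in> G c" using assms(2) unfolding good_def G_def by blast
    then show "z \<in> G True \<union> G False" by (cases c) auto
  qed
  ultimately have "G True \<inter> S = {} \<or> G False \<inter> S = {}"
    using connectedD[OF assms(1), of "G True" "G False"] by blast
  then obtain c where "S \<subseteq> G c" using \<open>S \<subseteq> G True \<union> G False\<close> by blast
  then have "f w = c" if "w \<in> S" "w \<notin> U" for w
  proof -
    have "\<forall>\<^sub>F u in nhds w. u \<notin> U \<longrightarrow> f u = c" using that(1) \<open>S \<subseteq> G c\<close> by (auto simp: G_def)
    then show ?thesis using eventually_nhds_x_imp_x that(2) by blast
  qed
  then show ?thesis by blast
qed

text \<open>The line of arc \<open>i\<close> cuts a small disk into two halves, and the colour is
  constant on each by \<open>constant_if_all_good\<close>. For every point of the line in the disk,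
  goodness therefore means that the same two colours agree.\<close>

lemma good_iff_near:
  assumes i: "i \<in> I" "\<alpha> i < \<tau>" "\<tau> < \<beta> i"
    and near: "\<forall>\<^sub>F w in nhds (\<gamma> i \<tau>). cr (d i) (w - p i) \<noteq> 0 \<longrightarrow> good f w"
  shows "\<exists>b. \<forall>\<^sub>F \<sigma> in nhds \<tau>. good f (\<gamma> i \<sigma>) = b"
proof -
  let ?z = "\<gamma> i \<tau>"
  obtain e0 where e0: "e0 > 0" "\<And>w. w \<in> ball ?z e0 \<Longrightarrow> cr (d i) (w - p i) \<noteq> 0 \<Longrightarrow> good f w"
    using near by (auto simp: eventually_nhds_metric dist_commute)
  \<comment> \<open>The radius is small enough that the line of arc \<open>i\<close> does not leave
    the arc within the disk.\<close>
  define e where "e = min e0 (min (\<tau> - \<alpha> i) (\<beta> i - \<tau>) * norm (d i))"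
  have "min (\<tau> - \<alpha> i) (\<beta> i - \<tau>) * norm (d i) \<le> (\<tau> - \<alpha> i) * norm (d i)"
    "min (\<tau> - \<alpha> i) (\<beta> i - \<tau>) * norm (d i) \<le> (\<beta> i - \<tau>) * norm (d i)"
    by (intro mult_right_mono; simp)+
  moreover have "e > 0" "e \<le> e0" "e \<le> min (\<tau> - \<alpha> i) (\<beta> i - \<tau>) * norm (d i)"
    unfolding e_def using e0(1) i d_nz[OF i(1)] by simp_all
  ultimately have e: "e > 0" "e \<le> e0" "e \<le> (\<tau> - \<alpha> i) * norm (d i)" "e \<le> (\<beta> i - \<tau>) * norm (d i)"
    by linarith+
  have line: "w \<in> U" if w: "w \<in> ball ?z e" "cr (d i) (w - p i) = 0" for w
  proof -
    obtain t where t: "w = \<gamma> i t" using on_lineE[OF i(1) w(2)] .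
    have "\<bar>\<tau> - t\<bar> * norm (d i) < e"
      using w(1) unfolding t by (simp add: dist_norm \<gamma>_minus norm_mult del: of_real_diff)
    then have "\<bar>\<tau> - t\<bar> * norm (d i) < (\<tau> - \<alpha> i) * norm (d i)" "\<bar>\<tau> - t\<bar> * norm (d i) < (\<beta> i - \<tau>) * norm (d i)"
      using e by linarith+
    then have "\<bar>\<tau> - t\<bar> < \<tau> - \<alpha> i" "\<bar>\<tau> - t\<bar> < \<beta> i - \<tau>"
      by (simp_all add: mult_less_cancel_right_disj)
    then show ?thesis unfolding t using i by (intro \<gamma>_in_U) auto
  qed
  define h where "h s = ball ?z e \<inter> {w. s * cr (d i) (w - p i) > 0}" for s
  have h_open: "open (h s)" for s unfolding h_def
    by (intro open_Int open_ball open_Collect_less continuous_intros)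
  have ex_c: "\<exists>c. \<forall>w\<in>h s. w \<notin> U \<longrightarrow> f w = c" for s
  proof -
    have "convex (h s)" unfolding h_def by (intro convex_Int convex_ball convex_half_plane)
    then have "connected (h s)" by (rule convex_connected)
    moreover have "good f w" if "w \<in> h s" for w
    proof (rule e0(2))
      show "w \<in> ball ?z e0" using that e(2) by (auto simp: h_def)
      show "cr (d i) (w - p i) \<noteq> 0" using that by (auto simp: h_def)
    qed
    ultimately show ?thesis by (rule constant_if_all_good)
  qed
  obtain c where c: "\<And>s w. w \<in> h s \<Longrightarrow> w \<notin> U \<Longrightarrow> f w = c s" using ex_c by metis
  have key: "good f z \<longleftrightarrow> c 1 = c (-1)" if z: "z \<in> ball ?z e" "cr (d i) (z - p i) = 0" for z
  proof
    assume eq: "c 1 = c (-1)"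
    have "\<forall>\<^sub>F w in nhds z. w \<in> ball ?z e" using z(1) by (intro eventually_nhds_in_open) auto
    then have "\<forall>\<^sub>F w in nhds z. w \<notin> U \<longrightarrow> f w = c 1"
    proof eventually_elim
      case (elim w)
      show ?case
      proof
        assume "w \<notin> U"
        then have "cr (d i) (w - p i) \<noteq> 0" using line elim by blast
        then have "w \<in> h 1 \<or> w \<in> h (-1)" using elim by (auto simp: h_def)
        then show "f w = c 1" using c \<open>w \<notin> U\<close> eq by metis
      qed
    qed
    then show "good f z" unfolding good_def by blast
  next
    assume "good f z"
    then obtain b S where S: "open S" "z \<in> S" "\<And>w. w \<in> S \<Longrightarrow> w \<notin> U \<Longrightarrow> f w = b"
      unfolding good_def eventually_nhds by blast
    have "c s = b" if s: "s = 1 \<or> s = -1" for s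
    proof -
      have "\<forall>\<^sub>F \<delta> in at_right 0. z + of_real \<delta> * (of_real s * (\<i> * d i)) \<in> S \<inter> ball ?z e"
        by (rule topological_tendstoD[OF tendsto_affine_at_right_0]) (use S z in auto)
      from eventually_at_right_0_imp_ex[OF this] obtain \<delta> where \<delta>: "z + of_real \<delta> * (of_real s * (\<i> * d i)) \<in> S \<inter> ball ?z e" "\<delta> > 0" by blast
      let ?w = "z + of_real \<delta> * (of_real s * (\<i> * d i))"
      have "s * cr (d i) (?w - p i) = s * cr (d i) (z - p i) + \<delta> * (s * s) * cr (d i) (\<i> * d i)"
        by (simp only: cr_diff_right cr_add_right cr_scale_right) (simp add: algebra_simps)
      also have "\<dots> > 0" using z(2) s \<delta>(2) cr_d_ii[OF i(1)] by auto
      finally have "?w \<in> S \<inter> h s" using \<delta>(1) by (auto simp: h_def)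
      then obtain w where "w \<in> S \<inter> h s" "w \<notin> U"
        using open_not_subset_U[of "S \<inter> h s"] S(1) h_open by blast
      then show ?thesis using c S(3) by blast
    qed
    then show "c 1 = c (-1)" by simp
  qed
  have "isCont (\<gamma> i) \<tau>" unfolding \<gamma>_def pt_def by (intro continuous_intros)
  then have "(\<gamma> i \<longlongrightarrow> \<gamma> i \<tau>) (nhds \<tau>)" by (simp add: isCont_def tendsto_at_iff_tendsto_nhds)
  then have "\<forall>\<^sub>F \<sigma> in nhds \<tau>. \<gamma> i \<sigma> \<in> ball ?z e" using e(1) by (intro topological_tendstoD) auto
  then have "\<forall>\<^sub>F \<sigma> in nhds \<tau>. good f (\<gamma> i \<sigma>) = (c 1 = c (-1))"
  proof eventually_elim
    case (elim \<sigma>)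
    then show ?case using key cr_on_line[of i \<sigma> 0] by simp
  qed
  then show ?thesis by blast
qed

text \<open>By \<open>good_iff_near\<close>, goodness is locally constant in the parameter, hence
  constant on the connected set \<open>T\<close>.\<close>

lemma good_propagates:
  assumes i: "i \<in> I" and T: "connected T" "T \<subseteq> {\<alpha> i<..<\<beta> i}" "\<tau>0 \<in> T" "\<tau>1 \<in> T"
    and start: "good f (\<gamma> i \<tau>0)"
    and near: "\<And>\<tau>. \<tau> \<in> T \<Longrightarrow> \<forall>\<^sub>F w in nhds (\<gamma> i \<tau>). cr (d i) (w - p i) \<noteq> 0 \<longrightarrow> good f w"
  shows "good f (\<gamma> i \<tau>1)"
proof -
  have "good f (\<gamma> i \<tau>0) = good f (\<gamma> i \<tau>1)"
  proof (rule connected_local_const[where f = "\<lambda>\<tau>. good f (\<gamma> i \<tau>)", OF T(1,3,4)], rule ballI)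
    fix \<tau> assume \<tau>: "\<tau> \<in> T"
    then have "\<alpha> i < \<tau>" "\<tau> < \<beta> i" using T(2) by auto
    from good_iff_near[OF i this near[OF \<tau>]]
    obtain b where b: "\<forall>\<^sub>F \<sigma> in nhds \<tau>. good f (\<gamma> i \<sigma>) = b" ..
    have at: "good f (\<gamma> i \<tau>) = b" using eventually_nhds_x_imp_x[OF b] .
    have "\<forall>\<^sub>F \<sigma> in nhds \<tau>. good f (\<gamma> i \<tau>) = good f (\<gamma> i \<sigma>)"
      unfolding at by (rule eventually_mono[OF b]) simp
    then show "\<forall>\<^sub>F \<sigma> in at \<tau> within T. good f (\<gamma> i \<tau>) = good f (\<gamma> i \<sigma>)"
      unfolding eventually_at_filter by (rule eventually_mono) simp
  qed
  then show ?thesis using start by simp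
qed

lemma eventually_near_end:
  assumes m: "m \<in> I" and e: "e > 0"
  shows "\<forall>\<^sub>F w in nhds (\<gamma> m \<sigma>). \<forall>\<tau>. w = \<gamma> m \<tau> \<longrightarrow> \<bar>\<tau> - \<sigma>\<bar> < e"
proof -
  have "e * norm (d m) > 0" using e d_nz[OF m] by simp
  then have "\<forall>\<^sub>F w in nhds (\<gamma> m \<sigma>). dist w (\<gamma> m \<sigma>) < e * norm (d m)"
    unfolding eventually_nhds_metric by blast
  then show ?thesis
  proof eventually_elim
    case (elim w)
    show ?case
    proof (intro allI impI)
      fix \<tau> assume "w = \<gamma> m \<tau>"
      then have "\<bar>\<tau> - \<sigma>\<bar> * norm (d m) < e * norm (d m)"
        using elim by (simp add: dist_norm \<gamma>_minus norm_mult del: of_real_diff)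
      then show "\<bar>\<tau> - \<sigma>\<bar> < e" by (simp add: mult_less_cancel_right_disj)
    qed
  qed
qed

end

text \<open>A colouring as in \<open>graph_connected\<close>, carried over from the cells to the
  free points, with the right endpoints as edges. The aim is \<open>f_constant\<close>.\<close>

locale crossing = extension +
  fixes f :: "complex \<Rightarrow> bool"
  assumes const: "\<And>z w. z \<in> D - U \<Longrightarrow> w \<in> cell z \<Longrightarrow> f w = f z"
    and cross: "\<And>i w w'. i \<in> I \<Longrightarrow> w \<in> side i (q i) 1 \<Longrightarrow> w' \<in> side i (q i) (-1) \<Longrightarrow> f w = f w'"
begin

lemma good_free: assumes "z \<in> D - U" shows "good f z"
proof -
  have "\<forall>\<^sub>F w in nhds z. w \<in> cell z"
    using open_cell[OF assms] mem_cell[OF assms] by (rule eventually_nhds_in_open)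
  then have "\<forall>\<^sub>F w in nhds z. w \<notin> U \<longrightarrow> f w = f z"
    by eventually_elim (use const[OF assms] in blast)
  then show ?thesis unfolding good_def by blast
qed

text \<open>Near \<open>q i\<close> every free point lies in one of the two cells at this endpoint,
  and these have the same colour.\<close>

lemma good_q: assumes i: "i \<in> I" shows "good f (q i)"
proof -
  have c: "\<exists>c. \<forall>w\<in>side i (q i) s. f w = c" if "s \<in> {1, -1}" for s
  proof -
    have "side i (q i) s \<in> cells" using side_cell(1)[OF i _ that] by blast
    then obtain z where "z \<in> D - U" "side i (q i) s = cell z" by (auto simp: cells_def)
    then show ?thesis using const by metis
  qed
  obtain c1 c2 where c: "\<And>w. w \<in> side i (q i) 1 \<Longrightarrow> f w = c1" "\<And>w. w \<in> side i (q i) (-1) \<Longrightarrow> f w = c2"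
    using c[of 1] c[of "-1"] by auto
  have "side i (q i) 1 \<noteq> {}" "side i (q i) (-1) \<noteq> {}"
    using side_cell(1)[OF i, of "q i"] cells_props(4) by auto
  then have "c1 = c2" using cross[OF i] c by blast
  have "\<forall>\<^sub>F w in nhds (q i). 1 * cr (d i) (w - q i) > 0 \<longrightarrow> w \<in> side i (q i) 1"
    "\<forall>\<^sub>F w in nhds (q i). -1 * cr (d i) (w - q i) > 0 \<longrightarrow> w \<in> side i (q i) (-1)"
    using side_cell(2)[OF i, of "q i" 1] side_cell(2)[OF i, of "q i" "-1"] by auto
  moreover have "\<forall>\<^sub>F w in nhds (q i). cr (d i) (w - q i) = 0 \<longrightarrow> w \<in> U"
  proof -
    have "\<forall>\<^sub>F w in nhds (q i). \<forall>\<tau>. w = \<gamma> i \<tau> \<longrightarrow> \<bar>\<tau> - 1\<bar> < min (1 - \<alpha> i) (\<beta> i - 1)"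
      using eventually_near_end[OF i, of "min (1 - \<alpha> i) (\<beta> i - 1)" 1] \<alpha>_less[OF i] \<beta>_greater[OF i] by simp
    then show ?thesis
    proof eventually_elim
      case (elim w)
      show ?case
      proof
        assume "cr (d i) (w - q i) = 0"
        then have "cr (d i) (w - p i) = 0" using cr_on_line[of i 1 0] by (simp add: cr_diff_right)
        then obtain t where t: "w = \<gamma> i t" using on_lineE[OF i] by blast
        then show "w \<in> U" using elim unfolding t by (intro \<gamma>_in_U i) force+
      qed
    qed
  qed
  ultimately have "\<forall>\<^sub>F w in nhds (q i). w \<notin> U \<longrightarrow> f w = c1"
  proof eventually_elim
    case (elim w)
    show ?case
    proof
      assume "w \<notin> U"
      then have "cr (d i) (w - q i) \<noteq> 0" using elim by blast
      then have "w \<in> side i (q i) 1 \<or> w \<in> side i (q i) (-1)" using elim by (cases "cr (d i) (w - q i) > 0") auto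
      then show "f w = c1" using c \<open>c1 = c2\<close> by blast
    qed
  qed
  then show ?thesis unfolding good_def by blast
qed

text \<open>Arcs do not cross, so the other arcs that come near an inner point of arc
  \<open>i\<close> are those that end at this point. Goodness of their last stretches is all that is
  required.\<close>

lemma near_good:
  assumes i: "i \<in> I" "\<alpha> i < \<tau>" "\<tau> < \<beta> i"
    and r: "\<And>m. m \<in> I \<Longrightarrow> m \<noteq> i \<Longrightarrow> \<gamma> i \<tau> = \<gamma> m (\<beta> m) \<Longrightarrow> \<forall>\<sigma>. 1 \<le> \<sigma> \<longrightarrow> \<sigma> < \<beta> m \<longrightarrow> good f (\<gamma> m \<sigma>)"
    and l: "\<And>m. m \<in> I \<Longrightarrow> m \<noteq> i \<Longrightarrow> \<gamma> i \<tau> = \<gamma> m (\<alpha> m) \<Longrightarrow> \<forall>\<sigma>. \<alpha> m < \<sigma> \<longrightarrow> \<sigma> \<le> 1 \<longrightarrow> good f (\<gamma> m \<sigma>)"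
  shows "\<forall>\<^sub>F w in nhds (\<gamma> i \<tau>). cr (d i) (w - p i) \<noteq> 0 \<longrightarrow> good f w"
proof -
  let ?z = "\<gamma> i \<tau>"
  have "\<forall>\<^sub>F w in nhds ?z. \<forall>m\<in>I - {i}. w \<in> \<gamma> m ` {\<alpha> m..\<beta> m} \<longrightarrow> w = ?z \<or> good f w"
  proof (rule eventually_ball_finite)
    show "\<forall>m\<in>I - {i}. \<forall>\<^sub>F w in nhds ?z. w \<in> \<gamma> m ` {\<alpha> m..\<beta> m} \<longrightarrow> w = ?z \<or> good f w"
    proof
      fix m assume m: "m \<in> I - {i}"
      then have mI: "m \<in> I" "m \<noteq> i" by auto
      show "\<forall>\<^sub>F w in nhds ?z. w \<in> \<gamma> m ` {\<alpha> m..\<beta> m} \<longrightarrow> w = ?z \<or> good f w"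
      proof (cases "?z \<in> \<gamma> m ` {\<alpha> m..\<beta> m}")
        case False
        then have "\<forall>\<^sub>F w in nhds ?z. w \<in> - \<gamma> m ` {\<alpha> m..\<beta> m}"
          using compact_L compact_imp_closed by (intro eventually_nhds_in_open) auto
        then show ?thesis by eventually_elim simp
      next
        case True
        then obtain \<sigma> where \<sigma>: "\<alpha> m \<le> \<sigma>" "\<sigma> \<le> \<beta> m" "?z = \<gamma> m \<sigma>" by auto
        have "\<sigma> = \<alpha> m \<or> \<sigma> = \<beta> m" using disj[OF mI(1) i(1) mI(2) _ _ i(2,3), of \<sigma>] \<sigma> by force
        then show ?thesis
        proof
          assume eq: "\<sigma> = \<beta> m"
          have "\<forall>\<^sub>F w in nhds ?z. \<forall>\<tau>. w = \<gamma> m \<tau> \<longrightarrow> \<bar>\<tau> - \<sigma>\<bar> < \<beta> m - 1"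
            unfolding \<sigma>(3) using \<beta>_greater[OF mI(1)] by (intro eventually_near_end mI) simp
          then show ?thesis
          proof eventually_elim
            case (elim w)
            show ?case
            proof
              assume "w \<in> \<gamma> m ` {\<alpha> m..\<beta> m}"
              then obtain t where t: "w = \<gamma> m t" "t \<le> \<beta> m" by auto
              then have "\<bar>t - \<sigma>\<bar> < \<beta> m - 1" using elim by blast
              then have "1 \<le> t" using eq by linarith
              then show "w = ?z \<or> good f w"
                using r[OF mI] \<sigma>(3) eq t by (cases "t = \<beta> m") auto
            qed
          qed
        next
          assume eq: "\<sigma> = \<alpha> m"
          have "\<forall>\<^sub>F w in nhds ?z. \<forall>\<tau>. w = \<gamma> m \<tau> \<longrightarrow> \<bar>\<tau> - \<sigma>\<bar> < 1 - \<alpha> m"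
            unfolding \<sigma>(3) using \<alpha>_less[OF mI(1)] by (intro eventually_near_end mI) simp
          then show ?thesis
          proof eventually_elim
            case (elim w)
            show ?case
            proof
              assume "w \<in> \<gamma> m ` {\<alpha> m..\<beta> m}"
              then obtain t where t: "w = \<gamma> m t" "\<alpha> m \<le> t" by auto
              then have "\<bar>t - \<sigma>\<bar> < 1 - \<alpha> m" using elim by blast
              then have "t \<le> 1" using eq by linarith
              then show "w = ?z \<or> good f w"
                using l[OF mI] \<sigma>(3) eq t by (cases "t = \<alpha> m") auto
            qed
          qed
        qed
      qed
    qed
  qed (use fin in simp)
  moreover have "\<forall>\<^sub>F w in nhds ?z. w \<in> D" using D(1) inD[OF i] by (rule eventually_nhds_in_open)
  ultimately show ?thesis
  proof eventually_elim
    case (elim w)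
    show ?case
    proof
      assume nz: "cr (d i) (w - p i) \<noteq> 0"
      show "good f w"
      proof (cases "w \<in> U")
        case True
        then obtain m where m: "m \<in> I" "w \<in> \<gamma> m ` {\<alpha> m..\<beta> m}" by (auto simp: U_def)
        have "m \<noteq> i" using m nz cr_on_line[of i _ 0] by auto
        moreover have "w \<noteq> ?z" using nz cr_on_line[of i \<tau> 0] by auto
        ultimately show ?thesis using m elim by blast
      next
        case False
        then show ?thesis using good_free elim by blast
      qed
    qed
  qed
qed

lemma Re_\<gamma>_less: "i \<in> I \<Longrightarrow> \<sigma> < \<tau> \<Longrightarrow> Re (\<gamma> i \<sigma>) < Re (\<gamma> i \<tau>)"
proof -
  assume i: "i \<in> I" and "\<sigma> < \<tau>"
  have "Re (\<gamma> i \<tau> - \<gamma> i \<sigma>) = (\<tau> - \<sigma>) * Re (d i)" unfolding \<gamma>_minus by simp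
  also have "\<dots> > 0" using Re_d[OF i] \<open>\<sigma> < \<tau>\<close> by simp
  finally show ?thesis by simp
qed

text \<open>Start at the right endpoint and walk along the right extension. An arc whose right end
  is met on the way has a right end of smaller abscissa than that of \<open>i\<close>, so the
  induction covers it; no left end is met at all.\<close>

lemma good_right: "i \<in> I \<Longrightarrow> 1 \<le> \<tau> \<Longrightarrow> \<tau> < \<beta> i \<Longrightarrow> good f (\<gamma> i \<tau>)"
proof (induction "card {m \<in> I. Re (\<gamma> m (\<beta> m)) < Re (\<gamma> i (\<beta> i))}" arbitrary: i \<tau> rule: less_induct)
  case less
  show ?case
  proof (rule good_propagates[of i "{1..\<tau>}" 1 \<tau>])
    show "{1..\<tau>} \<subseteq> {\<alpha> i<..<\<beta> i}" using less.prems \<alpha>_less[of i] by auto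
    show "good f (\<gamma> i 1)" using good_q less.prems by simp
    fix \<tau>' assume \<tau>': "\<tau>' \<in> {1..\<tau>}"
    then have i: "\<alpha> i < \<tau>'" "\<tau>' < \<beta> i" using less.prems \<alpha>_less[of i] by auto
    show "\<forall>\<^sub>F w in nhds (\<gamma> i \<tau>'). cr (d i) (w - p i) \<noteq> 0 \<longrightarrow> good f w"
    proof (rule near_good[OF less.prems(1) i])
      fix m assume m: "m \<in> I" "m \<noteq> i" "\<gamma> i \<tau>' = \<gamma> m (\<beta> m)"
      have "Re (\<gamma> m (\<beta> m)) < Re (\<gamma> i (\<beta> i))" using Re_\<gamma>_less[OF less.prems(1) i(2)] m(3) by simp
      then have "card {k \<in> I. Re (\<gamma> k (\<beta> k)) < Re (\<gamma> m (\<beta> m))} < card {k \<in> I. Re (\<gamma> k (\<beta> k)) < Re (\<gamma> i (\<beta> i))}"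
        using fin m(1) by (intro psubset_card_mono) auto
      then show "\<forall>\<sigma>. 1 \<le> \<sigma> \<longrightarrow> \<sigma> < \<beta> m \<longrightarrow> good f (\<gamma> m \<sigma>)" using less.hyps m(1) by blast
    next
      \<comment> \<open>This case is contradictory: a left extension stops at a parameter below 1 of
        some arc, which would have to be arc \<open>i\<close> at the parameter
        \<open>\<tau>'\<close>, and this is at least 1.\<close>
      fix m assume m: "m \<in> I" "m \<noteq> i" "\<gamma> i \<tau>' = \<gamma> m (\<alpha> m)"
      then obtain k \<sigma> where k: "k \<in> I" "\<alpha> k < \<sigma>" "\<sigma> < 1" "\<gamma> i \<tau>' = \<gamma> k \<sigma>"
        using left_end[OF m(1)] inD[OF less.prems(1) i] by auto
      have "k = i" using disj[OF k(1) less.prems(1) _ k(2) _ i] k \<beta>_greater[of k] by force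
      then have "\<sigma> = \<tau>'" using k(4) \<gamma>_eq_iff[OF less.prems(1)] by auto
      then show "\<forall>\<sigma>. \<alpha> m < \<sigma> \<longrightarrow> \<sigma> \<le> 1 \<longrightarrow> good f (\<gamma> m \<sigma>)" using k(3) \<tau>' by auto
    qed
  qed (use less.prems in auto)
qed

text \<open>The mirror image of \<open>good_right\<close>, from the right endpoint to the left:
  right ends met on the way are settled by \<open>good_right\<close>, left ends by induction on
  their abscissa.\<close>

lemma good_left: "i \<in> I \<Longrightarrow> \<alpha> i < \<tau> \<Longrightarrow> \<tau> \<le> 1 \<Longrightarrow> good f (\<gamma> i \<tau>)"
proof (induction "card {m \<in> I. Re (\<gamma> m (\<alpha> m)) > Re (\<gamma> i (\<alpha> i))}" arbitrary: i \<tau> rule: less_induct)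
  case less
  show ?case
  proof (rule good_propagates[of i "{\<tau>..1}" 1 \<tau>])
    show "{\<tau>..1} \<subseteq> {\<alpha> i<..<\<beta> i}" using less.prems \<beta>_greater[of i] by auto
    show "good f (\<gamma> i 1)" using good_q less.prems by simp
    fix \<tau>' assume \<tau>': "\<tau>' \<in> {\<tau>..1}"
    then have i: "\<alpha> i < \<tau>'" "\<tau>' < \<beta> i" using less.prems \<beta>_greater[of i] by auto
    show "\<forall>\<^sub>F w in nhds (\<gamma> i \<tau>'). cr (d i) (w - p i) \<noteq> 0 \<longrightarrow> good f w"
    proof (rule near_good[OF less.prems(1) i])
      fix m assume m: "m \<in> I" "m \<noteq> i" "\<gamma> i \<tau>' = \<gamma> m (\<beta> m)"
      then show "\<forall>\<sigma>. 1 \<le> \<sigma> \<longrightarrow> \<sigma> < \<beta> m \<longrightarrow> good f (\<gamma> m \<sigma>)" using good_right by blast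
    next
      fix m assume m: "m \<in> I" "m \<noteq> i" "\<gamma> i \<tau>' = \<gamma> m (\<alpha> m)"
      have "Re (\<gamma> m (\<alpha> m)) > Re (\<gamma> i (\<alpha> i))" using Re_\<gamma>_less[OF less.prems(1) i(1)] m(3) by simp
      then have "card {k \<in> I. Re (\<gamma> k (\<alpha> k)) > Re (\<gamma> m (\<alpha> m))} < card {k \<in> I. Re (\<gamma> k (\<alpha> k)) > Re (\<gamma> i (\<alpha> i))}"
        using fin m(1) by (intro psubset_card_mono) auto
      then show "\<forall>\<sigma>. \<alpha> m < \<sigma> \<longrightarrow> \<sigma> \<le> 1 \<longrightarrow> good f (\<gamma> m \<sigma>)" using less.hyps m(1) by blast
    qed
  qed (use less.prems in auto)
qed

lemma f_constant:
  assumes "z \<in> D - U" "w \<in> D - U" shows "f z = f w"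
proof -
  have "good f z" if z: "z \<in> D" for z
  proof (cases "z \<in> U")
    case True
    then obtain i \<tau> where i: "i \<in> I" "\<alpha> i < \<tau>" "\<tau> < \<beta> i" "z = \<gamma> i \<tau>" using U_in_D z by metis
    then show ?thesis using good_left[of i \<tau>] good_right[of i \<tau>] by (cases "\<tau> \<le> 1") auto
  qed (use z good_free in blast)
  moreover have "connected D" using D(2) by (rule convex_connected)
  ultimately have "\<exists>c. \<forall>w\<in>D. w \<notin> U \<longrightarrow> f w = c" using constant_if_all_good[of D f] by simp
  then show ?thesis using assms by auto
qed

end

subsection \<open>Sparsity of the left endpoint graph\<close>

definition below :: "complex set \<Rightarrow> complex set \<Rightarrow> bool" where
  "below A C \<longleftrightarrow> A \<noteq> C \<and> (\<exists>a\<in>A. \<exists>c\<in>C. Re a = Re c \<and> Im a < Im c)"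

text \<open>If the order were reversed on a second vertical line, the weight \<open>u\<close> that
  makes the two opposite vertical gaps cancel would produce, by convexity, a point common to both
  sets.\<close>

lemma below_asym:
  assumes "convex A" "convex C" "A \<inter> C = {}" "below A C"
  shows "\<not> below C A"
proof
  assume "below C A"
  then obtain a' c' where a': "a' \<in> A" "c' \<in> C" "Re a' = Re c'" "Im c' < Im a'"
    unfolding below_def by metis
  obtain a c where a: "a \<in> A" "c \<in> C" "Re a = Re c" "Im a < Im c"
    using assms(4) unfolding below_def by metis
  define u where "u = (Im c - Im a) / ((Im c - Im a) + (Im a' - Im c'))"
  have u: "0 \<le> u" "u \<le> 1" using a a' by (auto simp: u_def field_simps)
  have "(1 - u) * (Im c - Im a) = u * (Im a' - Im c')"
    using a a' by (simp add: u_def field_simps)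
  then have "(1 - u) *\<^sub>R a + u *\<^sub>R a' = (1 - u) *\<^sub>R c + u *\<^sub>R c'"
    using a(3) a'(3) by (simp add: complex_eq_iff algebra_simps)
  moreover have "(1 - u) *\<^sub>R a + u *\<^sub>R a' \<in> A" "(1 - u) *\<^sub>R c + u *\<^sub>R c' \<in> C"
    using convexD[OF assms(1) a(1) a'(1), of "1 - u" u] convexD[OF assms(2) a(2) a'(2), of "1 - u" u] u by auto
  ultimately show False using assms(3) by (metis IntI empty_iff)
qed

lemma Re_image_open_convex:
  fixes C :: "complex set"
  assumes "open C" "convex C" "bounded C" "C \<noteq> {}"
  shows "Re ` C = {Inf (Re ` C)<..<Sup (Re ` C)}"
proof -
  have "bounded (Re ` C)" using assms(3) by (rule bounded_linear_image) (rule bounded_linear_Re)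
  note bdd = bounded_imp_bdd_below[OF this] bounded_imp_bdd_above[OF this]
  have ne: "Re ` C \<noteq> {}" using assms(4) by simp
  have conn: "connected (Re ` C)"
    using assms(2) by (intro connected_continuous_image convex_connected continuous_intros)
  show ?thesis
  proof (intro equalityI subsetI)
    fix x assume "x \<in> Re ` C"
    then obtain c where c: "c \<in> C" "x = Re c" by auto
    then obtain e where e: "e > 0" "ball c e \<subseteq> C" using assms(1) openE by blast
    have "c - of_real (e / 2) \<in> C" "c + of_real (e / 2) \<in> C"
      using e by (auto simp: dist_norm simp del: of_real_divide intro!: subsetD[OF e(2)])
    then have "Re (c - of_real (e / 2)) \<in> Re ` C" "Re (c + of_real (e / 2)) \<in> Re ` C" by blast+
    then have m: "x - e / 2 \<in> Re ` C" "x + e / 2 \<in> Re ` C" using c(2) by simp_all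
    note cInf_lower[OF m(1) bdd(1)] cSup_upper[OF m(2) bdd(2)]
    then show "x \<in> {Inf (Re ` C)<..<Sup (Re ` C)}" using e(1) by auto
  next
    fix x assume "x \<in> {Inf (Re ` C)<..<Sup (Re ` C)}"
    then have "Inf (Re ` C) < x" "x < Sup (Re ` C)" by auto
    then obtain a b where "a \<in> Re ` C" "a < x" "b \<in> Re ` C" "x < b"
      using cInf_lessD[OF ne, of x] less_cSupD[OF ne, of x] by auto
    then show "x \<in> Re ` C" using connected_contains_Icc[OF conn, of a b] by auto
  qed
qed

context extension begin

section \<open>The dual graph of the left endpoints\<close>

abbreviation up :: "'i \<Rightarrow> complex set" where "up i \<equiv> side i (p i) 1"

abbreviation dn :: "'i \<Rightarrow> complex set" where "dn i \<equiv> side i (p i) (-1)"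

lemma up_dn_cells: "i \<in> I \<Longrightarrow> up i \<in> cells" "i \<in> I \<Longrightarrow> dn i \<in> cells"
  using side_cell(1) by auto

lemma up_neq_dn: assumes "i \<in> I" shows "up i \<noteq> dn i"
proof
  assume eq: "up i = dn i"
  obtain w where "w \<in> up i" using cells_props(4)[OF up_dn_cells(1)[OF assms]] by blast
  then have "1 * cr (d i) (w - p i) > 0" "-1 * cr (d i) (w - p i) > 0"
    using side_cr_pos[OF assms, of "p i" 1 w] side_cr_pos[OF assms, of "p i" "-1" w] eq by simp_all
  then show False by simp
qed

text \<open>The closures of the two cells at \<open>p i\<close> lie on opposite sides of the line of
  \<open>i\<close>. If \<open>p j\<close> had the same two cells, it would belong to both closures,
  hence to this line. This is the simplicity of the left endpoint graph.\<close>

lemma inj_up_dn: "inj_on (\<lambda>i. (dn i, up i)) I"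
proof (rule inj_onI, rule ccontr)
  fix i j assume ij: "i \<in> I" "j \<in> I" "(dn i, up i) = (dn j, up j)" "i \<noteq> j"
  have "p j \<in> closure (up i)" "p j \<in> closure (dn i)"
    using vertex_in_closure_side[OF ij(2), of "p j"] ij(3) by auto
  then have "1 * cr (d i) (p j - p i) \<ge> 0" "-1 * cr (d i) (p j - p i) \<ge> 0"
    using side_closure_cr[OF ij(1), of "p i" 1 "p j"] side_closure_cr[OF ij(1), of "p i" "-1" "p j"] by simp_all
  then have "cr (d i) (p j - p i) = 0" by simp
  then obtain t where "p j = \<gamma> i t" using on_lineE[OF ij(1)] by blast
  then show False using gp(1)[OF ij(2,1)] ij(4) by blast
qed

lemma graph_connected_right: "graph_connected I (\<lambda>i. side i (q i) 1) (\<lambda>i. side i (q i) (-1)) cells"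
  unfolding graph_connected_def
proof (intro allI impI)
  fix F :: "complex set \<Rightarrow> bool"
  assume F: "\<forall>i\<in>I. F (side i (q i) 1) = F (side i (q i) (-1))"
  have cell_side: "cell w = side i (q i) s" if "i \<in> I" "s \<in> {1, -1}" "w \<in> side i (q i) s" for i s w
  proof -
    have "side i (q i) s \<in> cells" using side_cell(1) that by blast
    then obtain z where "z \<in> D - U" "side i (q i) s = cell z" by (auto simp: cells_def)
    then show ?thesis using cell_eq that(3) by metis
  qed
  interpret crossing I p q D \<alpha> \<beta> \<gamma> d "\<lambda>z. F (cell z)"
  proof unfold_locales
    show "F (cell w) = F (cell z)" if "z \<in> D - U" "w \<in> cell z" for z w
      using cell_eq[OF that] by simp
    show "F (cell w) = F (cell w')" if "i \<in> I" "w \<in> side i (q i) 1" "w' \<in> side i (q i) (-1)" for i w w'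
      using cell_side[OF that(1) _ that(2)] cell_side[OF that(1) _ that(3)] F that(1) by simp
  qed
  show "\<forall>u\<in>cells. \<forall>v\<in>cells. F u = F v"
  proof (intro ballI)
    fix u v assume "u \<in> cells" "v \<in> cells"
    then obtain z w where "z \<in> D - U" "u = cell z" "w \<in> D - U" "v = cell w" unfolding cells_def by blast
    then show "F u = F v" using f_constant[of z w] by simp
  qed
qed

lemma finite_cells: "finite cells" and card_cells_le: "card cells \<le> Suc (card I)"
  using card_vertices_le_Suc_card_edges[OF fin graph_connected_right] by auto

text \<open>A vertical line slightly to the right of \<open>p i\<close> crosses the segment with
  \<open>up i\<close> directly above and \<open>dn i\<close> directly below. There are infinitely
  many such lines, so finitely many abscissae \<open>X\<close> can be avoided; in the sweep these
  are the right ends of the bars.\<close>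

lemma side_column:
  assumes i: "i \<in> I" and X: "finite X"
  shows "\<exists>t. \<gamma> i t \<in> U \<and> Re (\<gamma> i t) \<notin> X \<and>
    (\<forall>\<^sub>F y in at_right 0. \<gamma> i t + \<i> * of_real y \<in> up i \<and> \<gamma> i t - \<i> * of_real y \<in> dn i)"
proof -
  have "\<forall>\<^sub>F w in nhds (p i). (1 * cr (d i) (w - p i) > 0 \<longrightarrow> w \<in> up i) \<and> (-1 * cr (d i) (w - p i) > 0 \<longrightarrow> w \<in> dn i)"
    using side_cell(2)[OF i, of "p i" 1] side_cell(2)[OF i, of "p i" "-1"] by (intro eventually_conj) auto
  then obtain e where e: "e > 0" "\<And>w. dist w (p i) < e \<Longrightarrow> cr (d i) (w - p i) > 0 \<Longrightarrow> w \<in> up i"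
    "\<And>w. dist w (p i) < e \<Longrightarrow> cr (d i) (w - p i) < 0 \<Longrightarrow> w \<in> dn i"
    unfolding eventually_nhds_metric by auto
  \<comment> \<open>The bound 1 keeps the point on the segment itself. The other bound uses up half
    of the radius \<open>e\<close> and leaves the other half for the vertical displacement.\<close>
  define \<eta> where "\<eta> = min 1 (e / 2 / norm (d i))"
  have "\<eta> > 0" using e(1) d_nz[OF i] by (simp add: \<eta>_def)
  have "infinite ({0<..<\<eta>} - (\<lambda>x. (x - Re (p i)) / Re (d i)) ` X)"
    using X \<open>\<eta> > 0\<close> by (intro Diff_infinite_finite finite_imageI) (auto simp: infinite_Ioo)
  then obtain t where t: "t \<in> {0<..<\<eta>} - (\<lambda>x. (x - Re (p i)) / Re (d i)) ` X"
    by (metis finite.emptyI ex_in_conv)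
  have \<gamma>t: "\<gamma> i t - p i = of_real t * d i" using \<gamma>_minus[of i t 0] by simp
  have tpos: "0 < t" "t < 1" "t < e / 2 / norm (d i)" using t by (auto simp: \<eta>_def)
  show ?thesis
  proof (intro exI[of _ t] conjI)
    show "\<gamma> i t \<in> U" using tpos \<alpha>_less[OF i] \<beta>_greater[OF i] by (intro \<gamma>_in_U i) auto
    show "Re (\<gamma> i t) \<notin> X"
    proof
      assume "Re (\<gamma> i t) \<in> X"
      moreover have "Re (\<gamma> i t) - Re (p i) = t * Re (d i)" using arg_cong[OF \<gamma>t, of Re] by simp
      then have "t = (Re (\<gamma> i t) - Re (p i)) / Re (d i)" using Re_d[OF i] by simp
      ultimately show False using t by blast
    qed
    have small: "dist (\<gamma> i t) (p i) < e / 2"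
      using tpos d_nz[OF i] by (simp add: dist_norm \<gamma>t norm_mult pos_less_divide_eq)
    have "\<forall>\<^sub>F y in at_right (0::real). y \<in> {0<..<e / 2}" using e(1) by (intro eventually_at_right_real) simp
    then show "\<forall>\<^sub>F y in at_right 0. \<gamma> i t + \<i> * of_real y \<in> up i \<and> \<gamma> i t - \<i> * of_real y \<in> dn i"
    proof eventually_elim
      case (elim y)
      have "dist (\<gamma> i t + \<i> * of_real y) (p i) < e" "dist (\<gamma> i t - \<i> * of_real y) (p i) < e"
        using small elim norm_triangle_ineq[of "\<gamma> i t - p i" "\<i> * of_real y"]
          norm_triangle_ineq4[of "\<gamma> i t - p i" "\<i> * of_real y"]
        by (auto simp: dist_norm algebra_simps norm_mult)
      moreover have "cr (d i) (\<gamma> i t - p i) = 0" using cr_on_line[of i t 0] by simp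
      then have "cr (d i) (\<gamma> i t + \<i> * of_real y - p i) = y * Re (d i)"
        "cr (d i) (\<gamma> i t - \<i> * of_real y - p i) = - (y * Re (d i))"
        by (simp_all add: cr_def algebra_simps)
      moreover have "y * Re (d i) > 0" using elim Re_d[OF i] by simp
      ultimately show ?case using e(2,3) by auto
    qed
  qed
qed

text \<open>Disjoint open convex cells are bars under their projections, ordered vertically. On the
  column of \<open>side_column\<close> the cells \<open>dn i\<close> and \<open>up i\<close> are
  consecutive, since they come arbitrarily close to the same point of the segment from below and
  from above. By \<open>inj_up_dn\<close> different endpoints yield different pairs.\<close>

lemma sparse_left:
  assumes K: "K \<subseteq> cells" "2 \<le> card K"
  shows "card {i \<in> I. dn i \<in> K \<and> up i \<in> K} + 5 \<le> 3 * card K"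
proof -
  define l r where "l C = Inf (Re ` C)" and "r C = Sup (Re ` C)" for C :: "complex set"
  have finK: "finite K" using K finite_cells finite_subset by blast
  have props: "open C" "convex C" "bounded C" "C \<noteq> {}" "C \<subseteq> D - U" if "C \<in> K" for C
    using cells_props[of C] K that D(3) by (auto intro: bounded_subset)
  have proj: "l C < x \<and> x < r C \<longleftrightarrow> x \<in> Re ` C" if "C \<in> K" for C x
    using Re_image_open_convex[OF props(1-4)[OF that]] unfolding l_def r_def by (metis greaterThanLessThan_iff)
  have disjK: "A \<inter> C = {}" if "A \<in> K" "C \<in> K" "A \<noteq> C" for A C using cells_disjoint K that by blast
  have asymK: "\<not> below C A" if "A \<in> K" "C \<in> K" "below A C" for A C
  proof -
    have "A \<noteq> C" using that(3) by (simp add: below_def)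
    then show ?thesis using below_asym[OF props(2)[OF that(1)] props(2)[OF that(2)]] disjK that by blast
  qed
  have comp: "below A C" if "A \<in> K" "C \<in> K" "A \<noteq> C" "a \<in> A" "c \<in> C" "Re a = Re c" "Im a < Im c" for A C a c
    using that by (auto simp: below_def)
  have Im_neq: "Im a \<noteq> Im c" if "A \<in> K" "C \<in> K" "A \<noteq> C" "a \<in> A" "c \<in> C" "Re a = Re c" for A C a c
    using disjK that by (metis IntI complex_eqI empty_iff)
  have order: "Im a < Im c" if "A \<in> K" "C \<in> K" "below A C" "a \<in> A" "c \<in> C" "Re a = Re c" for A C a c
  proof (rule ccontr)
    assume "\<not> Im a < Im c"
    moreover have "A \<noteq> C" using that(3) by (simp add: below_def)
    ultimately have "Im c < Im a" using Im_neq[OF that(1,2) _ that(4,5,6)] by linarith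
    then have "below C A" using comp[of C A c a] that \<open>A \<noteq> C\<close> by auto
    then show False using asymK that by blast
  qed
  have at: "\<exists>a. a \<in> A \<and> Re a = x" if "A \<in> K" "l A < x" "x < r A" for A x
    using proj[OF that(1), of x] that(2,3) by auto
  interpret bars K l r below
  proof (unfold_locales, goal_cases)
    case 1
    show ?case by (rule finK)
  next
    case (2 A C x)
    show ?case by (rule asymK[OF 2(1,2,7)])
  next
    case (3 A C x)
    obtain a c where "a \<in> A" "Re a = x" "c \<in> C" "Re c = x"
      using at[OF 3(1,3,4)] at[OF 3(2,5,6)] by auto
    then show ?case
      using comp[of A C a c] comp[of C A c a] Im_neq[of A C a c] 3(1,2,7) by (cases "Im a < Im c") auto
  next
    case (4 A C E x)
    obtain a c e where x: "a \<in> A" "Re a = x" "c \<in> C" "Re c = x" "e \<in> E" "Re e = x"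
      using at[OF 4(1,4,5)] at[OF 4(2,6,7)] at[OF 4(3,8,9)] by auto
    have "Im a < Im c" "Im c < Im e"
      using order[OF 4(1,2,10) x(1,3)] order[OF 4(2,3,11) x(3,5)] x by simp_all
    moreover have "A \<noteq> E" using asymK[OF 4(1,2,10)] 4(11) by auto
    ultimately show ?case using comp[OF 4(1,3) _ x(1,5)] x by simp
  qed
  let ?J = "{i \<in> I. dn i \<in> K \<and> up i \<in> K}"
  let ?P = "(\<lambda>i. (dn i, up i)) ` ?J"
  have "card ?P + 5 \<le> 3 * card K"
  proof (rule card_adjacent_pairs)
    show "?P \<subseteq> K \<times> K" by auto
    show "l C < r C" if "C \<in> K" for C
      using proj[OF that] props(4)[OF that] by (metis all_not_in_conv image_is_empty less_trans)
    show "2 \<le> card K" by (rule K(2))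
    fix A C assume "(A, C) \<in> ?P"
    then obtain i where i: "i \<in> I" "A = dn i" "C = up i" "A \<in> K" "C \<in> K" by auto
    obtain t where t: "\<gamma> i t \<in> U" "Re (\<gamma> i t) \<notin> r ` K"
      and col: "\<forall>\<^sub>F y in at_right 0. \<gamma> i t + \<i> * of_real y \<in> up i \<and> \<gamma> i t - \<i> * of_real y \<in> dn i"
      using side_column[OF i(1), of "r ` K"] finK by auto
    let ?x = "Re (\<gamma> i t)"
    have column: "\<exists>y. 0 < y \<and> y < h \<and> \<gamma> i t + \<i> * of_real y \<in> C \<and> \<gamma> i t - \<i> * of_real y \<in> A" if "h > 0" for h
    proof -
      have "\<forall>\<^sub>F y in at_right (0::real). y \<in> {0<..<h}" using that by (intro eventually_at_right_real) simp
      then have "\<forall>\<^sub>F y in at_right 0. (\<gamma> i t + \<i> * of_real y \<in> up i \<and> \<gamma> i t - \<i> * of_real y \<in> dn i) \<and> y \<in> {0<..<h}"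
        by (rule eventually_conj[OF col])
      then show ?thesis
        using eventually_happens[of _ "at_right (0::real)"] trivial_limit_at_right_real i(2,3) by fastforce
    qed
    obtain y where y: "0 < y" "\<gamma> i t + \<i> * of_real y \<in> C" "\<gamma> i t - \<i> * of_real y \<in> A"
      using column[of 1] by auto
    have xin: "?x \<in> Re ` A" "?x \<in> Re ` C"
      using image_eqI[OF _ y(3), of ?x Re] image_eqI[OF _ y(2), of ?x Re] by simp_all
    have neq: "A \<noteq> C" using up_neq_dn i by auto
    have "below A C" using comp[OF i(4,5) neq y(3,2)] y(1) by simp
    moreover have "\<not> below E C" if E: "E \<in> act ?x" "below A E" for E
    proof
      assume "below E C"
      have "E \<in> K" "?x \<in> Re ` E" using E(1) proj[of E ?x] by (auto simp: act_def)
      then obtain e where e: "e \<in> E" "Re e = ?x" by auto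
      have "Im e \<noteq> Im (\<gamma> i t)"
      proof
        assume "Im e = Im (\<gamma> i t)"
        then have "e = \<gamma> i t" using e by (simp add: complex_eq_iff)
        then show False using t(1) e props(5)[OF \<open>E \<in> K\<close>] by auto
      qed
      \<comment> \<open>A cell strictly between would have a point \<open>e\<close> on the column.
        If \<open>e\<close> is above the segment, some point of \<open>C\<close> lies below it; if
        it is below the segment, some point of \<open>A\<close> lies above it.\<close>
      then consider "Im e > Im (\<gamma> i t)" | "Im e < Im (\<gamma> i t)" by linarith
      then show False
      proof cases
        case 1
        then obtain y where "y < Im e - Im (\<gamma> i t)" "\<gamma> i t + \<i> * of_real y \<in> C"
          using column[of "Im e - Im (\<gamma> i t)"] by auto
        then show False
          using order[OF \<open>E \<in> K\<close> i(5) \<open>below E C\<close> e(1), of "\<gamma> i t + \<i> * of_real y"] e(2) by simp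
      next
        case 2
        then obtain y where "y < Im (\<gamma> i t) - Im e" "\<gamma> i t - \<i> * of_real y \<in> A"
          using column[of "Im (\<gamma> i t) - Im e"] by auto
        then show False
          using order[OF i(4) \<open>E \<in> K\<close> E(2) _ e(1), of "\<gamma> i t - \<i> * of_real y"] e(2) by simp
      qed
    qed
    ultimately have "adj ?x A C"
      using proj[OF i(4)] proj[OF i(5)] xin i(4,5) by (auto simp: adj_def act_def)
    then show "\<exists>x. x \<notin> r ` K \<and> adj x A C" using t(2) by blast
  qed
  moreover have "card ?P = card ?J"
    using inj_up_dn by (intro card_image) (auto elim: inj_on_subset)
  ultimately show ?thesis by simp
qed

text \<open>At most \<open>n + 1\<close> cells turn the bound of
  \<open>ex_orientation_few_odd\<close> into \<open>2 n + 3\<close>, and parity removes one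
  more.\<close>

lemma ex_assignment:
  assumes ev: "even (card I)"
  shows "\<exists>hL hR. (\<forall>i\<in>I. hL i = up i \<or> hL i = dn i) \<and>
     (\<forall>i\<in>I. hR i = side i (q i) 1 \<or> hR i = side i (q i) (-1)) \<and>
     (\<forall>C. even (indeg I hR C)) \<and> finite {C. odd (indeg I hL C)} \<and>
     5 * card {C. odd (indeg I hL C)} \<le> 2 * card I + 2"
proof -
  have "(\<lambda>i. side i (q i) 1) ` I \<union> (\<lambda>i. side i (q i) (-1)) ` I \<subseteq> cells"
    using side_cell(1) by auto
  from ex_even_orientation[OF fin ev this graph_connected_right]
  obtain hR where hR: "orients I (\<lambda>i. side i (q i) 1) (\<lambda>i. side i (q i) (-1)) hR \<and> (\<forall>C. even (indeg I hR C))" ..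
  have sub: "dn ` I \<union> up ` I \<subseteq> cells" using up_dn_cells by auto
  have "\<exists>h. orients I dn up h \<and> card I + 5 * card {C \<in> cells. odd (indeg I h C)} \<le> 3 * card cells"
    by (rule ex_orientation_few_odd[OF fin finite_cells sub]) (use up_neq_dn in metis, rule sparse_left)
  then obtain hL where "orients I dn up hL \<and> card I + 5 * card {C \<in> cells. odd (indeg I hL C)} \<le> 3 * card cells" ..
  note hL = conjunct1[OF this] conjunct2[OF this]
  have im: "hL ` I \<subseteq> cells" using hL(1) sub unfolding orients_def by blast
  have "indeg I hL C = 0" if "C \<notin> cells" for C
    using im that fin by (auto simp: indeg_def)
  then have odds: "{C. odd (indeg I hL C)} = {C \<in> cells. odd (indeg I hL C)}" by force
  \<comment> \<open>The indegrees add up to the even number \<open>card I\<close>, so the odd cells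
    are even in number and the bound \<open>2 * card I + 3\<close> is not attained.\<close>
  have ev2: "even (card {C. odd (indeg I hL C)})"
    unfolding odds using sum_indeg[OF fin finite_cells im] ev even_sum_iff[OF finite_cells, of "indeg I hL"] by simp
  have "5 * card {C. odd (indeg I hL C)} \<le> 2 * card I + 3"
    using hL(2) card_cells_le odds by simp
  moreover have "even (5 * card {C. odd (indeg I hL C)})" using ev2 by simp
  ultimately have "5 * card {C. odd (indeg I hL C)} \<le> 2 * card I + 2" by presburger
  moreover have "finite {C. odd (indeg I hL C)}" unfolding odds using finite_cells by simp
  moreover have "\<forall>i\<in>I. hL i = up i \<or> hL i = dn i" using hL(1) by (auto simp: orients_def)
  moreover have "\<forall>i\<in>I. hR i = side i (q i) 1 \<or> hR i = side i (q i) (-1)" using hR by (simp add: orients_def)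
  ultimately show ?thesis using hR by (intro exI[of _ hL] exI[of _ hR]) simp
qed

end

subsection \<open>Pairing endpoints inside cells\<close>

text \<open>Both new segments are compared with the detour through \<open>x\<close>, by the triangle
  inequality. It is strict for \<open>a\<close> and \<open>c\<close>: equality would put
  \<open>x\<close> on the segment from \<open>a\<close> to \<open>c\<close> and make
  \<open>a\<close>, \<open>b\<close>, \<open>c\<close> collinear.\<close>

lemma uncrossing_shortens:
  fixes a b c e x :: complex
  assumes x: "x \<in> open_segment a b" "x \<in> open_segment c e" and nc: "cr (b - a) (c - a) \<noteq> 0"
  shows "dist a c + dist b e < dist a b + dist c e"
proof -
  have ab: "dist a b = dist a x + dist x b" and ce: "dist c e = dist c x + dist x e"
    using x by (auto simp: between[symmetric] between_mem_segment open_segment_def)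
  have "dist a c \<noteq> dist a x + dist x c"
  proof
    assume "dist a c = dist a x + dist x c"
    then have "x \<in> closed_segment a c" by (simp add: between[symmetric] between_mem_segment)
    then obtain u where u: "x = (1 - u) *\<^sub>R a + u *\<^sub>R c" unfolding in_segment by blast
    obtain t where t: "0 < t" "x = (1 - t) *\<^sub>R a + t *\<^sub>R b" using x(1) unfolding in_segment by blast
    have "x - a = of_real u * (c - a)" unfolding u by (simp add: scaleR_conv_of_real algebra_simps)
    moreover have "x - a = of_real t * (b - a)" unfolding t(2) by (simp add: scaleR_conv_of_real algebra_simps)
    ultimately have "t * cr (b - a) (c - a) = u * cr (c - a) (c - a)" by (metis cr_scale_left)
    then show False using nc t(1) by simp
  qed
  moreover have "dist a c \<le> dist a x + dist x c" by (rule dist_triangle)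
  ultimately have "dist a c < dist a x + dist x c" by linarith
  moreover have "dist b e \<le> dist b x + dist x e" by (rule dist_triangle)
  ultimately show ?thesis using ab ce by (simp add: dist_commute)
qed

lemma card_pairs:
  assumes "finite X" "\<forall>e\<in>E. \<exists>a b. a \<noteq> b \<and> e = {a, b}" "disjoint E" "\<Union>E = X"
  shows "2 * card E = card X"
proof -
  have "card (\<Union>E) = sum card E"
    using assms(2,3) by (intro card_Union_disjoint) auto
  also have "\<dots> = sum (\<lambda>_. 2) E" using assms(2) by (intro sum.cong) auto
  finally show ?thesis using assms(4) by simp
qed

context extension begin

text \<open>Endpoints are named by their segment and their kind, so that comparing first components
  decides whether two endpoints belong to the same segment.\<close>

definition vx :: "'i \<times> bool \<Rightarrow> complex" where "vx a = (if snd a then q (fst a) else p (fst a))"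

lemma vx_vertex: "vx a \<in> {p (fst a), q (fst a)}"
  by (simp add: vx_def)

lemma vx_not_on_line:
  assumes "fst a \<in> I" "i \<in> I" "fst a \<noteq> i"
  shows "vx a \<noteq> \<gamma> i \<tau>"
  using gp(1)[OF assms] gp(2)[OF assms] by (simp add: vx_def)

lemma vx_cases: "vx a = \<gamma> (fst a) (if snd a then 1 else 0)"
  by (simp add: vx_def)

text \<open>Both endpoints are in the closure of \<open>C\<close>, so \<open>vx b\<close> lies
  weakly on the correct side of the line through segment \<open>fst a\<close>. General position
  makes this strict, as \<open>open_segment_in_side\<close> demands.\<close>

lemma open_segment_in_cell:
  assumes I: "fst a \<in> I" "fst b \<in> I" "fst a \<noteq> fst b"
    and C: "C = side (fst a) (vx a) s" "s \<in> {1, -1}" "C = side (fst b) (vx b) s'" "s' \<in> {1, -1}"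
  shows "open_segment (vx a) (vx b) \<subseteq> C"
proof -
  have "vx b \<in> closure C" unfolding C(3) by (rule vertex_in_closure_side[OF I(2) vx_vertex C(4)])
  then have b: "vx b \<in> closure (side (fst a) (vx a) s)" using C(1) by simp
  have "s * cr (d (fst a)) (vx b - vx a) \<ge> 0" by (rule side_closure_cr[OF I(1) vx_vertex C(2) b])
  moreover have "cr (d (fst a)) (vx b - vx a) \<noteq> 0"
  proof
    assume "cr (d (fst a)) (vx b - vx a) = 0"
    moreover have "cr (d (fst a)) (vx a - p (fst a)) = 0" using cr_on_line[of "fst a" _ 0] vx_cases[of a] by simp
    ultimately have "cr (d (fst a)) (vx b - p (fst a)) = 0" by (simp add: cr_diff_right)
    then obtain t where "vx b = \<gamma> (fst a) t" using on_lineE[OF I(1)] by blast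
    then show False using vx_not_on_line[OF I(2,1)] I(3) by metis
  qed
  ultimately have "s * cr (d (fst a)) (vx b - vx a) > 0" using C(2) by auto
  then show ?thesis unfolding C(1) by (rule open_segment_in_side[OF I(1) vx_vertex C(2) b])
qed

text \<open>With \<open>o\<close> odd cells, \<open>2 n - o\<close> endpoints are kept, and
  \<open>5 o <= 2 n + 2\<close> gives \<open>5 (2 n - o) >= 8 n - 2\<close>.\<close>

lemma ex_pairing:
  assumes ev: "even (card I)"
  shows "\<exists>X cl E. X \<subseteq> I \<times> UNIV \<and> 5 * card X + 2 \<ge> 8 * card I \<and>
     (\<forall>a\<in>X. \<exists>s\<in>{1, -1}. cl a = side (fst a) (vx a) s) \<and>
     (\<forall>e\<in>E. \<exists>a\<in>X. \<exists>b\<in>X. fst a \<noteq> fst b \<and> e = {a, b} \<and> cl a = cl b) \<and> disjoint E \<and> \<Union>E = X"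
proof -
  obtain hL hR where hL: "\<And>i. i \<in> I \<Longrightarrow> hL i = up i \<or> hL i = dn i"
    and hR: "\<And>i. i \<in> I \<Longrightarrow> hR i = side i (q i) 1 \<or> hR i = side i (q i) (-1)"
    and evR: "\<And>C. even (indeg I hR C)" and finO: "finite {C. odd (indeg I hL C)}"
    and O5: "5 * card {C. odd (indeg I hL C)} \<le> 2 * card I + 2"
    using ex_assignment[OF ev] by (elim exE conjE) (metis (no_types, lifting))
  let ?O = "{C. odd (indeg I hL C)}"
  have "\<forall>C\<in>?O. \<exists>i. i \<in> I \<and> hL i = C"
  proof (rule ballI, rule ccontr)
    fix C assume C: "C \<in> ?O" and "\<nexists>i. i \<in> I \<and> hL i = C"
    then have none: "{i \<in> I. hL i = C} = {}" by blast
    have "indeg I hL C = 0" unfolding indeg_def none by simp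
    then show False using C by simp
  qed
  \<comment> \<open>The left endpoint \<open>g C\<close> is the one dropped in the odd cell
    \<open>C\<close>; an odd indegree is not 0, so there is one.\<close>
  from bchoice[OF this] obtain g where "\<forall>C\<in>?O. g C \<in> I \<and> hL (g C) = C" ..
  then have g: "g C \<in> I" "hL (g C) = C" if "C \<in> ?O" for C using that by simp_all
  define J where "J = I - g ` ?O"
  have cardJ: "card J + card ?O = card I"
  proof -
    have "inj_on g ?O" by (rule inj_on_inverseI[of _ hL]) (rule g(2))
    then have "card (g ` ?O) = card ?O" by (rule card_image)
    moreover have sub: "g ` ?O \<subseteq> I" using g(1) by (rule image_subsetI)
    moreover have "card J = card I - card (g ` ?O)"
      unfolding J_def by (rule card_Diff_subset[OF finite_subset[OF sub fin] sub])
    ultimately show ?thesis using card_mono[OF fin sub] by simp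
  qed
  have evJ: "even (card {i \<in> J. hL i = C})" for C
  proof (cases "C \<in> ?O")
    case True
    have "{i \<in> J. hL i = C} = {i \<in> I. hL i = C} - {g C}" using g True unfolding J_def by auto
    then have "card {i \<in> J. hL i = C} = indeg I hL C - 1" unfolding indeg_def using g[OF True] fin by simp
    then show ?thesis using True by simp
  next
    case False
    have "{i \<in> J. hL i = C} = {i \<in> I. hL i = C}" using g False unfolding J_def by auto
    then show ?thesis using False by (simp add: indeg_def)
  qed
  define X where "X = J \<times> {False} \<union> I \<times> {True}"
  have XI: "X \<subseteq> I \<times> UNIV" by (auto simp: X_def J_def)
  have finX: "finite X" using fin by (auto simp: X_def J_def)
  have "finite J" using fin by (simp add: J_def)
  have cardX: "card X = card J + card I"
  proof -
    have "(J \<times> {False}) \<inter> (I \<times> {True}) = {}" by blast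
    then have "card X = card (J \<times> {False}) + card (I \<times> {True})"
      unfolding X_def using fin \<open>finite J\<close> by (intro card_Un_disjoint) simp_all
    then show ?thesis by (simp add: card_cartesian_product)
  qed
  define cl where "cl a = (if snd a then hR (fst a) else hL (fst a))" for a
  \<comment> \<open>The colour consists of the cell and the kind of the endpoint. Two different
    endpoints of the same kind belong to different segments, so no pair repeats a given
    segment.\<close>
  have "even (card {x \<in> X. (cl x, snd x) = (C, b)})" for C b
  proof (cases b)
    case True
    have "{x \<in> X. (cl x, snd x) = (C, b)} = {i \<in> I. hR i = C} \<times> {True}"
      using True unfolding X_def cl_def by auto
    then show ?thesis using evR[of C] by (simp add: card_cartesian_product indeg_def)
  next
    case False
    have "{x \<in> X. (cl x, snd x) = (C, b)} = {i \<in> J. hL i = C} \<times> {False}"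
      using False unfolding X_def cl_def by auto
    then show ?thesis using evJ[of C] by (simp add: card_cartesian_product)
  qed
  then have "even (card {x \<in> X. (cl x, snd x) = c})" for c by (cases c) simp
  then have "\<exists>E. (\<forall>e\<in>E. \<exists>a\<in>X. \<exists>b\<in>X. a \<noteq> b \<and> e = {a, b} \<and> (cl a, snd a) = (cl b, snd b)) \<and> disjoint E \<and> \<Union>E = X"
    by (rule ex_monochromatic_pairing[OF finX])
  then obtain E where "(\<forall>e\<in>E. \<exists>a\<in>X. \<exists>b\<in>X. a \<noteq> b \<and> e = {a, b} \<and> (cl a, snd a) = (cl b, snd b)) \<and> disjoint E \<and> \<Union>E = X" ..
  then have E: "\<forall>e\<in>E. \<exists>a\<in>X. \<exists>b\<in>X. a \<noteq> b \<and> e = {a, b} \<and> (cl a, snd a) = (cl b, snd b)" "disjoint E" "\<Union>E = X"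
    by simp_all
  have E1: "\<forall>e\<in>E. \<exists>a\<in>X. \<exists>b\<in>X. fst a \<noteq> fst b \<and> e = {a, b} \<and> cl a = cl b"
  proof
    fix e assume "e \<in> E"
    from bspec[OF E(1) this] show "\<exists>a\<in>X. \<exists>b\<in>X. fst a \<noteq> fst b \<and> e = {a, b} \<and> cl a = cl b"
    proof (elim bexE conjE)
      fix a b assume ab: "a \<in> X" "b \<in> X" "a \<noteq> b" "e = {a, b}" "(cl a, snd a) = (cl b, snd b)"
      then have "fst a \<noteq> fst b" "cl a = cl b" by (auto simp: prod_eq_iff)
      then show ?thesis by (intro bexI[OF _ ab(1)] bexI[OF _ ab(2)] conjI ab(4))
    qed
  qed
  have sides: "\<forall>a\<in>X. \<exists>s\<in>{1, -1}. cl a = side (fst a) (vx a) s"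
  proof
    fix a assume "a \<in> X"
    then have "fst a \<in> I" using XI by auto
    then show "\<exists>s\<in>{1, -1}. cl a = side (fst a) (vx a) s"
      using hL[of "fst a"] hR[of "fst a"] by (auto simp: cl_def vx_def)
  qed
  have "5 * card X + 2 \<ge> 8 * card I" using cardX cardJ O5 by linarith
  then show ?thesis using XI sides E1 E(2,3) by (intro exI[of _ X] exI[of _ cl] exI[of _ E]) simp
qed

text \<open>The sum over ordered pairs makes the length a function of the set \<open>e\<close>, with
  no order of its two elements to be chosen; it is twice the length of the segment.\<close>

definition len :: "('i \<times> bool) set \<Rightarrow> real" where
  "len e = (\<Sum>a\<in>e. \<Sum>b\<in>e. dist (vx a) (vx b))"

lemma len_pair: "a \<noteq> b \<Longrightarrow> len {a, b} = 2 * dist (vx a) (vx b)"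
  by (simp add: len_def dist_commute)

text \<open>Take a pairing of minimal total length. Crossing pairs lie in a common cell, so
  exchanging partners stays within the cell and shortens the pairing; it remains to see that one of
  the two exchanges joins no two ends of the same segment.\<close>

lemma ex_noncrossing_pairing:
  assumes ev: "even (card I)"
    and gp3: "\<And>a b c. a \<in> I \<times> UNIV \<Longrightarrow> b \<in> I \<times> UNIV \<Longrightarrow> c \<in> I \<times> UNIV \<Longrightarrow> a \<noteq> b \<Longrightarrow> a \<noteq> c \<Longrightarrow> b \<noteq> c \<Longrightarrow>
      cr (vx b - vx a) (vx c - vx a) \<noteq> 0"
  shows "\<exists>E. 5 * card E + 1 \<ge> 4 * card I \<and> disjoint E \<and>
     (\<forall>e\<in>E. \<exists>a\<in>I \<times> UNIV. \<exists>b\<in>I \<times> UNIV. fst a \<noteq> fst b \<and> e = {a, b} \<and> open_segment (vx a) (vx b) \<inter> U = {}) \<and>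
     (\<forall>a b c e. {a, b} \<in> E \<longrightarrow> {c, e} \<in> E \<longrightarrow> {a, b} \<noteq> {c, e} \<longrightarrow>
        open_segment (vx a) (vx b) \<inter> open_segment (vx c) (vx e) = {})"
proof -
  obtain X cl E0 where X: "X \<subseteq> I \<times> UNIV" "5 * card X + 2 \<ge> 8 * card I"
    and cl: "\<And>a. a \<in> X \<Longrightarrow> \<exists>s\<in>{1, -1}. cl a = side (fst a) (vx a) s"
    and E0: "\<forall>e\<in>E0. \<exists>a\<in>X. \<exists>b\<in>X. fst a \<noteq> fst b \<and> e = {a, b} \<and> cl a = cl b" "disjoint E0" "\<Union>E0 = X"
    using ex_pairing[OF ev] by (elim exE conjE) (metis (no_types, lifting))
  have finX: "finite X" using X(1) fin finite_subset by fastforce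
  \<comment> \<open>The condition that both ends be of the same kind is weakened to different
    segments, because an exchange may pair a left endpoint with a right one.\<close>
  define \<M> where "\<M> = {E. (\<forall>e\<in>E. \<exists>a\<in>X. \<exists>b\<in>X. fst a \<noteq> fst b \<and> e = {a, b} \<and> cl a = cl b) \<and> disjoint E \<and> \<Union>E = X}"
  have "\<M> \<subseteq> Pow (Pow X)" by (auto simp: \<M>_def)
  then have fin\<M>: "finite \<M>" using finX finite_subset by fastforce
  have "E0 \<in> \<M>" using E0 by (simp add: \<M>_def)
  then obtain E where E: "E \<in> \<M>" and min: "\<And>E'. E' \<in> \<M> \<Longrightarrow> sum len E \<le> sum len E'"
    using ex_min_on_finite[OF fin\<M>, of "sum len"] by blast
  have pairs: "\<exists>a\<in>X. \<exists>b\<in>X. fst a \<noteq> fst b \<and> e = {a, b} \<and> cl a = cl b" if "e \<in> E" for e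
    using E that by (simp add: \<M>_def)
  have disjE: "disjoint E" and UE: "\<Union>E = X" using E by (simp_all add: \<M>_def)
  have finE: "finite E" using UE finX by (metis finite_UnionD)
  have in_cell: "open_segment (vx a) (vx b) \<subseteq> cl a" if ab: "a \<in> X" "b \<in> X" "fst a \<noteq> fst b" "cl a = cl b" for a b
  proof -
    obtain s s' where "s \<in> {1, -1}" "cl a = side (fst a) (vx a) s" "s' \<in> {1, -1}" "cl b = side (fst b) (vx b) s'"
      using cl[OF ab(1)] cl[OF ab(2)] by blast
    moreover have "fst a \<in> I" "fst b \<in> I" using ab X(1) by auto
    ultimately show ?thesis using open_segment_in_cell[of a b "cl a" s s'] ab by simp
  qed
  have cl_cells: "cl a \<in> cells" if "a \<in> X" for a
  proof -
    have "fst a \<in> I" using that X(1) by auto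
    then show ?thesis using cl[OF that] side_cell(1)[OF _ vx_vertex] by metis
  qed
  have pairD: "a \<in> X" "b \<in> X" "fst a \<noteq> fst b" "cl a = cl b" if "{a, b} \<in> E" for a b
    using pairs[OF that] by (auto simp: doubleton_eq_iff)
  have no_cross: False
    if e: "{a, b} \<in> E" "{c, e} \<in> E" "{a, b} \<noteq> {c, e}"
      and x: "x \<in> open_segment (vx a) (vx b)" "x \<in> open_segment (vx c) (vx e)"
      and ok: "fst a \<noteq> fst c" "fst b \<noteq> fst e" for a b c e x
  proof -
    note ab = pairD[OF e(1)] and ce = pairD[OF e(2)]
    have dis: "{a, b} \<inter> {c, e} = {}" using disjE e by (meson disjointD)
    \<comment> \<open>The crossing point lies in the cells of both pairs, so all four endpoints are
      assigned to the same cell.\<close>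
    have "x \<in> cl a" "x \<in> cl c" using in_cell[OF ab] in_cell[OF ce] x by auto
    then have "cl a = cl c" using cells_disjoint[of "cl a" "cl c"] cl_cells ab ce by blast
    let ?E = "insert {a, c} (insert {b, e} (E - {{a, b}, {c, e}}))"
    have rest: "f \<inter> {a, b, c, e} = {}" if "f \<in> E - {{a, b}, {c, e}}" for f
    proof -
      have "f \<inter> {a, b} = {}" by (rule disjointD[OF disjE]) (use that e in auto)
      moreover have "f \<inter> {c, e} = {}" by (rule disjointD[OF disjE]) (use that e in auto)
      ultimately show ?thesis by auto
    qed
    have "?E \<in> \<M>" unfolding \<M>_def mem_Collect_eq
    proof (intro conjI ballI)
      fix f assume "f \<in> ?E"
      then consider "f = {a, c}" | "f = {b, e}" | "f \<in> E" by auto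
      then show "\<exists>a\<in>X. \<exists>b\<in>X. fst a \<noteq> fst b \<and> f = {a, b} \<and> cl a = cl b"
      proof cases
        case 1 then show ?thesis using ab ce ok \<open>cl a = cl c\<close> by blast
      next
        case 2 then show ?thesis using ab ce ok \<open>cl a = cl c\<close> by metis
      next
        case 3 then show ?thesis by (rule pairs)
      qed
    next
      have "disjoint (E - {{a, b}, {c, e}})" using disjE by (rule pairwise_subset) auto
      moreover have "disjnt {b, e} y \<and> disjnt y {b, e}" if "y \<in> E - {{a, b}, {c, e}}" for y
        using rest[OF that] by (auto simp: disjnt_def)
      moreover have "disjnt {a, c} y \<and> disjnt y {a, c}" if "y \<in> insert {b, e} (E - {{a, b}, {c, e}})" for y
      proof (cases "y = {b, e}")
        case True
        moreover have "a \<noteq> b" "c \<noteq> e" using ab(3) ce(3) by auto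
        ultimately show ?thesis using dis by (auto simp: disjnt_def)
      next
        case False
        then show ?thesis using that rest[of y] by (auto simp: disjnt_def)
      qed
      ultimately show "disjoint ?E" unfolding pairwise_insert by simp
    next
      have "X = \<Union>(E - {{a, b}, {c, e}}) \<union> {a, b} \<union> {c, e}" using UE e by blast
      then show "\<Union>?E = X" by auto
    qed
    then have "sum len E \<le> sum len ?E" by (rule min)
    moreover have "sum len E = sum len (E - {{a, b}, {c, e}}) + len {a, b} + len {c, e}"
      using finE e by (subst sum.subset_diff[of "{{a, b}, {c, e}}" E]) auto
    moreover have "sum len ?E = sum len (E - {{a, b}, {c, e}}) + len {a, c} + len {b, e}"
    proof -
      have "{b, e} \<notin> E - {{a, b}, {c, e}}" "{a, c} \<notin> E - {{a, b}, {c, e}}" "{a, c} \<noteq> {b, e}"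
        using rest[of "{b, e}"] rest[of "{a, c}"] dis ab(3) by (auto simp: doubleton_eq_iff)
      then show ?thesis using finE by simp
    qed
    moreover have "a \<noteq> b" "c \<noteq> e" "a \<noteq> c" "b \<noteq> e" "b \<noteq> c" using ab(3) ce(3) ok dis by auto
    moreover have "dist (vx a) (vx c) + dist (vx b) (vx e) < dist (vx a) (vx b) + dist (vx c) (vx e)"
    proof (rule uncrossing_shortens[OF x])
      show "cr (vx b - vx a) (vx c - vx a) \<noteq> 0"
        using gp3[of a b c] X(1) ab ce \<open>a \<noteq> b\<close> \<open>a \<noteq> c\<close> \<open>b \<noteq> c\<close> by blast
    qed
    ultimately show False by (simp add: len_pair)
  qed
  have final: "open_segment (vx a) (vx b) \<inter> open_segment (vx c) (vx e) = {}"
    if e: "{a, b} \<in> E" "{c, e} \<in> E" "{a, b} \<noteq> {c, e}" for a b c e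
  proof (rule ccontr)
    assume "\<not> ?thesis"
    then obtain x where x: "x \<in> open_segment (vx a) (vx b)" "x \<in> open_segment (vx c) (vx e)" by blast
    have x': "x \<in> open_segment (vx e) (vx c)" using x(2) by (simp add: open_segment_commute)
    have dis: "{a, b} \<inter> {c, e} = {}" using disjE e by (meson disjointD)
    note ab = pairD[OF e(1)] and ce = pairD[OF e(2)]
    show False
    \<comment> \<open>If \<open>a\<close> and \<open>c\<close>, or \<open>b\<close> and
      \<open>e\<close>, belong to one segment, then \<open>a\<close>, \<open>e\<close> and
      \<open>b\<close>, \<open>c\<close> do not, since the two ends of a pair always lie on
      different segments. The roles of \<open>c\<close> and \<open>e\<close> can then be
      exchanged.\<close>
    proof (cases "fst a \<noteq> fst c \<and> fst b \<noteq> fst e")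
      case True
      then show False using no_cross[OF e x] by blast
    next
      case False
      have three: "u = v \<or> u = w \<or> v = w" if "fst u = fst v" "fst u = fst w" for u v w :: "'i \<times> bool"
        using that by (cases u; cases v; cases w) auto
      have "fst a \<noteq> fst e \<and> fst b \<noteq> fst c"
        using False three[of a c e] three[of a c b] three[of b e a] three[of b e c] dis ab(3) ce(3) by fastforce
      moreover have "{e, c} \<in> E" "{a, b} \<noteq> {e, c}" using e by (simp_all add: insert_commute)
      ultimately show False using no_cross[OF e(1) _ _ x(1) x'] by blast
    qed
  qed
  have "2 * card E = card X"
  proof (rule card_pairs[OF finX _ disjE UE], rule ballI)
    fix e assume "e \<in> E"
    then show "\<exists>a b. a \<noteq> b \<and> e = {a, b}" using pairs by metis
  qed
  then have "5 * card E + 1 \<ge> 4 * card I" using X(2) by linarith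
  moreover have "\<forall>e\<in>E. \<exists>a\<in>I \<times> UNIV. \<exists>b\<in>I \<times> UNIV. fst a \<noteq> fst b \<and> e = {a, b} \<and> open_segment (vx a) (vx b) \<inter> U = {}"
  proof
    fix e assume "e \<in> E"
    then obtain a b where ab: "a \<in> X" "b \<in> X" "fst a \<noteq> fst b" "e = {a, b}" "cl a = cl b" using pairs by blast
    have "open_segment (vx a) (vx b) \<inter> U = {}"
      using in_cell[OF ab(1-3,5)] cells_props(3)[OF cl_cells[OF ab(1)]] by blast
    then show "\<exists>a\<in>I \<times> UNIV. \<exists>b\<in>I \<times> UNIV. fst a \<noteq> fst b \<and> e = {a, b} \<and> open_segment (vx a) (vx b) \<inter> U = {}"
      using ab X(1) by blast
  qed
  ultimately show ?thesis using disjE final by (intro exI[of _ E]) blast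
qed

end

subsection \<open>The matching\<close>

lemma pt_in_closed_segment: "0 \<le> t \<Longrightarrow> t \<le> 1 \<Longrightarrow> pt a b t \<in> closed_segment a b"
  unfolding in_segment pt_def by (intro exI[of _ t]) (simp add: scaleR_conv_of_real algebra_simps)

lemma closed_segment_eq_pt: "closed_segment a b = pt a b ` {0..1}"
proof -
  have "pt a b = (\<lambda>u. (1 - u) *\<^sub>R a + u *\<^sub>R b)"
    by (rule ext) (simp add: pt_def scaleR_conv_of_real algebra_simps)
  then show ?thesis by (auto simp: closed_segment_def)
qed

text \<open>Two rounds of \<open>extend_right\<close> supply the extension parameters, and the given
  segments are part of the extended ones, so avoiding \<open>U\<close> means avoiding them.\<close>

lemma complex_matching:
  fixes w :: "'i \<times> bool \<Rightarrow> complex"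
  assumes fin: "finite I" and ev: "even (card I)"
    and Re_less: "\<And>i. i \<in> I \<Longrightarrow> Re (w (i, False)) < Re (w (i, True))"
    and gp3: "\<And>a b c. a \<in> I \<times> UNIV \<Longrightarrow> b \<in> I \<times> UNIV \<Longrightarrow> c \<in> I \<times> UNIV \<Longrightarrow> a \<noteq> b \<Longrightarrow> a \<noteq> c \<Longrightarrow> b \<noteq> c \<Longrightarrow>
      cr (w b - w a) (w c - w a) \<noteq> 0"
    and disj: "\<And>i j. i \<in> I \<Longrightarrow> j \<in> I \<Longrightarrow> i \<noteq> j \<Longrightarrow>
      closed_segment (w (i, False)) (w (i, True)) \<inter> closed_segment (w (j, False)) (w (j, True)) = {}"
  shows "\<exists>E. 5 * card E + 1 \<ge> 4 * card I \<and> disjoint E \<and>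
     (\<forall>e\<in>E. \<exists>a\<in>I \<times> UNIV. \<exists>b\<in>I \<times> UNIV. fst a \<noteq> fst b \<and> e = {a, b} \<and>
        (\<forall>i\<in>I. open_segment (w a) (w b) \<inter> closed_segment (w (i, False)) (w (i, True)) = {})) \<and>
     (\<forall>a b c e. {a, b} \<in> E \<longrightarrow> {c, e} \<in> E \<longrightarrow> {a, b} \<noteq> {c, e} \<longrightarrow>
        open_segment (w a) (w b) \<inter> open_segment (w c) (w e) = {})"
proof -
  define p q where "p i = w (i, False)" and "q i = w (i, True)" for i
  define \<gamma> where "\<gamma> i = pt (p i) (q i)" for i
  \<comment> \<open>The segments traversed backwards: a right extension of these is a left extension
    of the original ones, with parameter \<open>t\<close> replaced by \<open>1 - t\<close>.\<close>
  define \<gamma>' where "\<gamma>' i = pt (q i) (p i)" for i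
  have swap: "\<gamma>' i t = \<gamma> i (1 - t)" for i t unfolding \<gamma>_def \<gamma>'_def by (rule pt_swap)
  have pq: "p i \<noteq> q i" if "i \<in> I" for i using Re_less[OF that] by (auto simp: p_def q_def)
  have gp: "w (i, b) \<noteq> \<gamma> j \<tau>" if "i \<in> I" "j \<in> I" "i \<noteq> j" for i j b \<tau>
  proof
    assume "w (i, b) = \<gamma> j \<tau>"
    then have "w (i, b) - w (j, False) = of_real \<tau> * (w (j, True) - w (j, False))"
      by (simp add: \<gamma>_def pt_def p_def q_def)
    then have "cr (w (j, True) - w (j, False)) (w (i, b) - w (j, False)) = 0" by (simp add: cr_scale_right)
    then show False using gp3[of "(j, False)" "(j, True)" "(i, b)"] that by simp
  qed
  have gp_p: "p i \<noteq> \<gamma> j \<tau>" and gp_q: "q i \<noteq> \<gamma> j \<tau>" if "i \<in> I" "j \<in> I" "i \<noteq> j" for i j \<tau>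
    using gp[OF that] by (simp_all add: p_def q_def)
  have "bounded (w ` (I \<times> UNIV))" using fin by (intro finite_imp_bounded) simp
  then obtain R where R: "\<And>x. x \<in> w ` (I \<times> UNIV) \<Longrightarrow> norm x \<le> R" unfolding bounded_iff by blast
  \<comment> \<open>The margin 1 places the endpoints, which have norm at most \<open>R\<close>,
    inside the open disk.\<close>
  define D :: "complex set" where "D = ball 0 (R + 1)"
  have D: "open D" "convex D" "bounded D" by (simp_all add: D_def)
  have wD: "w (i, b) \<in> D" if "i \<in> I" for i b
    using R[of "w (i, b)"] that by (auto simp: D_def)
  have segD: "\<gamma> i t \<in> D" if "i \<in> I" "0 \<le> t" "t \<le> 1" for i t
  proof -
    have "closed_segment (p i) (q i) \<subseteq> D"
      using wD[OF that(1)] D(2) by (intro closed_segment_subset) (simp_all add: p_def q_def)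
    then show ?thesis using pt_in_closed_segment[OF that(2,3)] unfolding \<gamma>_def by blast
  qed
  have seg_disj: "\<gamma> i \<tau> \<noteq> \<gamma> j \<sigma>" if "i \<in> I" "j \<in> I" "i \<noteq> j" "0 \<le> \<tau>" "\<tau> \<le> 1" "0 \<le> \<sigma>" "\<sigma> \<le> 1" for i j \<tau> \<sigma>
    using disj[OF that(1-3)] pt_in_closed_segment[OF that(4,5), of "p i" "q i"]
      pt_in_closed_segment[OF that(6,7), of "p j" "q j"] unfolding \<gamma>_def p_def q_def by fastforce
  have "\<exists>\<beta>. (\<forall>i\<in>I. 1 < \<beta> i \<and> (\<forall>\<tau>. 0 < \<tau> \<longrightarrow> \<tau> < \<beta> i \<longrightarrow> \<gamma>' i \<tau> \<in> D) \<and>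
        (\<gamma>' i (\<beta> i) \<notin> D \<or> (\<exists>k\<in>I. k \<noteq> i \<and> (\<exists>\<sigma>. 0 < \<sigma> \<and> \<sigma> < \<beta> k \<and> \<gamma>' i (\<beta> i) = \<gamma>' k \<sigma>)))) \<and>
      (\<forall>i\<in>I. \<forall>j\<in>I. i \<noteq> j \<longrightarrow> (\<forall>\<tau> \<sigma>. 0 < \<tau> \<longrightarrow> \<tau> < \<beta> i \<longrightarrow> 0 < \<sigma> \<longrightarrow> \<sigma> < \<beta> j \<longrightarrow> \<gamma>' i \<tau> \<noteq> \<gamma>' j \<sigma>))" (is "\<exists>\<beta>. ?P \<beta>")
  proof (rule extend_right[of \<gamma>' q p I D "\<lambda>_. 0"], goal_cases)
    case (1 i) show ?case by (simp add: \<gamma>'_def)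
  next
    case (5 i) then show ?case using pq[of i] by simp
  next
    case (6 i j \<tau>) then show ?case unfolding swap using gp_q by blast
  next
    case (7 i j \<tau>) then show ?case unfolding swap using gp_p by blast
  next
    case (9 i \<tau>) then show ?case unfolding swap by (intro segD) auto
  next
    case (10 i j \<tau> \<sigma>) then show ?case unfolding swap by (intro seg_disj) auto
  qed (use fin D in auto)
  then obtain \<beta>' where \<beta>': "?P \<beta>'" ..
  define \<alpha> where "\<alpha> i = 1 - \<beta>' i" for i
  have \<alpha>_less: "\<alpha> i < 0" if "i \<in> I" for i using \<beta>' that by (simp add: \<alpha>_def)
  have \<alpha>_D: "\<gamma> i \<tau> \<in> D" if "i \<in> I" "\<alpha> i < \<tau>" "\<tau> < 1" for i \<tau>
  proof -
    have "\<gamma>' i (1 - \<tau>) \<in> D" using \<beta>' that by (simp add: \<alpha>_def)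
    then show ?thesis by (simp add: swap)
  qed
  have \<alpha>_disj: "\<gamma> i \<tau> \<noteq> \<gamma> j \<sigma>"
    if "i \<in> I" "j \<in> I" "i \<noteq> j" "\<alpha> i < \<tau>" "\<tau> < 1" "\<alpha> j < \<sigma>" "\<sigma> < 1" for i j \<tau> \<sigma>
  proof -
    have "0 < 1 - \<tau>" "1 - \<tau> < \<beta>' i" "0 < 1 - \<sigma>" "1 - \<sigma> < \<beta>' j" using that by (simp_all add: \<alpha>_def)
    then have "\<gamma>' i (1 - \<tau>) \<noteq> \<gamma>' j (1 - \<sigma>)" using conjunct2[OF \<beta>'] that(1-3) by meson
    then show ?thesis by (simp add: swap)
  qed
  have \<alpha>_end: "\<gamma> i (\<alpha> i) \<notin> D \<or> (\<exists>k\<in>I. k \<noteq> i \<and> (\<exists>\<sigma>. \<alpha> k < \<sigma> \<and> \<sigma> < 1 \<and> \<gamma> i (\<alpha> i) = \<gamma> k \<sigma>))" if "i \<in> I" for i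
  proof (cases "\<gamma> i (\<alpha> i) \<in> D")
    case True
    then have "\<gamma>' i (\<beta>' i) \<in> D" by (simp add: swap \<alpha>_def)
    then obtain k \<sigma> where k: "k \<in> I" "k \<noteq> i" "0 < \<sigma>" "\<sigma> < \<beta>' k" "\<gamma>' i (\<beta>' i) = \<gamma>' k \<sigma>"
      using conjunct1[OF \<beta>'] \<open>i \<in> I\<close> by meson
    have "\<alpha> k < 1 - \<sigma> \<and> 1 - \<sigma> < 1 \<and> \<gamma> i (\<alpha> i) = \<gamma> k (1 - \<sigma>)"
      using k(3-5) by (simp add: swap \<alpha>_def)
    then show ?thesis using k(1,2) by meson
  qed simp
  \<comment> \<open>The second round starts with the left extensions in place, so that right
    extensions may stop on them.\<close>
  have "\<exists>\<beta>. (\<forall>i\<in>I. 1 < \<beta> i \<and> (\<forall>\<tau>. \<alpha> i < \<tau> \<longrightarrow> \<tau> < \<beta> i \<longrightarrow> \<gamma> i \<tau> \<in> D) \<and>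
        (\<gamma> i (\<beta> i) \<notin> D \<or> (\<exists>k\<in>I. k \<noteq> i \<and> (\<exists>\<sigma>. \<alpha> k < \<sigma> \<and> \<sigma> < \<beta> k \<and> \<gamma> i (\<beta> i) = \<gamma> k \<sigma>)))) \<and>
      (\<forall>i\<in>I. \<forall>j\<in>I. i \<noteq> j \<longrightarrow> (\<forall>\<tau> \<sigma>. \<alpha> i < \<tau> \<longrightarrow> \<tau> < \<beta> i \<longrightarrow> \<alpha> j < \<sigma> \<longrightarrow> \<sigma> < \<beta> j \<longrightarrow> \<gamma> i \<tau> \<noteq> \<gamma> j \<sigma>))" (is "\<exists>\<beta>. ?P \<beta>")
  proof (rule extend_right[of \<gamma> p q I D \<alpha>], goal_cases)
    case (1 i) show ?case by (simp add: \<gamma>_def)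
  next
    case (5 i) then show ?case by (rule pq)
  next
    case (6 i j \<tau>) then show ?case by (rule gp_p)
  next
    case (7 i j \<tau>) then show ?case by (rule gp_q)
  next
    case (8 i) then show ?case using \<alpha>_less by (simp add: less_imp_le)
  next
    case (9 i \<tau>) then show ?case using \<alpha>_D[of i \<tau>] segD[of i 1] by (cases "\<tau> = 1") auto
  next
    case (10 i j \<tau> \<sigma>) then show ?case by (rule \<alpha>_disj)
  next
    case (11 i) then show ?case using \<alpha>_end[of i] by simp
  qed (use fin D in auto)
  then obtain \<beta> where \<beta>: "?P \<beta>" ..
  note \<beta>1 = bspec[OF conjunct1[OF \<beta>]] and \<beta>2 = conjunct2[OF \<beta>]
  interpret extension I p q D \<alpha> \<beta> \<gamma> "\<lambda>i. q i - p i"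
  proof (unfold_locales, unfold \<gamma>_def[symmetric], goal_cases)
    case (5 i)
    then show ?case using Re_less by (simp add: p_def q_def)
  next
    case (6 i j \<tau>)
    then show ?case by (rule gp_p)
  next
    case (7 i j \<tau>)
    then show ?case by (rule gp_q)
  next
    case (8 i)
    then show ?case by (rule \<alpha>_less)
  next
    case (9 i)
    then show ?case using \<beta>1 by simp
  next
    case (10 i \<tau>)
    then show ?case using \<beta>1[of i] by simp
  next
    case (11 i j \<tau> \<sigma>)
    then show ?case using \<beta>2 by meson
  next
    case (12 i)
    then show ?case using \<alpha>_end[of i] by simp
  next
    case (13 i)
    then show ?case using \<beta>1[of i] by simp
  qed (use fin D in auto)
  have vx_eq: "vx = w"
  proof
    fix x show "vx x = w x" by (cases x) (simp add: vx_def p_def q_def)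
  qed
  have seg_U: "closed_segment (w (i, False)) (w (i, True)) \<subseteq> U" if "i \<in> I" for i
  proof -
    have "\<gamma> i t \<in> U" if "0 \<le> t" "t \<le> 1" for t
      using \<gamma>_in_U[OF \<open>i \<in> I\<close>, of t] \<alpha>_less[OF \<open>i \<in> I\<close>] \<beta>1[OF \<open>i \<in> I\<close>] that by simp
    then show ?thesis unfolding closed_segment_eq_pt \<gamma>_def p_def q_def by auto
  qed
  have "\<exists>E. 5 * card E + 1 \<ge> 4 * card I \<and> disjoint E \<and>
     (\<forall>e\<in>E. \<exists>a\<in>I \<times> UNIV. \<exists>b\<in>I \<times> UNIV. fst a \<noteq> fst b \<and> e = {a, b} \<and> open_segment (w a) (w b) \<inter> U = {}) \<and>
     (\<forall>a b c e. {a, b} \<in> E \<longrightarrow> {c, e} \<in> E \<longrightarrow> {a, b} \<noteq> {c, e} \<longrightarrow>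
        open_segment (w a) (w b) \<inter> open_segment (w c) (w e) = {})" (is "\<exists>E. ?P E")
    unfolding vx_eq[symmetric] by (rule ex_noncrossing_pairing[OF ev]) (unfold vx_eq, rule gp3)
  then obtain E where E: "?P E" ..
  show ?thesis
  proof (intro exI[of _ E] conjI ballI)
    fix e assume "e \<in> E"
    then have "\<exists>a\<in>I \<times> UNIV. \<exists>b\<in>I \<times> UNIV. fst a \<noteq> fst b \<and> e = {a, b} \<and> open_segment (w a) (w b) \<inter> U = {}"
      using E by simp
    then show "\<exists>a\<in>I \<times> UNIV. \<exists>b\<in>I \<times> UNIV. fst a \<noteq> fst b \<and> e = {a, b} \<and>
        (\<forall>i\<in>I. open_segment (w a) (w b) \<inter> closed_segment (w (i, False)) (w (i, True)) = {})"
    proof (elim bexE conjE)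
      fix a b assume ab: "a \<in> I \<times> UNIV" "b \<in> I \<times> UNIV" "fst a \<noteq> fst b" "e = {a, b}"
        and free: "open_segment (w a) (w b) \<inter> U = {}"
      have "\<forall>i\<in>I. open_segment (w a) (w b) \<inter> closed_segment (w (i, False)) (w (i, True)) = {}"
        using free seg_U by (auto dest: subsetD)
      then show ?thesis by (intro bexI[OF _ ab(1)] bexI[OF _ ab(2)] conjI ab(3,4))
    qed
  qed (use E in simp_all)
qed

text \<open>The map adds \<open>c\<close> times the ordinate to the abscissa. Two points with
  different ordinates obtain equal abscissae for one value of \<open>c\<close> only, so finitely
  many values are forbidden. An injective linear map preserves segments and collinearity, so the
  answer can be pulled back.\<close>

lemma ex_shear:
  assumes "finite S"
  obtains h :: "point \<Rightarrow> complex" where "linear h" "inj h"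
    "\<And>a b. a \<in> S \<Longrightarrow> b \<in> S \<Longrightarrow> a \<noteq> b \<Longrightarrow> Re (h a) \<noteq> Re (h b)"
proof -
  define B where "B = (\<lambda>(a, b). - (a $ 1 - b $ 1) / (a $ 2 - b $ 2)) ` (S \<times> S)"
  have "finite B" using assms by (simp add: B_def)
  then obtain c where c: "c \<notin> B" using ex_new_if_finite infinite_UNIV_char_0 by blast
  define h where "h a = Complex (a $ 1 + c * a $ 2) (a $ 2)" for a :: point
  have "linear h" by (rule linearI) (simp_all add: h_def complex_eq_iff algebra_simps)
  moreover have "inj h"
    by (rule injI) (auto simp: h_def vec_eq_iff exhaust_2 forall_2)
  moreover have "Re (h a) \<noteq> Re (h b)" if "a \<in> S" "b \<in> S" "a \<noteq> b" for a b
  proof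
    assume eq: "Re (h a) = Re (h b)"
    show False
    proof (cases "a $ 2 = b $ 2")
      case True
      then show False using eq that(3) by (simp add: h_def vec_eq_iff forall_2)
    next
      case False
      have "c * (a $ 2 - b $ 2) = - (a $ 1 - b $ 1)" using eq by (simp add: h_def algebra_simps)
      then have "c = - (a $ 1 - b $ 1) / (a $ 2 - b $ 2)" using False by (simp add: eq_divide_eq)
      then have "c \<in> B" unfolding B_def using that(1,2) by (auto intro!: image_eqI[of _ _ "(a, b)"])
      then show False using c by contradiction
    qed
  qed
  ultimately show ?thesis by (rule that)
qed

theorem theorem14:
  fixes S :: "point set" and M :: "point set set" and n :: nat
  assumes "finite S" and "card S = 2 * n" and "even n"
    and "general_position S"
    and "perfect_matching S M"
  shows "\<exists>M'. matching S M' \<and> real (card M') \<ge> (1 / 5) * (4 * real n - 1)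
           \<and> compatible S M M' \<and> M \<inter> M' = {}"
proof -
  have ncgM: "non_crossing_geometric_graph S M"
    using assms(5) by (simp add: perfect_matching_def matching_def)
  then have ncM: "non_crossing M" and ggM: "geometric_graph S M"
    by (simp_all add: non_crossing_geometric_graph_def)
  have edgeM: "\<exists>a\<in>S. \<exists>b\<in>S. a \<noteq> b \<and> e = {a, b}" if "e \<in> M" for e
    using ggM that by (simp add: geometric_graph_def)
  have subM: "e \<subseteq> S" if "e \<in> M" for e using edgeM[OF that] by blast
  have finM: "finite M" using subM assms(1) by (meson PowI finite_Pow_iff finite_subset subsetI)
  have uniqueM: "e = f" if "e \<in> M" "f \<in> M" "v \<in> e" "v \<in> f" for e f v
  proof -
    have "v \<in> S" using subM[OF that(1)] that(3) by (rule subsetD)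
    then have "card {e \<in> M. v \<in> e} = 1" using assms(5) by (simp add: perfect_matching_def degree_def)
    then obtain g where g: "{e \<in> M. v \<in> e} = {g}" by (rule card_1_singletonE)
    have "e \<in> {g}" "f \<in> {g}" unfolding g[symmetric] using that by simp_all
    then show ?thesis by simp
  qed
  have disjM: "disjoint M" using uniqueM by (intro disjointI) blast
  have UM: "\<Union>M = S"
  proof (intro equalityI subsetI)
    fix v assume "v \<in> S"
    then have "card {e \<in> M. v \<in> e} = 1" using assms(5) by (simp add: perfect_matching_def degree_def)
    then obtain g where g: "{e \<in> M. v \<in> e} = {g}" by (rule card_1_singletonE)
    have "g \<in> {e \<in> M. v \<in> e}" unfolding g by simp
    then show "v \<in> \<Union>M" by auto
  qed (use subM in blast)
  have "2 * card M = card S"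
    by (rule card_pairs[OF assms(1) _ disjM UM]) (use edgeM in metis)
  then have cardM: "card M = n" using assms(2) by simp
  obtain h :: "point \<Rightarrow> complex" where h: "linear h" "inj h"
    "\<And>a b. a \<in> S \<Longrightarrow> b \<in> S \<Longrightarrow> a \<noteq> b \<Longrightarrow> Re (h a) \<noteq> Re (h b)"
    using ex_shear[OF assms(1)] by blast
  \<comment> \<open>Each edge is oriented from left to right after the shear; the edges themselves
    serve as indices of the segments.\<close>
  have "\<forall>e\<in>M. \<exists>ab. e = {fst ab, snd ab} \<and> Re (h (fst ab)) < Re (h (snd ab))"
  proof
    fix e assume "e \<in> M"
    from edgeM[OF this] obtain a b where ab: "a \<in> S" "b \<in> S" "a \<noteq> b" "e = {a, b}" by blast
    then consider "Re (h a) < Re (h b)" | "Re (h b) < Re (h a)" using h(3)[of a b] by linarith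
    then show "\<exists>ab. e = {fst ab, snd ab} \<and> Re (h (fst ab)) < Re (h (snd ab))"
    proof cases
      case 1
      then show ?thesis using ab(4) by (intro exI[of _ "(a, b)"]) simp
    next
      case 2
      then show ?thesis using ab(4) by (intro exI[of _ "(b, a)"]) (simp add: insert_commute)
    qed
  qed
  from bchoice[OF this] obtain g where
    "\<forall>e\<in>M. e = {fst (g e), snd (g e)} \<and> Re (h (fst (g e))) < Re (h (snd (g e)))" ..
  then have g: "e = {fst (g e), snd (g e)}" "Re (h (fst (g e))) < Re (h (snd (g e)))" if "e \<in> M" for e
    using that by blast+
  define W where "W x = (if snd x then snd (g (fst x)) else fst (g (fst x)))" for x :: "point set \<times> bool"
  have W_mem: "W x \<in> fst x" if "fst x \<in> M" for x
    using g(1)[OF that] by (auto simp: W_def)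
  have W_edge: "e = {W (e, False), W (e, True)}" if "e \<in> M" for e
    using g(1)[OF that] by (simp add: W_def)
  have W_S: "W x \<in> S" if "fst x \<in> M" for x using W_mem[OF that] subM[OF that] by blast
  have W_inj: "x = y" if "fst x \<in> M" "fst y \<in> M" "W x = W y" for x y
  proof -
    have "fst x = fst y" using uniqueM[OF that(1,2)] W_mem[OF that(1)] W_mem[OF that(2)] that(3) by simp
    moreover have "fst (g (fst x)) \<noteq> snd (g (fst x))" using g(2)[OF that(1)] by auto
    ultimately have "snd x = snd y" using that(3) by (auto simp: W_def split: if_splits)
    then show ?thesis using \<open>fst x = fst y\<close> by (simp add: prod_eq_iff)
  qed
  have hull_M: "convex hull e = closed_segment (W (e, False)) (W (e, True))" if "e \<in> M" for e
    using W_edge[OF that] by (metis segment_convex_hull)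
  have h_seg: "h ` closed_segment a b = closed_segment (h a) (h b)" for a b
    using h(1) by (rule closed_segment_linear_image[symmetric])
  have h_open: "h ` open_segment a b = open_segment (h a) (h b)" for a b
    using h(1,2) by (rule open_segment_linear_image[symmetric])
  have "\<exists>E. 5 * card E + 1 \<ge> 4 * card M \<and> disjoint E \<and>
     (\<forall>e\<in>E. \<exists>a\<in>M \<times> UNIV. \<exists>b\<in>M \<times> UNIV. fst a \<noteq> fst b \<and> e = {a, b} \<and>
        (\<forall>i\<in>M. open_segment ((h \<circ> W) a) ((h \<circ> W) b) \<inter> closed_segment ((h \<circ> W) (i, False)) ((h \<circ> W) (i, True)) = {})) \<and>
     (\<forall>a b c e. {a, b} \<in> E \<longrightarrow> {c, e} \<in> E \<longrightarrow> {a, b} \<noteq> {c, e} \<longrightarrow>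
        open_segment ((h \<circ> W) a) ((h \<circ> W) b) \<inter> open_segment ((h \<circ> W) c) ((h \<circ> W) e) = {})" (is "\<exists>E. ?P E")
  proof (rule complex_matching[OF finM], goal_cases)
    case 1
    then show ?case using assms(3) cardM by simp
  next
    case (2 i)
    then show ?case using g(2) by (simp add: W_def)
  next
    case (3 a b c)
    show ?case
    proof
      assume z: "cr ((h \<circ> W) b - (h \<circ> W) a) ((h \<circ> W) c - (h \<circ> W) a) = 0"
      have m: "fst a \<in> M" "fst b \<in> M" "fst c \<in> M" using 3(1-3) by (simp_all add: mem_Times_iff)
      have neq: "W a \<noteq> W b" "W a \<noteq> W c" "W b \<noteq> W c"
        using W_inj[OF m(1,2)] W_inj[OF m(1,3)] W_inj[OF m(2,3)] 3(4-6) by metis+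
      have "h (W b) - h (W a) \<noteq> 0" using neq(1) h(2) by (auto dest: injD)
      then obtain t where "h (W c) - h (W a) = of_real t * (h (W b) - h (W a))"
        using cr_eq_0_imp_scale z by (metis comp_apply)
      then have "h (W c - W a) = h (t *\<^sub>R (W b - W a))"
        unfolding linear_scale[OF h(1)] linear_diff[OF h(1)] by (simp add: scaleR_conv_of_real)
      then have "W c - W a = t *\<^sub>R (W b - W a)" using h(2) by (auto dest: injD)
      then have "collinear {W b, W a, W c}" by (subst collinear_3) (auto simp: collinear_lemma)
      then have "collinear {W a, W b, W c}" by (simp add: insert_commute)
      moreover have "W a \<in> S" "W b \<in> S" "W c \<in> S" using W_S m by simp_all
      ultimately show False using assms(4) neq unfolding general_position_def by blast
    qed
  next
    case (4 i j)
    have "convex hull i \<inter> convex hull j \<subseteq> i \<inter> j" using ncM 4 by (simp add: non_crossing_def)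
    moreover have "i \<inter> j = {}" using disjM 4 by (meson disjointD)
    ultimately have "closed_segment (W (i, False)) (W (i, True)) \<inter> closed_segment (W (j, False)) (W (j, True)) = {}"
      using hull_M 4 by auto
    then have "h ` closed_segment (W (i, False)) (W (i, True)) \<inter> h ` closed_segment (W (j, False)) (W (j, True)) = {}"
      using h(2) by (simp add: image_Int[symmetric])
    then show ?case by (simp add: h_seg)
  qed
  then obtain E where E: "?P E" ..
  then have disjE: "disjoint E" by simp
  have pairE: "\<exists>a b. a \<in> M \<times> UNIV \<and> b \<in> M \<times> UNIV \<and> fst a \<noteq> fst b \<and> e = {a, b} \<and>
     (\<forall>i\<in>M. open_segment (W a) (W b) \<inter> convex hull i = {})" if e: "e \<in> E" for e
  proof -
    have "\<exists>a\<in>M \<times> UNIV. \<exists>b\<in>M \<times> UNIV. fst a \<noteq> fst b \<and> e = {a, b} \<and>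
        (\<forall>i\<in>M. open_segment ((h \<circ> W) a) ((h \<circ> W) b) \<inter> closed_segment ((h \<circ> W) (i, False)) ((h \<circ> W) (i, True)) = {})"
      using E e by simp
    then show ?thesis
    proof (elim bexE conjE)
      fix a b assume ab: "a \<in> M \<times> UNIV" "b \<in> M \<times> UNIV" "fst a \<noteq> fst b" "e = {a, b}"
        and free: "\<forall>i\<in>M. open_segment ((h \<circ> W) a) ((h \<circ> W) b) \<inter> closed_segment ((h \<circ> W) (i, False)) ((h \<circ> W) (i, True)) = {}"
      have "open_segment (W a) (W b) \<inter> convex hull i = {}" if "i \<in> M" for i
      proof -
        have "h ` (open_segment (W a) (W b)) \<inter> h ` (convex hull i) = {}"
          using free that by (simp add: h_seg h_open hull_M)
        then show ?thesis by blast
      qed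
      then show ?thesis using ab by blast
    qed
  qed
  have crossE: "open_segment (W a) (W b) \<inter> open_segment (W c) (W e) = {}"
    if "{a, b} \<in> E" "{c, e} \<in> E" "{a, b} \<noteq> {c, e}" for a b c e
  proof -
    have "open_segment ((h \<circ> W) a) ((h \<circ> W) b) \<inter> open_segment ((h \<circ> W) c) ((h \<circ> W) e) = {}"
      using E that by meson
    then have "h ` open_segment (W a) (W b) \<inter> h ` open_segment (W c) (W e) = {}" by (simp add: h_open)
    then show ?thesis by blast
  qed
  define M' where "M' = image W ` E"
  have edgeM': "\<exists>x y. {x, y} \<in> E \<and> e = {W x, W y} \<and> W x \<noteq> W y \<and> fst x \<in> M \<and> fst y \<in> M \<and> fst x \<noteq> fst y \<and>
     (\<forall>i\<in>M. open_segment (W x) (W y) \<inter> convex hull i = {})" if e: "e \<in> M'" for e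
  proof -
    obtain e' where e': "e' \<in> E" "e = W ` e'" using e by (auto simp: M'_def)
    then obtain a b where ab: "a \<in> M \<times> UNIV" "b \<in> M \<times> UNIV" "fst a \<noteq> fst b" "e' = {a, b}"
      "\<forall>i\<in>M. open_segment (W a) (W b) \<inter> convex hull i = {}" using pairE by meson
    then have "fst a \<in> M" "fst b \<in> M" by auto
    moreover from this have "W a \<noteq> W b" using W_inj ab(3) by blast
    ultimately show ?thesis using ab e' by (intro exI[of _ a] exI[of _ b]) simp
  qed
  have EM: "fst x \<in> M" if "e \<in> E" "x \<in> e" for e x
    using pairE[OF that(1)] that(2) by auto
  have shareM': "e = f" if v: "e \<in> M'" "f \<in> M'" "v \<in> e" "v \<in> f" for e f v
  proof -
    obtain e' f' where ef: "e' \<in> E" "e = W ` e'" "f' \<in> E" "f = W ` f'" using v by (auto simp: M'_def)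
    have "v \<in> W ` e'" using v(3) ef(2) by simp
    then obtain x where x: "v = W x" "x \<in> e'" by (rule imageE)
    have "v \<in> W ` f'" using v(4) ef(4) by simp
    then obtain y where y: "v = W y" "y \<in> f'" by (rule imageE)
    have "x = y" by (rule W_inj[OF EM[OF ef(1) x(2)] EM[OF ef(3) y(2)]]) (use x(1) y(1) in simp)
    then have "e' \<inter> f' \<noteq> {}" using x(2) y(2) by auto
    then have "e' = f'" using disjointD[OF disjE ef(1,3)] by metis
    then show ?thesis using ef by simp
  qed
  have hull_pair: "z \<in> {a, b} \<or> z \<in> open_segment a b" if "z \<in> convex hull {a, b}" for a b z :: point
    using that by (auto simp: segment_convex_hull[symmetric] open_segment_def)
  have vertex_hull: "W x \<in> convex hull fst x" if "fst x \<in> M" for x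
    using W_mem[OF that] hull_subset by fast
  \<comment> \<open>A new segment meets the old ones only at its ends. Such an end is an endpoint of
    its own edge of \<open>M\<close>, and this edge meets \<open>m\<close> at most in a common
    vertex.\<close>
  have nc_mixed: "convex hull e \<inter> convex hull m \<subseteq> e \<inter> m" if "e \<in> M'" "m \<in> M" for e m
  proof
    fix z assume z: "z \<in> convex hull e \<inter> convex hull m"
    obtain x y where xy: "e = {W x, W y}" "fst x \<in> M" "fst y \<in> M" "open_segment (W x) (W y) \<inter> convex hull m = {}"
      using edgeM'[OF \<open>e \<in> M'\<close>] \<open>m \<in> M\<close> by blast
    have zxy: "z \<in> {W x, W y}" using z hull_pair[of z "W x" "W y"] xy(1,4) by blast
    then have "z \<in> e" using xy(1) by simp
    from zxy obtain u where u: "z = W u" "fst u \<in> M" using xy(2,3) by blast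
    have "z \<in> m"
    proof (cases "fst u = m")
      case True
      then show ?thesis using W_mem[OF u(2)] u(1) by simp
    next
      case False
      then have "convex hull fst u \<inter> convex hull m \<subseteq> fst u \<inter> m"
        using ncM u(2) \<open>m \<in> M\<close> by (simp add: non_crossing_def)
      then show ?thesis using vertex_hull[OF u(2)] z u(1) by blast
    qed
    then show "z \<in> e \<inter> m" using \<open>z \<in> e\<close> by simp
  qed
  \<comment> \<open>The insides of two new segments are disjoint. An end of one cannot be inside the
    other either, because it lies on an edge of \<open>M\<close>, and the inside of a new segment
    avoids all of these. Only common ends remain.\<close>
  have nc_new: "convex hull e \<inter> convex hull f \<subseteq> e \<inter> f" if ef: "e \<in> M'" "f \<in> M'" "e \<noteq> f" for e f
  proof
    fix z assume z: "z \<in> convex hull e \<inter> convex hull f"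
    obtain x y where xy: "{x, y} \<in> E" "e = {W x, W y}" "fst x \<in> M" "fst y \<in> M"
      "\<forall>i\<in>M. open_segment (W x) (W y) \<inter> convex hull i = {}" using edgeM'[OF ef(1)] by (elim exE conjE) (rule that; assumption)
    obtain u v where uv: "{u, v} \<in> E" "f = {W u, W v}" "fst u \<in> M" "fst v \<in> M"
      "\<forall>i\<in>M. open_segment (W u) (W v) \<inter> convex hull i = {}" using edgeM'[OF ef(2)] by (elim exE conjE) (rule that; assumption)
    have "{x, y} \<noteq> {u, v}"
    proof
      assume "{x, y} = {u, v}"
      then have "W ` {x, y} = W ` {u, v}" by simp
      then show False using ef(3) xy(2) uv(2) by simp
    qed
    then have "z \<notin> open_segment (W x) (W y) \<or> z \<notin> open_segment (W u) (W v)"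
      using crossE[OF xy(1) uv(1)] by blast
    moreover have "z \<in> {W x, W y} \<or> z \<in> open_segment (W x) (W y)" "z \<in> {W u, W v} \<or> z \<in> open_segment (W u) (W v)"
      using z hull_pair[of z "W x" "W y"] hull_pair[of z "W u" "W v"] unfolding xy(2) uv(2) by simp_all
    moreover have "z \<notin> open_segment (W u) (W v)" if "z \<in> {W x, W y}"
      using that uv(5) xy(3,4) vertex_hull by blast
    moreover have "z \<notin> open_segment (W x) (W y)" if "z \<in> {W u, W v}"
      using that xy(5) uv(3,4) vertex_hull by blast
    ultimately have "z \<in> {W x, W y} \<and> z \<in> {W u, W v}" by blast
    then show "z \<in> e \<inter> f" using xy(2) uv(2) by simp
  qed
  have ncU: "non_crossing (M \<union> M')"
    unfolding non_crossing_def
  proof (intro ballI impI)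
    fix e f assume ef: "e \<in> M \<union> M'" "f \<in> M \<union> M'" "e \<noteq> f"
    consider "e \<in> M" "f \<in> M" | "e \<in> M'" "f \<in> M" | "e \<in> M" "f \<in> M'" | "e \<in> M'" "f \<in> M'" using ef by blast
    then show "convex hull e \<inter> convex hull f \<subseteq> e \<inter> f"
    proof cases
      case 1
      then show ?thesis using ncM ef(3) by (simp add: non_crossing_def)
    next
      case 2
      then show ?thesis by (rule nc_mixed)
    next
      case 3
      then show ?thesis using nc_mixed[of f e] by (simp add: Int_commute)
    next
      case 4
      then show ?thesis using nc_new ef(3) by blast
    qed
  qed
  have gg': "geometric_graph S M'"
    unfolding geometric_graph_def
  proof (intro conjI ballI assms(1))
    fix e assume "e \<in> M'"
    then obtain x y where "e = {W x, W y}" "W x \<noteq> W y" "fst x \<in> M" "fst y \<in> M"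
      using edgeM'[OF \<open>e \<in> M'\<close>] by (elim exE conjE) (rule that; assumption)
    then show "\<exists>a\<in>S. \<exists>b\<in>S. a \<noteq> b \<and> e = {a, b}" using W_S by blast
  qed
  have "non_crossing M'"
    unfolding non_crossing_def by (intro ballI impI) (rule nc_new)
  with gg' have ncg': "non_crossing_geometric_graph S M'" by (simp add: non_crossing_geometric_graph_def)
  have subM': "e \<subseteq> S" if "e \<in> M'" for e
  proof -
    have "\<exists>a\<in>S. \<exists>b\<in>S. a \<noteq> b \<and> e = {a, b}" using gg' that by (simp add: geometric_graph_def)
    then show ?thesis by auto
  qed
  have "M' \<subseteq> Pow S" by (rule subsetI, rule PowI, rule subM')
  then have finM': "finite M'" using assms(1) finite_subset by auto
  have deg: "degree M' v \<le> 1" for v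
  proof -
    have "\<forall>e\<in>{e \<in> M'. v \<in> e}. \<forall>f\<in>{e \<in> M'. v \<in> e}. e = f"
      by (intro ballI, rule shareM'[of _ _ v]) simp_all
    then show ?thesis unfolding degree_def using finM' by (simp add: card_le_Suc0_iff_eq)
  qed
  have "inj_on (image W) E"
  proof (rule inj_onI)
    fix e f assume ef: "e \<in> E" "f \<in> E" "W ` e = W ` f"
    obtain x where x: "x \<in> e" using pairE[OF ef(1)] by auto
    then have "W x \<in> W ` f" using ef(3) by auto
    then obtain y where y: "W x = W y" "y \<in> f" by (rule imageE)
    have "x = y" by (rule W_inj[OF EM[OF ef(1) x] EM[OF ef(2) y(2)] y(1)])
    then have "e \<inter> f \<noteq> {}" using x y(2) by auto
    then show "e = f" using disjointD[OF disjE ef(1,2)] by metis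
  qed
  then have "card M' = card E" unfolding M'_def by (rule card_image)
  then have "5 * card M' + 1 \<ge> 4 * n" using E cardM by simp
  then have "real (4 * n) \<le> real (5 * card M' + 1)" by (rule of_nat_mono)
  then have "real (card M') \<ge> (1 / 5) * (4 * real n - 1)" by simp
  moreover have "M \<inter> M' = {}"
  proof -
    \<comment> \<open>A common edge would be the edge of \<open>M\<close> at each of its two ends,
      but a new edge joins ends of different edges of \<open>M\<close>.\<close>
    have False if e: "e \<in> M" "e \<in> M'" for e
    proof -
      obtain x y where xy: "e = {W x, W y}" "fst x \<in> M" "fst y \<in> M" "fst x \<noteq> fst y"
        using edgeM'[OF e(2)] by (elim exE conjE) (rule that; assumption)
      have "e = fst x" "e = fst y"
        using uniqueM[OF e(1) xy(2), of "W x"] uniqueM[OF e(1) xy(3), of "W y"] W_mem xy by auto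
      then show False using xy(4) by simp
    qed
    then show ?thesis by blast
  qed
  moreover have "matching S M'" using ncg' deg by (simp add: matching_def)
  moreover have "compatible S M M'" using ncgM ncg' ncU by (simp add: compatible_def)
  ultimately show ?thesis by blast
qed

end
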